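(* Let $M=\{1^{k_{1}},2^{k_{2}},\ldots,m^{k_{m}}\}$ be a multiset with $k_{i}\geq1$ for all $i\in[m]$, and let $\mathcal{P}_{M}$ be the set of words in $\mathfrak{S}_{M}$ in which the last occurrences of $1,2,\ldots,m$ occur in this order (from left to right). Then for every positive integer $d$ and every positive integer $r$, \[ \sum_{w\in\mathcal{P}_{M}}q^{\mathrm{INV}(w)}=\sum_{w\in\mathcal{P}_{M}}q^{\mathrm{MAJ}(w)}=\sum_{w\in\mathcal{P}_{M}}q^{\mathrm{MAJ}_{d}(w)}=\sum_{w\in\mathcal{P}_{M}}q^{\mathrm{Z}(w)}=\sum_{w\in\mathcal{P}_{M}}q^{r\text{-}\mathrm{MAJ}(w)}=\sum_{w\in\mathcal{P}_{M}}q^{\mathrm{DEN}(w)}=\sum_{w\in\mathcal{P}_{M}}q^{\mathrm{MAK}(w)}=\sum_{w\in\mathcal{P}_{M}}q^{\mathrm{MAD}(w)}. \]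
   Context: $M=\{1^{k_1},\dots,m^{k_m}\}$ denotes the multiset with $k_i$ copies of $i$; $n=k_1+\dots+k_m$; $\mathfrak{S}_M$ is the set of words $w=w_1\cdots w_n$ that are rearrangements of $M$. (Via the representation of a set partition of $[n]$ with blocks $B_1,\dots,B_m$, $\max B_1<\dots<\max B_m$, $|B_i|=k_i$, by the word $w$ with $i\in B_{w_i}$, $\mathcal{P}_M$ is exactly the set of partitions of $[n]$ of type $(k_1,\dots,k_m)$.) Statistics, for $w=w_1\cdots w_n$: - $\mathrm{INV}(w)=|\{(i,j):i<j,\ w_i>w_j\}|$; $\mathrm{Des}(w)=\{i\in[n-1]:w_i>w_{i+1}\}$; $\mathrm{MAJ}(w)=\sum_{i\in\mathrm{Des}(w)}i$. - $\mathrm{MAJ}_d(w)=|\{(i,j):i<j<i+d,\ w_i>w_j\}|+\sum_{i:\,w_i>w_{i+d}} i$. - $\mathrm{Z}(w)=\sum_{i<j}\mathrm{MAJ}(w_{ij})$, where $w_{ij}$ is the subword of $w$ obtained by deleting all letters other than $i$ and $j$. - $r\text{-}\mathrm{MAJ}(w)=|\{(i,j):i<j,\ w_i-r<w_j<w_i\}|+\sum_{i\in[n-1]:\,w_i\ge w_{i+1}+r} i$. - Let $a_1a_2\cdots a_n$ be the nondecreasing rearrangement of $w$. An excedance place is an $i$ with $w_i>a_i$; $\mathrm{Exc}\,w$ is the subword of $w$ consisting of the letters $w_i$ at excedance places, and $\mathrm{Nexc}\,w$ the subword of the remaining letters. With $\mathrm{imv}(u)=|\{(i,j):i<j,\ u_i\ge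 u_j\}|$, $\mathrm{DEN}(w)=\sum_{i:\,w_i>a_i}i+\mathrm{imv}(\mathrm{Exc}\,w)+\mathrm{INV}(\mathrm{Nexc}\,w)$. - The height $h(a)$ of a letter $a$ is one more than the number of letters of $w$ strictly smaller than $a$; the value of the $i$th letter is $v_i=h(w_i)+|\{j<i:w_j=w_i\}|$. For a descent $i$, $w_i$ is a descent top and $w_{i+1}$ a descent bottom. $\mathrm{Dtop}(w)$ is the sum of the heights of the descent tops, $\mathrm{Dbot}(w)$ the sum of the values of the descent bottoms, $\mathrm{Ddif}=\mathrm{Dtop}-\mathrm{Dbot}$. Cut $w$ into descent blocks by placing a dash between $w_i$ and $w_{i+1}$ whenever $w_i\le w_{i+1}$; a descent block with at least two letters is proper, its leftmost letter is its closer $C(B)$ and its rightmost letter its opener $O(B)$; a letter $a$ is embraced by $B$ if $C(B)\ge a>O(B)$. The right embracing number $e_i$ is the number of descent blocks strictly to the right of $w_i$ that embrace $w_i$; $\mathrm{Res}(w)=\sum_i e_i$. Then $\mathrm{MAK}(w)=\mathrm{Dbot}(w)+\mathrm{Res}(w)$ and $\mathrm{MAD}(w)=\mathrm{Ddif}(w)+\mathrm{Res}(w)$. *)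

theory Defs
  imports
    "HOL-Computational_Algebra.Polynomial"
    "HOL-Combinatorics.Multiset_Permutations"
begin

text \<open>
  Words are lists of natural numbers. List positions are counted from 0, so the letter
  at position \<open>i\<close> of the mathematical text is \<open>w ! (i - 1)\<close>; wherever a statistic adds up
  positions, list index \<open>i\<close> therefore contributes \<open>Suc i\<close>.
\<close>

definition type_mset :: "nat \<Rightarrow> (nat \<Rightarrow> nat) \<Rightarrow> nat multiset" where
  "type_mset m k = (\<Sum>i\<in>{1..m}. replicate_mset (k i) i)"

definition last_occ :: "nat list \<Rightarrow> nat \<Rightarrow> nat" where
  "last_occ w a = Max {i. i < length w \<and> w ! i = a}"

definition partition_words :: "nat \<Rightarrow> (nat \<Rightarrow> nat) \<Rightarrow> nat list set" where
  "partition_words m k =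
     {w \<in> permutations_of_multiset (type_mset m k). strict_mono_on {1..m} (last_occ w)}"

definition INV :: "nat list \<Rightarrow> nat" where
  "INV w = card {(i, j). i < j \<and> j < length w \<and> w ! i > w ! j}"

definition Des :: "nat list \<Rightarrow> nat set" where
  "Des w = {i. Suc i < length w \<and> w ! i > w ! Suc i}"

definition MAJ :: "nat list \<Rightarrow> nat" where
  "MAJ w = (\<Sum>i\<in>Des w. Suc i)"

definition MAJd :: "nat \<Rightarrow> nat list \<Rightarrow> nat" where
  "MAJd d w =
     card {(i, j). i < j \<and> j < i + d \<and> j < length w \<and> w ! i > w ! j}
     + (\<Sum>i\<in>{i. i + d < length w \<and> w ! i > w ! (i + d)}. Suc i)"

definition Zstat :: "nat list \<Rightarrow> nat" where
  "Zstat w = (\<Sum>(a, b)\<in>{(a, b). a \<in> set w \<and> b \<in> set w \<and> a < b}.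
     MAJ (filter (\<lambda>x. x = a \<or> x = b) w))"

text \<open>The condition \<open>w\<^sub>i - r < w\<^sub>j\<close> is written without subtraction, which truncates on \<^typ>\<open>nat\<close>.\<close>

definition rMAJ :: "nat \<Rightarrow> nat list \<Rightarrow> nat" where
  "rMAJ r w =
     card {(i, j). i < j \<and> j < length w \<and> w ! i < w ! j + r \<and> w ! j < w ! i}
     + (\<Sum>i\<in>{i. Suc i < length w \<and> w ! i \<ge> w ! Suc i + r}. Suc i)"

definition imv :: "nat list \<Rightarrow> nat" where
  "imv u = card {(i, j). i < j \<and> j < length u \<and> u ! i \<ge> u ! j}"

definition exc_places :: "nat list \<Rightarrow> nat set" where
  "exc_places w = {i. i < length w \<and> w ! i > sort w ! i}"

definition Exc :: "nat list \<Rightarrow> nat list" where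
  "Exc w = nths w (exc_places w)"

definition Nexc :: "nat list \<Rightarrow> nat list" where
  "Nexc w = nths w (- exc_places w)"

definition DEN :: "nat list \<Rightarrow> nat" where
  "DEN w = (\<Sum>i\<in>exc_places w. Suc i) + imv (Exc w) + INV (Nexc w)"

definition height :: "nat list \<Rightarrow> nat \<Rightarrow> nat" where
  "height w a = Suc (card {j. j < length w \<and> w ! j < a})"

definition letter_value :: "nat list \<Rightarrow> nat \<Rightarrow> nat" where
  "letter_value w i = height w (w ! i) + card {j. j < i \<and> w ! j = w ! i}"

definition Dtop :: "nat list \<Rightarrow> nat" where
  "Dtop w = (\<Sum>i\<in>Des w. height w (w ! i))"

definition Dbot :: "nat list \<Rightarrow> nat" where
  "Dbot w = (\<Sum>i\<in>Des w. letter_value w (Suc i))"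

lemma Dbot_le_Dtop: "Dbot w \<le> Dtop w"
  unfolding Dbot_def Dtop_def
proof (rule sum_mono)
  fix i assume i: "i \<in> Des w"
  let ?A = "{j. j < length w \<and> w ! j < w ! Suc i}"
  let ?B = "{j. j < Suc i \<and> w ! j = w ! Suc i}"
  have "card ?A + card ?B = card (?A \<union> ?B)"
    by (rule card_Un_disjoint[symmetric]) auto
  also have "\<dots> \<le> card {j. j < length w \<and> w ! j < w ! i}"
    using i by (intro card_mono) (auto simp: Des_def)
  finally show "letter_value w (Suc i) \<le> height w (w ! i)"
    by (simp add: letter_value_def height_def)
qed

text \<open>By \<open>Dbot_le_Dtop\<close> the subtraction is not truncated.\<close>

definition Ddif :: "nat list \<Rightarrow> nat" where
  "Ddif w = Dtop w - Dbot w"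

text \<open>
  A descent block, i.e. a maximal strictly decreasing run of consecutive letters, is
  given by its first and last list index \<open>(a, b)\<close>; its closer is \<open>w ! a\<close> and its opener
  \<open>w ! b\<close>. Blocks of a single letter are included.
\<close>

definition descent_blocks :: "nat list \<Rightarrow> (nat \<times> nat) set" where
  "descent_blocks w = {(a, b). a \<le> b \<and> b < length w
     \<and> (\<forall>p. a \<le> p \<and> p < b \<longrightarrow> w ! p > w ! Suc p)
     \<and> (a > 0 \<longrightarrow> w ! (a - 1) \<le> w ! a)
     \<and> (Suc b < length w \<longrightarrow> w ! b \<le> w ! Suc b)}"

text \<open>
  A block of a single letter has its closer equal to its opener and so embraces nothing;
  hence properness (\<open>a < b\<close>) need not be required here.
\<close>

definition embraces :: "nat list \<Rightarrow> nat \<times> nat \<Rightarrow> nat \<Rightarrow> bool" where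
  "embraces w = (\<lambda>(a, b) x. w ! a \<ge> x \<and> x > w ! b)"

definition right_embracing :: "nat list \<Rightarrow> nat \<Rightarrow> nat" where
  "right_embracing w i = card {B \<in> descent_blocks w. i < fst B \<and> embraces w B (w ! i)}"

definition Res :: "nat list \<Rightarrow> nat" where
  "Res w = (\<Sum>i<length w. right_embracing w i)"

definition MAK :: "nat list \<Rightarrow> nat" where
  "MAK w = Dbot w + Res w"

definition MAD :: "nat list \<Rightarrow> nat" where
  "MAD w = Ddif w + Res w"

text \<open>The polynomial \<open>\<Sum>w\<in>P. q ^ st w\<close> in the indeterminate \<open>q\<close>.\<close>

definition gen_poly :: "nat list set \<Rightarrow> (nat list \<Rightarrow> nat) \<Rightarrow> int poly" where
  "gen_poly P st = (\<Sum>w\<in>P. monom 1 (st w))"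

end

theory Submission
  imports Defs
begin

text \<open>
  Every one of the generating functions equals the product over \<open>i\<close> of the Gaussian binomial coefficients
  with upper index \<open>k\<^sub>1 + \<dots> + k\<^sub>i - 1\<close> and lower index \<open>k\<^sub>i - 1\<close>.

  For \<open>INV\<close> this is the insertion of the copies of the largest letter, the last of which is forced to
  the end. \<open>MAJ\<close>, \<open>MAJd\<close> and \<open>rMAJ\<close> are instances of one statistic \<open>MAJdr\<close> that has, for each choice of
  the last \<open>d\<close> letters, the same distribution as \<open>INV\<close>; this follows by induction on the length, as in
  Foata's second fundamental transformation.

  For \<open>Zstat\<close> the words are classified by the order of the last occurrences of all their letters.
  Removing the last letter yields a recursion between the generating functions of the classes, and these
  have a product formula for every order, not only for the increasing one.

  Inserting the largest letter changes \<open>MAK\<close>, \<open>MAD\<close> and \<open>DEN\<close> by an amount that depends on the whole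
  word. The remedy is to insert, besides the letters, an arbitrary number \<open>t\<close> of virtual letters larger than all
  others, each of which must be a descent top (respectively an excedance). Weighted by \<open>y ^ t\<close>, the
  virtual letters contribute the factor \<open>(1 + y * q) * (1 + y * q\<^sup>2) * \<dots> * (1 + y * q ^ n)\<close> for words of length \<open>n\<close>,
  and the induction step turns some of the virtual letters into copies of the next letter.
\<close>

text \<open>The restriction on last occurrences survives each recursion for its own reason. For the
  largest letter it only says that the word ends in it. In the induction for \<open>MAJdr\<close>, a
  letter larger than some \<open>y\<close> of the fixed suffix must occur again in that suffix, so
  it can be moved freely among the smaller letters in front. The power \<open>y ^ t\<close> is
  replaced by an arbitrary function of \<open>t\<close>. Turning virtual letters into copies of the
  next letter is then a linear operator on such functions, \<open>msum\<close>, and the functional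
  that the product of the factors \<open>1 + y * q ^ l\<close> defines is an eigenvector of it, with
  a Gaussian binomial coefficient as eigenvalue (\<open>esum_msum\<close>). \<open>MAK\<close>,
  \<open>MAD\<close> and \<open>DEN\<close> lead to the same operator, although their words are
  taken apart differently. The function that is 1 at 0 and 0 elsewhere finally discards all words
  with virtual letters. All sums live in an arbitrary commutative semiring. Identities between
  Gaussian binomial coefficients therefore come from Pascal rules and not from quotients of
  q-factorials.\<close>

section \<open>Gaussian binomial coefficients\<close>

text \<open>\<open>gbinom q s l\<close> is the Gaussian binomial coefficient with upper index \<open>s + l\<close> and lower index \<open>l\<close>.\<close>

fun gbinom :: "'a::comm_semiring_1 \<Rightarrow> nat \<Rightarrow> nat \<Rightarrow> 'a" where
  "gbinom q 0 l = 1"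
| "gbinom q (Suc s) 0 = 1"
| "gbinom q (Suc s) (Suc l) = gbinom q s (Suc l) + q ^ Suc s * gbinom q (Suc s) l"

lemma gbinom_0_right [simp]: "gbinom q s 0 = 1"
  by (cases s) simp_all

text \<open>The dual Pascal rule. After the defining rule has been applied once, the dual rule for
  smaller arguments expands both terms, and the result regroups by the defining rule.\<close>

lemma gbinom_Suc_Suc':
  "gbinom q (Suc s) (Suc l) = q ^ Suc l * gbinom q s (Suc l) + gbinom q (Suc s) l"
proof (induction "s + l" arbitrary: s l rule: less_induct)
  case less
  have 1: "gbinom q s (Suc l) = (if s = 0 then 1 else q ^ Suc l * gbinom q (s - 1) (Suc l) + gbinom q s l)"
    using less[of "s - 1" l] by (cases s) auto
  have 2: "gbinom q (Suc s) l = (if l = 0 then 1 else q ^ l * gbinom q s l + gbinom q (Suc s) (l - 1))"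
    using less[of s "l - 1"] by (cases l) auto
  show ?case
  proof (cases s; cases l)
    fix s' l' assume [simp]: "s = Suc s'" "l = Suc l'"
    have "gbinom q (Suc s) (Suc l) = gbinom q s (Suc l) + q ^ Suc s * gbinom q (Suc s) l"
      by simp
    also have "\<dots> = q ^ Suc l * (gbinom q s' (Suc l) + q ^ s * gbinom q s l)
        + (gbinom q s l + q ^ Suc s * gbinom q (Suc s) l')"
      unfolding 1 2 by (simp add: algebra_simps del: gbinom.simps)
    finally show ?thesis by simp
  next
    fix l' assume [simp]: "s = 0" "l = Suc l'"
    have 3: "gbinom q (Suc s) l = 1 + q * gbinom q (Suc s) l'"
      by simp
    have "gbinom q (Suc s) (Suc l) = 1 + q * gbinom q (Suc s) l"
      by simp
    also have "\<dots> = q ^ Suc l + (1 + q * gbinom q (Suc s) l')"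
      unfolding 2 by (simp add: algebra_simps)
    also have "\<dots> = q ^ Suc l * gbinom q s (Suc l) + gbinom q (Suc s) l"
      unfolding 3 by simp
    finally show ?thesis .
  next
    fix s' assume [simp]: "s = Suc s'" "l = 0"
    have 3: "gbinom q s (Suc l) = gbinom q s' (Suc l) + q ^ s"
      by simp
    have "gbinom q (Suc s) (Suc l) = gbinom q s (Suc l) + q ^ Suc s"
      by simp
    also have "\<dots> = q * (gbinom q s' (Suc l) + q ^ s) + 1"
      unfolding 1 by (simp add: algebra_simps)
    also have "\<dots> = q ^ Suc l * gbinom q s (Suc l) + gbinom q (Suc s) l"
      unfolding 3 by simp
    finally show ?thesis .
  qed (simp add: add.commute)
qed

lemma gbinom_commute: "gbinom q s l = gbinom q l s"
proof (induction q s l rule: gbinom.induct)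
  case (3 q s l)
  then show ?case by (simp add: gbinom_Suc_Suc'[of q l s] add.commute del: gbinom.simps(3)) simp
qed simp_all

text \<open>Both sides are the q-trinomial coefficient of \<open>a\<close>, \<open>b\<close>,
  \<open>c\<close>. Splitting off one element by the two Pascal rules gives the same three-term
  recursion on either side.\<close>

lemma gbinom_trinomial:
  "gbinom q (a + b) c * gbinom q a b = gbinom q a c * gbinom q (a + c) b"
proof (induction "a + b + c" arbitrary: a b c rule: less_induct)
  case less
  show ?case
  proof (cases "a = 0 \<or> b = 0 \<or> c = 0")
    case True
    then show ?thesis by (auto simp: gbinom_commute)
  next
    case False
    then obtain a' b' c' where [simp]: "a = Suc a'" "b = Suc b'" "c = Suc c'"
      by (metis not0_implies_Suc)
    have i1: "gbinom q (a + b') c * gbinom q a b' = gbinom q a c * gbinom q (a + c) b'"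
      by (rule less) simp
    have i2: "gbinom q (a' + b) c * gbinom q a' b = gbinom q a' c * gbinom q (a' + c) b"
      by (rule less) simp
    have i3: "gbinom q (a + b) c' * gbinom q a b = gbinom q a c' * gbinom q (a' + c) b"
      using less[of a b c'] by simp
    have 1: "gbinom q (a + b) c = gbinom q (a' + b) c + q ^ (a + b) * gbinom q (a + b) c'"
      by simp
    have 2: "gbinom q a b = q ^ b * gbinom q a' b + gbinom q a b'"
      using gbinom_Suc_Suc'[of q a' b'] by simp
    have "gbinom q (a + b) c * gbinom q a b
       = gbinom q (a' + b) c * gbinom q a b + q ^ (a + b) * (gbinom q (a + b) c' * gbinom q a b)"
      by (subst 1) (simp only: distrib_right mult.assoc)
    also have "gbinom q (a' + b) c * gbinom q a b
       = gbinom q (a' + b) c * (q ^ b * gbinom q a' b + gbinom q a b')"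
      by (subst 2) (rule refl)
    also have "gbinom q (a' + b) c * (q ^ b * gbinom q a' b + gbinom q a b')
         + q ^ (a + b) * (gbinom q (a + b) c' * gbinom q a b)
       = q ^ b * (gbinom q (a' + b) c * gbinom q a' b) + gbinom q (a + b') c * gbinom q a b'
         + q ^ (a + b) * (gbinom q (a + b) c' * gbinom q a b)"
      by (simp only: algebra_simps add_Suc) (simp only: \<open>a = Suc a'\<close> \<open>b = Suc b'\<close> add_Suc add_Suc_right)
    also have "\<dots> = q ^ b * (gbinom q a' c * gbinom q (a' + c) b) + gbinom q a c * gbinom q (a + c) b'
         + q ^ (a + b) * (gbinom q a c' * gbinom q (a' + c) b)"
      unfolding i1 i2 i3 ..
    also have "\<dots> = q ^ b * (gbinom q (a' + c) b * (gbinom q a' c + q ^ a * gbinom q a c')) + gbinom q a c * gbinom q (a + c) b'"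
      by (simp only: algebra_simps power_add)
    also have "gbinom q a' c + q ^ a * gbinom q a c' = gbinom q a c"
      by simp
    also have "q ^ b * (gbinom q (a' + c) b * gbinom q a c) + gbinom q a c * gbinom q (a + c) b'
        = gbinom q a c * (q ^ b * gbinom q (a' + c) b + gbinom q (a + c) b')"
      by (simp only: algebra_simps)
    also have "q ^ b * gbinom q (a' + c) b + gbinom q (a + c) b' = gbinom q (a + c) b"
      using gbinom_Suc_Suc'[of q "a' + c" b'] by simp
    finally show ?thesis .
  qed
qed

section \<open>Counting pairs of positions\<close>

definition pairs :: "('a \<Rightarrow> 'a \<Rightarrow> bool) \<Rightarrow> 'a list \<Rightarrow> nat" where
  "pairs R w = card {(i, j). i < j \<and> j < length w \<and> R (w ! i) (w ! j)}"

lemma INV_eq_pairs: "INV w = pairs (>) w"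
  by (simp add: INV_def pairs_def)

lemma imv_eq_pairs: "imv w = pairs (\<ge>) w"
  by (simp add: imv_def pairs_def)

lemma finite_pairs [simp]: "finite {(i, j). i < j \<and> j < (n::nat) \<and> Q i j}"
  by (rule finite_subset[of _ "{..<n} \<times> {..<n}"]) auto

lemma pairs_Nil [simp]: "pairs R [] = 0"
  by (simp add: pairs_def)

lemma pairs_Cons [simp]: "pairs R (a # w) = length (filter (R a) w) + pairs R w"
proof -
  let ?A = "{j. j < length w \<and> R a (w ! j)}"
  let ?B = "{(i, j). i < j \<and> j < length w \<and> R (w ! i) (w ! j)}"
  have "{(i, j). i < j \<and> j < length (a # w) \<and> R ((a # w) ! i) ((a # w) ! j)}
      = (\<lambda>j. (0, Suc j)) ` ?A \<union> (\<lambda>(i, j). (Suc i, Suc j)) ` ?B" (is "?L = ?R")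
  proof (intro equalityI subsetI)
    fix x assume "x \<in> ?L"
    then obtain i j where x: "x = (i, j)" "i < j" "j < Suc (length w)" "R ((a # w) ! i) ((a # w) ! j)"
      by auto
    then obtain j' where "j = Suc j'" by (cases j) auto
    with x show "x \<in> ?R" by (cases i) (auto simp: image_iff)
  qed auto
  moreover have "card ((\<lambda>j. (0::nat, Suc j)) ` ?A \<union> (\<lambda>(i, j). (Suc i, Suc j)) ` ?B) = card ?A + card ?B"
    by (subst card_Un_disjoint) (auto simp: card_image inj_on_def)
  ultimately show ?thesis
    by (simp add: pairs_def length_filter_conv_card)
qed

lemma pairs_eq_0: "(\<And>a b. a \<in> set w \<Longrightarrow> b \<in> set w \<Longrightarrow> \<not> R a b) \<Longrightarrow> pairs R w = 0"
  by (induction w) (auto simp: filter_empty_conv)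

lemma pairs_append:
  "pairs R (u @ v) = pairs R u + pairs R v + (\<Sum>a\<leftarrow>u. length (filter (R a) v))"
  by (induction u) auto

text \<open>A letter below \<open>t\<close> in front of one that is not is never an inversion, so
  only one kind of mixed pair remains.\<close>

lemma pairs_filter_split:
  fixes w :: "'a::linorder list"
  shows "pairs (>) w = pairs (>) (filter (\<lambda>a. a < t) w) + pairs (>) (filter (\<lambda>a. \<not> a < t) w)
    + pairs (\<lambda>a b. \<not> a < t \<and> b < t) w"
proof (induction w)
  case (Cons a w)
  have "length (filter ((>) a) w) = length (filter ((>) a) (filter (\<lambda>a. a < t) w))
      + length (filter ((>) a) (filter (\<lambda>a. \<not> a < t) w))"
    by (induction w) auto
  moreover have "length (filter ((>) a) (filter (\<lambda>a. \<not> a < t) w)) = 0" if "a < t"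
    using that by (auto simp: filter_empty_conv)
  moreover have "filter ((>) a) (filter (\<lambda>a. a < t) w) = filter (\<lambda>b. b < t) w" if "\<not> a < t"
    using that by (auto intro!: filter_cong)
  ultimately show ?case using Cons by auto
qed simp

section \<open>Sums over shuffles\<close>

abbreviation cross :: "('a \<Rightarrow> bool) \<Rightarrow> 'a list \<Rightarrow> nat" where
  "cross P \<equiv> pairs (\<lambda>a b. \<not> P a \<and> P b)"

lemma sum_shuffles_Cons:
  assumes "x \<noteq> y"
  shows "(\<Sum>p\<in>shuffles (x # xs) (y # ys). f p)
    = (\<Sum>p\<in>shuffles xs (y # ys). f (x # p)) + (\<Sum>p\<in>shuffles (x # xs) ys. f (y # p))"
proof -
  have "(\<Sum>p\<in>shuffles (x # xs) (y # ys). f p)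
    = sum f ((#) x ` shuffles xs (y # ys)) + sum f ((#) y ` shuffles (x # xs) ys)"
    unfolding shuffles.simps by (rule sum.union_disjoint) (use assms in auto)
  then show ?thesis by (simp add: sum.reindex)
qed

text \<open>A final letter from \<open>xs\<close> forms a crossing with every letter of
  \<open>ys\<close>, hence the factor \<open>q ^ length ys\<close>; a final letter from
  \<open>ys\<close> forms none. The rest is an arbitrary shuffle. The weights \<alpha> and \<beta>
  allow both the selection of a final letter (0 and 1) and the extra power of \<open>q\<close> in
  \<open>sum_INV_last\<close>.\<close>

lemma sum_shuffles_last:
  fixes q \<alpha> \<beta> :: "'a::comm_semiring_1"
  assumes "\<forall>x\<in>set xs. P x" "\<forall>y\<in>set ys. \<not> P y" "xs \<noteq> [] \<or> ys \<noteq> []"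
  shows "(\<Sum>p\<in>shuffles xs ys. q ^ cross P p * (if P (last p) then \<alpha> else \<beta>))
    = (if xs = [] then 0 else q ^ length ys * gbinom q (length xs - 1) (length ys) * \<alpha>)
      + (if ys = [] then 0 else gbinom q (length xs) (length ys - 1) * \<beta>)"
  using assms
proof (induction xs ys rule: shuffles.induct)
  case (1 ys)
  then have "cross P ys = 0"
    by (intro pairs_eq_0) auto
  moreover have "\<not> P (last ys)" using 1 by auto
  ultimately show ?case using 1 by auto
next
  case (2 xs)
  then have "cross P xs = 0"
    by (intro pairs_eq_0) auto
  moreover have "P (last xs)" using 2 by auto
  ultimately show ?case using 2 by (cases xs) auto
next
  case (3 x xs y ys)
  let ?g = "\<lambda>p. q ^ cross P p * (if P (last p) then \<alpha> else \<beta>)"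
  have xy: "P x" "\<not> P y" "x \<noteq> y" using 3 by auto
  have g1: "?g (x # p) = ?g p" if "p \<in> shuffles xs (y # ys)" for p
    using that xy by auto
  have g2: "?g (y # p) = q ^ length (x # xs) * ?g p" if "p \<in> shuffles (x # xs) ys" for p
  proof -
    have "filter P p = x # xs"
      using filter_shuffles[of P "x # xs" ys] that 3 xy by (force simp: filter_id_conv)
    moreover have "p \<noteq> []" using that by auto
    ultimately show ?thesis using xy by (simp add: power_add mult.assoc)
  qed
  have "(\<Sum>p\<in>shuffles (x # xs) (y # ys). ?g p) = (\<Sum>p\<in>shuffles xs (y # ys). ?g p)
      + q ^ length (x # xs) * (\<Sum>p\<in>shuffles (x # xs) ys. ?g p)"
    by (simp only: sum_shuffles_Cons[OF xy(3)] sum_distrib_left g1 g2 cong: sum.cong)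
  also have "(\<Sum>p\<in>shuffles xs (y # ys). ?g p)
     = (if xs = [] then 0 else q ^ Suc (length ys) * gbinom q (length xs - 1) (Suc (length ys)) * \<alpha>)
      + gbinom q (length xs) (length ys) * \<beta>"
    using 3 by simp
  also have "(\<Sum>p\<in>shuffles (x # xs) ys. ?g p)
     = q ^ length ys * gbinom q (length xs) (length ys) * \<alpha>
      + (if ys = [] then 0 else gbinom q (Suc (length xs)) (length ys - 1) * \<beta>)"
    using 3 by simp
  finally have eq: "(\<Sum>p\<in>shuffles (x # xs) (y # ys). ?g p)
    = ((if xs = [] then 0 else q ^ Suc (length ys) * gbinom q (length xs - 1) (Suc (length ys)) * \<alpha>)
       + q ^ length (x # xs) * (q ^ length ys * gbinom q (length xs) (length ys) * \<alpha>))
      + (gbinom q (length xs) (length ys) * \<beta>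
       + q ^ length (x # xs) * (if ys = [] then 0 else gbinom q (Suc (length xs)) (length ys - 1) * \<beta>))"
    by (simp only: distrib_left ac_simps)
  have "(if xs = [] then 0 else q ^ Suc (length ys) * gbinom q (length xs - 1) (Suc (length ys)) * \<alpha>)
       + q ^ length (x # xs) * (q ^ length ys * gbinom q (length xs) (length ys) * \<alpha>)
     = q ^ Suc (length ys) * gbinom q (length xs) (Suc (length ys)) * \<alpha>"
    by (cases xs) (simp_all add: algebra_simps)
  moreover have "gbinom q (length xs) (length ys) * \<beta>
       + q ^ length (x # xs) * (if ys = [] then 0 else gbinom q (Suc (length xs)) (length ys - 1) * \<beta>)
     = gbinom q (Suc (length xs)) (length ys) * \<beta>"
    by (cases ys) (simp_all add: algebra_simps)
  ultimately show ?case unfolding eq by simp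
qed

lemma sum_shuffles:
  fixes q :: "'a::comm_semiring_1"
  assumes "\<forall>x\<in>set xs. P x" "\<forall>y\<in>set ys. \<not> P y"
  shows "(\<Sum>p\<in>shuffles xs ys. q ^ cross P p) = gbinom q (length xs) (length ys)"
proof (cases "xs = [] \<and> ys = []")
  case False
  then have "(\<Sum>p\<in>shuffles xs ys. q ^ cross P p)
      = (if xs = [] then 0 else q ^ length ys * gbinom q (length xs - 1) (length ys))
      + (if ys = [] then 0 else gbinom q (length xs) (length ys - 1))"
    using sum_shuffles_last[of xs P ys q 1 1] assms by simp
  then show ?thesis
    by (cases xs; cases ys) (simp_all only: length_Cons list.size(3) gbinom_Suc_Suc' diff_Suc_1,
      use False in simp_all)
qed simp

lemma shuffles_eq_filter:
  assumes "\<forall>x\<in>set xs. P x" "\<forall>y\<in>set ys. \<not> P y"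
  shows "p \<in> shuffles xs ys \<longleftrightarrow> filter P p = xs \<and> filter (\<lambda>a. \<not> P a) p = ys"
proof -
  have "shuffles xs ys = partition P -` {(xs, ys)}"
    using assms by (intro inv_image_partition[symmetric]) auto
  then show ?thesis by (simp add: o_def)
qed

section \<open>Words whose last occurrences are in increasing order\<close>

abbreviation below :: "'a::ord \<Rightarrow> 'a list \<Rightarrow> 'a list" where
  "below x \<equiv> filter (\<lambda>a. a < x)"

text \<open>A form of the condition on \<open>last_occ\<close> (see
  \<open>last_ordered_iff_strict_mono_on\<close>) without positions: it follows the recursion on
  lists and makes sense for words that contain only some of the letters.\<close>

fun last_ordered :: "nat list \<Rightarrow> bool" where
  "last_ordered [] \<longleftrightarrow> True"
| "last_ordered (a # w) \<longleftrightarrow> last_ordered w \<and> (a \<in> set w \<or> (\<forall>b\<in>set w. a < b))"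

abbreviation not_below :: "'a::ord \<Rightarrow> 'a list \<Rightarrow> 'a list" where
  "not_below x \<equiv> filter (\<lambda>a. \<not> a < x)"

text \<open>A smaller letter behind the last \<open>x\<close> would violate the order, so
  \<open>x\<close> closes the word. Every other copy of \<open>x\<close> recurs later and puts no
  condition on its surroundings.\<close>

lemma last_ordered_insert_max:
  assumes "set w \<subseteq> {..x}" "x \<in> set w"
  shows "last_ordered w \<longleftrightarrow> last_ordered (below x w) \<and> last w = x"
  using assms
proof (induction w)
  case (Cons a w)
  show ?case
  proof (cases "x \<in> set w")
    case True
    then have "w \<noteq> []" by auto
    moreover have "(\<forall>b\<in>set w. a < b) \<longleftrightarrow> (\<forall>b\<in>set w. b < x \<longrightarrow> a < b)" if "a < x"
      using that Cons.prems by (auto simp: le_less)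
    ultimately show ?thesis using Cons True by auto
  next
    case False
    then have "a = x" using Cons by auto
    with False Cons.prems show ?thesis by (cases w) (auto simp: order.order_iff_strict)
  qed
qed simp

definition ordered_words :: "nat \<Rightarrow> (nat \<Rightarrow> nat) \<Rightarrow> nat list set" where
  "ordered_words m k = {w. mset w = type_mset m k \<and> last_ordered w}"

lemma type_mset_Suc: "type_mset (Suc m) k = type_mset m k + replicate_mset (k (Suc m)) (Suc m)"
  by (simp add: type_mset_def)

lemma type_mset_0 [simp]: "type_mset 0 k = {#}"
  by (simp add: type_mset_def)

lemma size_type_mset: "size (type_mset m k) = sum k {1..m}"
  by (induction m) (auto simp: type_mset_Suc)

lemma set_type_mset: "set_mset (type_mset m k) \<subseteq> {1..m}"
  by (induction m) (fastforce simp: type_mset_Suc split: if_splits)+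

lemma finite_ordered_words [simp]: "finite (ordered_words m k)"
  by (rule finite_subset[OF _ finite_permutations_of_multiset[of "type_mset m k"]])
     (auto simp: ordered_words_def permutations_of_multiset_def)

lemma ordered_words_0 [simp]: "ordered_words 0 k = {[]}"
  by (auto simp: ordered_words_def)

lemma set_type_mset_Suc:
  assumes "mset w = type_mset (Suc m) k" "k (Suc m) \<ge> 1"
  shows "set w \<subseteq> {..Suc m}" "Suc m \<in> set w"
proof -
  have "set w = set_mset (type_mset (Suc m) k)"
    using assms(1) by (metis set_mset_mset)
  then show "set w \<subseteq> {..Suc m}" "Suc m \<in> set w"
    using set_type_mset[of "Suc m" k] assms(2) by (auto simp: type_mset_Suc)
qed

lemma ordered_words_Suc:
  assumes "k (Suc m) \<ge> 1"
  shows "w \<in> ordered_words (Suc m) k \<longleftrightarrow> below (Suc m) w \<in> ordered_words m k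
    \<and> not_below (Suc m) w = replicate (k (Suc m)) (Suc m) \<and> last w = Suc m"
    (is "_ \<longleftrightarrow> ?R")
proof
  assume w: "w \<in> ordered_words (Suc m) k"
  then have ms: "mset w = type_mset m k + replicate_mset (k (Suc m)) (Suc m)" "last_ordered w"
    by (auto simp: ordered_words_def type_mset_Suc)
  have sub: "set w \<subseteq> {..Suc m}" "Suc m \<in> set w"
    using set_type_mset_Suc[of w m k] ms assms by (auto simp: type_mset_Suc)
  have "filter_mset (\<lambda>a. a < Suc m) (type_mset m k) = type_mset m k"
    using set_type_mset[of m k] by (subst filter_mset_eq_conv) auto
  then have lt: "mset (below (Suc m) w) = type_mset m k"
    using ms by (simp add: mset_filter filter_mset_False)
  have "filter_mset (\<lambda>a. \<not> a < Suc m) (type_mset m k) = {#}"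
    using set_type_mset[of m k] by auto
  moreover have "filter_mset (\<lambda>a. \<not> a < Suc m) (replicate_mset (k (Suc m)) (Suc m)) = replicate_mset (k (Suc m)) (Suc m)"
    by (subst filter_mset_eq_conv) auto
  ultimately have ge: "mset (not_below (Suc m) w) = replicate_mset (k (Suc m)) (Suc m)"
    using ms by (simp only: mset_filter filter_union_mset add_0)
  have "not_below (Suc m) w = replicate (k (Suc m)) (Suc m)"
  proof (rule replicate_eqI)
    show "length (not_below (Suc m) w) = k (Suc m)"
      using arg_cong[OF ge, of size] by (simp only: size_mset size_replicate_mset)
    show "y = Suc m" if "y \<in> set (not_below (Suc m) w)" for y
      using that sub(1) by (simp add: subset_iff) (meson le_antisym not_less)
  qed
  then show ?R
    using last_ordered_insert_max[OF sub] ms(2) lt by (auto simp: ordered_words_def)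
next
  assume r: ?R
  have "mset w = mset (below (Suc m) w) + mset (not_below (Suc m) w)"
    by (simp add: mset_filter multiset_partition[symmetric])
  then have ms: "mset w = type_mset (Suc m) k"
    using r by (simp add: ordered_words_def type_mset_Suc)
  then have sub: "set w \<subseteq> {..Suc m}" "Suc m \<in> set w"
    using set_type_mset_Suc[OF ms assms] by auto
  show "w \<in> ordered_words (Suc m) k"
    using last_ordered_insert_max[OF sub] r ms by (auto simp: ordered_words_def)
qed

section \<open>The inversion number\<close>

definition word_poly :: "'a::comm_semiring_1 \<Rightarrow> nat \<Rightarrow> (nat \<Rightarrow> nat) \<Rightarrow> 'a" where
  "word_poly q m k = (\<Prod>i\<in>{1..m}. gbinom q (sum k {1..<i}) (k i - 1))"

lemma word_poly_0 [simp]: "word_poly q 0 k = 1"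
  by (simp add: word_poly_def)

lemma word_poly_Suc:
  "word_poly q (Suc m) k = word_poly q m k * gbinom q (sum k {1..m}) (k (Suc m) - 1)"
  by (simp add: word_poly_def atLeastLessThanSuc_atLeastAtMost mult.commute)

lemma length_ordered_word: "w \<in> ordered_words m k \<Longrightarrow> length w = sum k {1..m}"
  by (metis (mono_tags, lifting) mem_Collect_eq ordered_words_def size_mset size_type_mset)

lemma set_ordered_word: "w \<in> ordered_words m k \<Longrightarrow> set w \<subseteq> {1..m}"
  using set_type_mset[of m k] by (auto simp: ordered_words_def dest!: arg_cong[of _ _ set_mset])

lemma sum_INV:
  fixes q :: "'a::comm_semiring_1"
  assumes "\<And>i. i \<in> {1..m} \<Longrightarrow> k i \<ge> 1"
  shows "(\<Sum>w\<in>ordered_words m k. q ^ INV w) = word_poly q m k"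
  using assms
proof (induction m)
  case 0
  then show ?case by (simp add: INV_eq_pairs)
next
  case (Suc m)
  define x where "x = Suc m"
  define ys where "ys = replicate (k x) x"
  let ?P = "\<lambda>a. a < x"
  have kx: "k x \<ge> 1" using Suc.prems by (simp add: x_def)
  have ys: "\<forall>y\<in>set ys. \<not> ?P y" "ys \<noteq> []" "length ys = k x" using kx by (auto simp: ys_def)
  have fibre: "(\<Sum>w\<in>{w \<in> ordered_words x k. filter ?P w = xs}. q ^ INV w)
      = q ^ INV xs * gbinom q (sum k {1..m}) (k x - 1)" if xs: "xs \<in> ordered_words m k" for xs
  proof -
    have P: "\<forall>a\<in>set xs. ?P a" using set_ordered_word[OF xs] by (auto simp: x_def)
    have last: "last p = x \<longleftrightarrow> \<not> ?P (last p)" if "p \<in> shuffles xs ys" for p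
    proof -
      have "p \<noteq> []" "set p = set xs \<union> set ys" using that ys set_shuffles[OF that] by auto
      then have "last p \<in> set xs \<union> {x}" using kx last_in_set[of p] by (auto simp: ys_def)
      then show ?thesis using P by auto
    qed
    have set: "{w \<in> ordered_words x k. filter ?P w = xs} = {p \<in> shuffles xs ys. \<not> ?P (last p)}"
    proof -
      have "w \<in> ordered_words x k \<longleftrightarrow> filter ?P w \<in> ordered_words m k \<and> filter (\<lambda>a. \<not> ?P a) w = ys \<and> last w = x" for w
        using ordered_words_Suc[of k m w] kx by (simp add: x_def ys_def)
      then show ?thesis
        using xs last by (auto simp: shuffles_eq_filter[OF P ys(1)])
    qed
    have INV: "q ^ INV p = q ^ INV xs * q ^ cross ?P p" if "p \<in> shuffles xs ys" for p
    proof -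
      have "pairs (>) ys = 0" by (rule pairs_eq_0) (auto simp: ys_def)
      then show ?thesis
        using that pairs_filter_split[of p x] by (simp add: INV_eq_pairs shuffles_eq_filter[OF P ys(1)] power_add)
    qed
    have "(\<Sum>w\<in>{w \<in> ordered_words x k. filter ?P w = xs}. q ^ INV w)
      = (\<Sum>p\<in>shuffles xs ys. if \<not> ?P (last p) then q ^ INV p else 0)"
      unfolding set by (rule sum.inter_filter) simp
    \<comment> \<open>The weights 0 and 1 on the final letter select the shuffles that end in
      \<open>x\<close>.\<close>
    also have "\<dots> = q ^ INV xs * (\<Sum>p\<in>shuffles xs ys. q ^ cross ?P p * (if ?P (last p) then 0 else 1))"
      unfolding sum_distrib_left by (rule sum.cong) (auto simp: INV)
    also have "\<dots> = q ^ INV xs * gbinom q (sum k {1..m}) (k x - 1)"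
      using ys by (subst sum_shuffles_last[OF P ys(1)]) (simp_all add: length_ordered_word[OF xs])
    finally show ?thesis .
  qed
  have "(\<Sum>w\<in>ordered_words x k. q ^ INV w)
      = (\<Sum>xs\<in>ordered_words m k. \<Sum>w\<in>{w \<in> ordered_words x k. filter ?P w = xs}. q ^ INV w)"
    using kx by (intro sum.group[symmetric]) (auto simp: x_def ordered_words_Suc)
  also have "\<dots> = (\<Sum>xs\<in>ordered_words m k. q ^ INV xs) * gbinom q (sum k {1..m}) (k x - 1)"
    unfolding sum_distrib_right by (rule sum.cong) (auto simp: fibre)
  finally show ?case
    using Suc by (simp add: word_poly_Suc x_def)
qed

section \<open>A common generalization of the d-major index and the r-major index\<close>

definition MAJdr :: "nat \<Rightarrow> nat \<Rightarrow> nat list \<Rightarrow> nat" where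
  "MAJdr d r w =
     card {(i, j). i < j \<and> j < length w \<and> w ! i > w ! j \<and> (j < i + d \<or> w ! i < w ! j + r)}
     + (\<Sum>i\<in>{i. i + d < length w \<and> w ! i \<ge> w ! (i + d) + r}. Suc i)"

lemma MAJ_eq_MAJdr: "MAJ w = MAJdr 1 1 w"
proof -
  have "{(i, j). i < j \<and> j < length w \<and> w ! i > w ! j \<and> (j < i + 1 \<or> w ! i < w ! j + 1)} = {}"
    by auto
  then show ?thesis by (simp add: MAJ_def Des_def MAJdr_def Suc_le_eq)
qed

lemma MAJd_eq_MAJdr: "MAJd d w = MAJdr d 1 w"
proof -
  have "{(i, j). i < j \<and> j < length w \<and> w ! i > w ! j \<and> (j < i + d \<or> w ! i < w ! j + 1)}
      = {(i, j). i < j \<and> j < i + d \<and> j < length w \<and> w ! i > w ! j}"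
    by auto
  then show ?thesis by (simp add: MAJd_def MAJdr_def Suc_le_eq)
qed

lemma rMAJ_eq_MAJdr: "rMAJ r w = MAJdr 1 r w"
proof -
  have "{(i, j). i < j \<and> j < length w \<and> w ! i > w ! j \<and> (j < i + 1 \<or> w ! i < w ! j + r)}
      = {(i, j). i < j \<and> j < length w \<and> w ! i < w ! j + r \<and> w ! j < w ! i}"
    by auto
  then show ?thesis by (simp add: rMAJ_def MAJdr_def)
qed

text \<open>The start of the induction: as long as no two positions are \<open>d\<close> apart,
  every inversion counts once.\<close>

lemma MAJdr_short:
  assumes "length w \<le> d"
  shows "MAJdr d r w = INV w"
proof -
  have "{(i, j). i < j \<and> j < length w \<and> w ! i > w ! j \<and> (j < i + d \<or> w ! i < w ! j + r)}
      = {(i, j). i < j \<and> j < length w \<and> w ! i > w ! j}"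
    using assms by auto
  moreover have "{i. i + d < length w \<and> w ! i \<ge> w ! (i + d) + r} = {}"
    using assms by auto
  ultimately show ?thesis unfolding MAJdr_def INV_def by (simp only: sum.empty add_0_right)
qed

text \<open>The cut sorts the letters by their distance from the new letter \<open>y\<close>. Those
  in \<open>v\<close> are less than \<open>d\<close> away and count whenever they exceed
  \<open>y\<close>; those in \<open>u\<close> count only if they exceed it by less than
  \<open>r\<close>. The last letter of \<open>u\<close> is exactly \<open>d\<close> away, at
  position \<open>length u\<close> counted from 1.\<close>

lemma MAJdr_snoc:
  assumes d: "d = Suc (length v)" and "r \<ge> 1"
  shows "MAJdr d r ((u @ v) @ [y]) = MAJdr d r (u @ v) + length (filter (\<lambda>a. y < a) v)
    + length (filter (\<lambda>a. y < a \<and> a < y + r) u) + (if u \<noteq> [] \<and> last u \<ge> y + r then length u else 0)"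
proof -
  define w where "w = u @ v"
  define n where "n = length w"
  let ?S = "\<lambda>w. {(i, j). i < j \<and> j < length w \<and> w ! i > w ! j \<and> (j < i + d \<or> w ! i < w ! j + r)}"
  let ?T = "\<lambda>w. {i. i + d < length w \<and> w ! i \<ge> w ! (i + d) + r}"
  let ?A = "{i. i < n \<and> w ! i > y \<and> (n < i + d \<or> w ! i < y + r)}"
  have nu: "n = length u + length v" by (simp add: n_def w_def)
  have S: "?S (w @ [y]) = ?S w \<union> (\<lambda>i. (i, n)) ` ?A"
    by (auto simp: nth_append n_def not_less less_Suc_eq)
  have fin: "finite (?S w)" by (rule finite_subset[of _ "{..<n} \<times> {..<n}"]) (auto simp: n_def)
  have "card (?S (w @ [y])) = card (?S w) + card ?A"
    unfolding S by (subst card_Un_disjoint) (use fin in \<open>auto simp: n_def card_image inj_on_def\<close>)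
  moreover have "?A = {i. i < length u \<and> y < u ! i \<and> u ! i < y + r} \<union> (\<lambda>i. length u + i) ` {i. i < length v \<and> y < v ! i}"
    (is "_ = ?B \<union> ?C")
  proof (intro equalityI subsetI)
    fix i assume i: "i \<in> ?A"
    show "i \<in> ?B \<union> ?C"
    proof (cases "i < length u")
      case True
      then show ?thesis using i by (auto simp: w_def nth_append nu d)
    next
      case False
      then have "i = length u + (i - length u)" "i - length u < length v" using i by (auto simp: nu)
      moreover have "v ! (i - length u) > y" using i False by (auto simp: w_def nth_append)
      ultimately show ?thesis by blast
    qed
  qed (auto simp: nu w_def nth_append d)
  then have "card ?A = card ?B + card ?C"
    by (simp only:) (subst card_Un_disjoint; auto)
  moreover have "card ?C = length (filter (\<lambda>a. y < a) v)"
    by (subst card_image) (auto simp: length_filter_conv_card)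
  moreover have "card ?B = length (filter (\<lambda>a. y < a \<and> a < y + r) u)"
    by (simp add: length_filter_conv_card)
  moreover have "?T (w @ [y]) = ?T w \<union> (if u \<noteq> [] \<and> last u \<ge> y + r then {length u - 1} else {})"
  proof (intro equalityI subsetI)
    fix i assume i: "i \<in> ?T (w @ [y])"
    show "i \<in> ?T w \<union> (if u \<noteq> [] \<and> last u \<ge> y + r then {length u - 1} else {})"
    proof (cases "i + d < n")
      case True
      then show ?thesis using i by (auto simp: nth_append n_def)
    next
      case False
      then have "i + d = n" using i by (auto simp: n_def)
      then have "i = length u - 1" "u \<noteq> []" using d nu by auto
      moreover have "w ! i = last u" using calculation by (simp add: w_def nth_append last_conv_nth)
      moreover have "i < n" using \<open>i + d = n\<close> d by simp
      ultimately have "(w @ [y]) ! i = last u" "(w @ [y]) ! (i + d) = y"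
        using \<open>i + d = n\<close> by (auto simp: nth_append n_def)
      then show ?thesis using i \<open>i = length u - 1\<close> \<open>u \<noteq> []\<close> by auto
    qed
  next
    fix i assume i: "i \<in> ?T w \<union> (if u \<noteq> [] \<and> last u \<ge> y + r then {length u - 1} else {})"
    show "i \<in> ?T (w @ [y])"
    proof (cases "i \<in> ?T w")
      case True
      then show ?thesis by (auto simp: nth_append)
    next
      case False
      then have i: "i = length u - 1" "u \<noteq> []" "last u \<ge> y + r" using i by (auto split: if_splits)
      then have "i + d = n" using d nu by (cases u) auto
      moreover have "w ! i = last u" using i by (simp add: w_def nth_append last_conv_nth)
      moreover have "i < n" using i nu by (cases u) auto
      ultimately show ?thesis using i by (auto simp: nth_append n_def)
    qed
  qed
  then have "(\<Sum>i\<in>?T (w @ [y]). Suc i) = (\<Sum>i\<in>?T w. Suc i)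
      + (\<Sum>i\<in>(if u \<noteq> [] \<and> last u \<ge> y + r then {length u - 1} else {}). Suc i)"
  proof (simp only:, intro sum.union_disjoint)
    show "finite (?T w)" by (rule finite_subset[of _ "{..<n}"]) (auto simp: n_def)
    have "\<not> length u - 1 + d < n" if "u \<noteq> []" using that d nu by (cases u) auto
    then show "?T w \<inter> (if u \<noteq> [] \<and> last u \<ge> y + r then {length u - 1} else {}) = {}"
      by (auto simp: n_def)
  qed auto
  ultimately show ?thesis
    unfolding MAJdr_def w_def[symmetric] by simp
qed

section \<open>Words with prescribed letters, and the induction that shifts a window of
  \<open>d\<close> letters\<close>

lemma finite_words [simp]: "finite {u. mset u = c \<and> Q u}"
  by (rule finite_subset[OF _ finite_permutations_of_multiset[of c]]) (auto simp: permutations_of_multiset_def)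

lemma sum_words_snoc:
  assumes "c \<noteq> {#}"
  shows "(\<Sum>u\<in>{u. mset u = c \<and> Q u}. g u)
    = (\<Sum>z\<in>set_mset c. \<Sum>u\<in>{u. mset u = c - {#z#} \<and> Q (u @ [z])}. g (u @ [z]))"
proof -
  let ?U = "{u. mset u = c \<and> Q u}"
  have ne: "u \<noteq> []" if "u \<in> ?U" for u using that assms by auto
  have "(\<Sum>u\<in>?U. g u) = (\<Sum>z\<in>set_mset c. \<Sum>u\<in>{u \<in> ?U. last u = z}. g u)"
    by (rule sum.group[symmetric]) (use ne last_in_set in fastforce)+
  also have "\<dots> = (\<Sum>z\<in>set_mset c. \<Sum>u\<in>{u. mset u = c - {#z#} \<and> Q (u @ [z])}. g (u @ [z]))"
  proof (rule sum.cong[OF refl])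
    fix z assume z: "z \<in># c"
    have "{u \<in> ?U. last u = z} = (\<lambda>u. u @ [z]) ` {u. mset u = c - {#z#} \<and> Q (u @ [z])}"
    proof (intro equalityI subsetI)
      fix u assume u: "u \<in> {u \<in> ?U. last u = z}"
      then have "u = butlast u @ [z]" using ne by (metis (mono_tags, lifting) append_butlast_last_id mem_Collect_eq)
      moreover have "mset (butlast u @ [z]) = c" using u calculation by simp
      then have "mset (butlast u) = c - {#z#}" by auto
      moreover have "Q (butlast u @ [z])" using u calculation(1) by simp
      ultimately show "u \<in> (\<lambda>u. u @ [z]) ` {u. mset u = c - {#z#} \<and> Q (u @ [z])}" by blast
    qed (use z in auto)
    then show "(\<Sum>u\<in>{u \<in> ?U. last u = z}. g u) = (\<Sum>u\<in>{u. mset u = c - {#z#} \<and> Q (u @ [z])}. g (u @ [z]))"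
      by (simp add: sum.reindex inj_on_def)
  qed
  finally show ?thesis .
qed

text \<open>A letter of \<open>u\<close> that is not below \<open>t\<close> exceeds
  \<open>y\<close>, which stands further right, so its own last occurrence must lie in
  \<open>s\<close>. As this is all that is asked of such letters, the condition on
  \<open>u @ s\<close> is invariant under reshuffling the large letters of \<open>u\<close> among
  the small ones.\<close>

lemma last_ordered_append_filter:
  assumes "y \<in> set s" "y < t"
  shows "last_ordered (u @ s) \<longleftrightarrow> last_ordered (below t u @ s) \<and> (\<forall>a\<in>set u. \<not> a < t \<longrightarrow> a \<in> set s)"
proof (induction u)
  case (Cons a u)
  show ?case
  proof (cases "a < t")
    case True
    then have "(\<forall>b\<in>set (u @ s). a < b) \<longleftrightarrow> (\<forall>b\<in>set (below t u @ s). a < b)" by auto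
    then show ?thesis using Cons True by auto
  next
    case False
    then have "\<not> (\<forall>b\<in>set (u @ s). a < b)" using assms by (auto intro!: bexI[of _ y])
    then show ?thesis using Cons False by auto
  qed
qed simp

text \<open>
  This identity takes the place of the rotation of the blocks of a word in Foata's second fundamental
  transformation.
\<close>

lemma sum_INV_last:
  fixes q :: "'a::comm_semiring_1"
  assumes y: "y \<in> set s" "y < t"
  shows "(\<Sum>u\<in>{u. mset u = c \<and> last_ordered (u @ s)}. q ^ INV u * (if u \<noteq> [] \<and> \<not> last u < t then q ^ size c else 1))
    = q ^ size (filter_mset (\<lambda>a. \<not> a < t) c) * (\<Sum>u\<in>{u. mset u = c \<and> last_ordered (u @ s)}. q ^ INV u)"
    (is "(\<Sum>u\<in>?U. ?f u) = ?C * _")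
proof -
  let ?P = "\<lambda>a. a < t"
  define g where "g = (\<lambda>u. (filter ?P u, filter (\<lambda>a. \<not> ?P a) u))"
  have fibre: "(\<Sum>u\<in>{u\<in>?U. g u = k}. ?f u) = ?C * (\<Sum>u\<in>{u\<in>?U. g u = k}. q ^ INV u)" if k: "k \<in> g ` ?U" for k
  proof -
    obtain u0 where u0: "u0 \<in> ?U" "k = g u0" using k by auto
    define xs ys where "xs = filter ?P u0" and "ys = filter (\<lambda>a. \<not> ?P a) u0"
    have k: "k = (xs, ys)" using u0 by (simp add: g_def xs_def ys_def)
    have P: "\<forall>a\<in>set xs. ?P a" "\<forall>a\<in>set ys. \<not> ?P a" by (auto simp: xs_def ys_def)
    have c: "c = mset xs + mset ys" using u0 multiset_partition[of "mset u0" ?P] by (simp add: xs_def ys_def)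
    have set: "{u\<in>?U. g u = k} = shuffles xs ys"
    proof (intro equalityI subsetI)
      fix u assume u: "u \<in> shuffles xs ys"
      then have f: "filter ?P u = xs" "filter (\<lambda>a. \<not> ?P a) u = ys"
        by (auto simp: shuffles_eq_filter[OF P])
      have mu: "mset u = c" using multiset_partition[of "mset u" ?P] by (simp add: c flip: f)
      have "last_ordered (u @ s)"
        using u0(1) last_ordered_append_filter[OF y, of u] last_ordered_append_filter[OF y, of u0] mu f
        by (auto simp: xs_def dest: mset_eq_setD)
      with mu f show "u \<in> {u\<in>?U. g u = k}" by (simp add: g_def k)
    qed (auto simp: shuffles_eq_filter[OF P] g_def k)
    have INV: "q ^ INV p = q ^ (INV xs + INV ys) * q ^ cross ?P p" if "p \<in> shuffles xs ys" for p
      using that pairs_filter_split[of p t] by (simp add: INV_eq_pairs shuffles_eq_filter[OF P] power_add)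
    have C: "?C = q ^ length ys"
      using P by (simp add: c filter_mset_False flip: mset_filter)
    show ?thesis
    proof (cases "xs = [] \<and> ys = []")
      case True
      then show ?thesis by (simp add: set c)
    next
      case False
      then have ne: "p \<noteq> []" if "p \<in> shuffles xs ys" for p using that by auto
      have "(\<Sum>u\<in>shuffles xs ys. ?f u)
        = q ^ (INV xs + INV ys) * (\<Sum>p\<in>shuffles xs ys. q ^ cross ?P p * (if ?P (last p) then 1 else q ^ (length xs + length ys)))"
        unfolding sum_distrib_left by (rule sum.cong) (use ne in \<open>auto simp: INV c mult.assoc\<close>)
      \<comment> \<open>With the weights 1 and \<open>q ^ (length xs + length ys)\<close> both cases
        contain the factor \<open>q ^ length ys\<close>; what is left is the defining Pascal
        rule.\<close>
      also have "(\<Sum>p\<in>shuffles xs ys. q ^ cross ?P p * (if ?P (last p) then 1 else q ^ (length xs + length ys)))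
        = q ^ length ys * gbinom q (length xs) (length ys)"
        using False by (subst sum_shuffles_last[OF P]) (cases xs; cases ys; auto simp: algebra_simps power_add)+
      also have "gbinom q (length xs) (length ys) = (\<Sum>p\<in>shuffles xs ys. q ^ cross ?P p)"
        using sum_shuffles[OF P, of q] by simp
      also have "q ^ (INV xs + INV ys) * (q ^ length ys * \<dots>) = q ^ length ys * (\<Sum>p\<in>shuffles xs ys. q ^ INV p)"
        by (simp add: sum_distrib_left INV mult_ac cong: sum.cong)
      finally show ?thesis unfolding set C .
    qed
  qed
  have "(\<Sum>u\<in>?U. ?f u) = (\<Sum>k\<in>g ` ?U. \<Sum>u\<in>{u\<in>?U. g u = k}. ?f u)"
    by (rule sum.group[symmetric]) auto
  also have "\<dots> = (\<Sum>k\<in>g ` ?U. ?C * (\<Sum>u\<in>{u\<in>?U. g u = k}. q ^ INV u))"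
    using fibre by (rule sum.cong[OF refl])
  also have "\<dots> = ?C * (\<Sum>u\<in>?U. q ^ INV u)"
    unfolding sum_distrib_left[symmetric] by (subst sum.group) auto
  finally show ?thesis .
qed

text \<open>One step shifts the window \<open>v\<close> to the left: its last letter
  \<open>y\<close> passes to \<open>s\<close>, where it still takes part in the order of last
  occurrences, and the last letter \<open>z\<close> of \<open>u\<close> enters. Removing
  \<open>y\<close> costs \<open>q ^ C\<close>, and a further \<open>q ^ size c\<close> if
  \<open>z\<close> is at least \<open>y + r\<close>. Once the induction hypothesis has turned
  \<open>MAJdr\<close> into \<open>INV\<close>, \<open>sum_INV_last\<close> with
  \<open>t = y + r\<close> trades this last factor for the inversions of \<open>y\<close> with the
  letters of \<open>u\<close> that are at least \<open>y + r\<close>.\<close>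

lemma sum_MAJdr_fixed_suffix:
  fixes q :: "'a::comm_semiring_1"
  assumes "length v = d" "d \<ge> 1" "r \<ge> 1"
  shows "(\<Sum>u\<in>{u. mset u = c \<and> last_ordered (u @ v @ s)}. q ^ MAJdr d r (u @ v))
    = (\<Sum>u\<in>{u. mset u = c \<and> last_ordered (u @ v @ s)}. q ^ INV (u @ v))"
  using assms
proof (induction "size c" arbitrary: c v s)
  case 0
  then show ?case by (intro sum.cong) (auto simp: MAJdr_short)
next
  case (Suc n)
  then have c: "c \<noteq> {#}" by auto
  obtain v' y where v: "v = v' @ [y]" using Suc.prems by (cases v rule: rev_cases) auto
  have d: "d = Suc (length v')" using Suc.prems v by simp
  let ?t = "y + r" and ?Q = "\<lambda>u. last_ordered (u @ v' @ y # s)"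
  let ?U = "{u. mset u = c \<and> ?Q u}"
  let ?V = "\<lambda>z. {u. mset u = c - {#z#} \<and> last_ordered (u @ (z # v') @ y # s)}"
  \<comment> \<open>\<open>C\<close> is what \<open>y\<close> contributes to both statistics alike;
    \<open>X\<close> counts the inversions of \<open>u @ v'\<close> that are not inside
    \<open>u\<close>, and depends on \<open>u\<close> only through its multiset of letters.\<close>
  define C where "C = length (filter (\<lambda>a. y < a) v') + size (filter_mset (\<lambda>a. y < a \<and> a < ?t) c)"
  define X where "X = INV v' + (\<Sum>a\<in>#c. length (filter ((>) a) v'))"
  let ?e = "\<lambda>z. if \<not> z < ?t then q ^ size c else 1"
  have len: "length (filter R u) = size (filter_mset R c)" if "mset u = c" for u R
    using that by (metis mset_filter size_mset)
  have step: "q ^ MAJdr d r ((u @ v') @ [y]) = q ^ MAJdr d r (u @ v') * (q ^ C * ?e (last u))"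
    if "mset u = c" for u
  proof -
    have "u \<noteq> []" "length u = size c" using that c by auto
    then show ?thesis
      using MAJdr_snoc[OF d Suc.prems(3), of u y] len[OF that, of "\<lambda>a. y < a \<and> a < ?t"]
      by (simp add: C_def power_add not_less mult_ac)
  qed
  have X: "INV (u @ v') = INV u + X" if "mset u = c" for u
    using that by (auto simp: X_def INV_eq_pairs pairs_append simp flip: sum_mset_sum_list)
  have INV: "q ^ INV ((u @ v') @ [y]) = q ^ INV u * (q ^ X * (q ^ C * q ^ size (filter_mset (\<lambda>a. \<not> a < ?t) c)))"
    if u: "mset u = c" for u
  proof -
    have "INV ((u @ v') @ [y]) = INV (u @ v') + length (filter (\<lambda>a. y < a) u) + length (filter (\<lambda>a. y < a) v')"
      unfolding INV_eq_pairs pairs_append[of _ "u @ v'" "[y]"]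
      by (induction u) (auto, induction v', auto)
    moreover have "length (filter (\<lambda>a. y < a) u) = size (filter_mset (\<lambda>a. y < a \<and> a < ?t) c) + size (filter_mset (\<lambda>a. \<not> a < ?t) c)"
      unfolding len[OF u, symmetric] using Suc.prems(3) by (induction u) auto
    ultimately show ?thesis using X[OF u] by (simp add: C_def power_add mult_ac)
  qed
  have "(\<Sum>u\<in>?U. q ^ MAJdr d r ((u @ v') @ [y]))
      = (\<Sum>z\<in>set_mset c. \<Sum>u\<in>{u. mset u = c - {#z#} \<and> ?Q (u @ [z])}. q ^ MAJdr d r (((u @ [z]) @ v') @ [y]))"
    by (rule sum_words_snoc[OF c])
  also have "\<dots> = (\<Sum>z\<in>set_mset c. \<Sum>u\<in>?V z.
        q ^ MAJdr d r (u @ (z # v')) * (q ^ C * ?e z))"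
  proof (intro sum.cong refl)
    fix z u assume "z \<in># c" "u \<in> ?V z"
    then have "mset (u @ [z]) = c" by simp
    from step[OF this] show "q ^ MAJdr d r (((u @ [z]) @ v') @ [y]) = q ^ MAJdr d r (u @ z # v') * (q ^ C * ?e z)"
      by simp
  qed simp
  also have "\<dots> = (\<Sum>z\<in>set_mset c. \<Sum>u\<in>?V z.
        q ^ INV (u @ (z # v')) * (q ^ C * ?e z))"
  proof (rule sum.cong[OF refl])
    fix z assume z: "z \<in># c"
    have "n = size (c - {#z#})" using Suc.hyps(2) z by (simp add: size_Diff_singleton)
    from Suc.hyps(1)[OF this, of "z # v'" "y # s"] Suc.prems d
    show "(\<Sum>u\<in>?V z. q ^ MAJdr d r (u @ (z # v')) * (q ^ C * ?e z))
      = (\<Sum>u\<in>?V z. q ^ INV (u @ (z # v')) * (q ^ C * ?e z))"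
      unfolding sum_distrib_right[symmetric] by simp
  qed
  also have "\<dots> = (\<Sum>u\<in>?U. q ^ INV (u @ v') * (q ^ C * ?e (last u)))"
    by (subst sum_words_snoc[OF c]) simp
  also have "\<dots> = q ^ (X + C) * (\<Sum>u\<in>?U. q ^ INV u * (if u \<noteq> [] \<and> \<not> last u < ?t then q ^ size c else 1))"
    unfolding sum_distrib_left by (intro sum.cong) (use c in \<open>auto simp: X power_add mult_ac\<close>)
  also have "\<dots> = q ^ (X + C) * (q ^ size (filter_mset (\<lambda>a. \<not> a < ?t) c) * (\<Sum>u\<in>?U. q ^ INV u))"
    using Suc.prems(3) by (subst sum_INV_last[of y]) auto
  also have "\<dots> = (\<Sum>u\<in>?U. q ^ INV ((u @ v') @ [y]))"
    unfolding sum_distrib_left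
  proof (intro sum.cong refl)
    fix u assume "u \<in> ?U"
    then show "q ^ (X + C) * (q ^ size (filter_mset (\<lambda>a. \<not> a < ?t) c) * q ^ INV u) = q ^ INV ((u @ v') @ [y])"
      by (simp only: mem_Collect_eq INV power_add mult_ac)
  qed
  finally show ?case by (simp add: v)
qed

theorem sum_MAJdr:
  fixes q :: "'a::comm_semiring_1"
  assumes "d \<ge> 1" "r \<ge> 1"
  shows "(\<Sum>w\<in>ordered_words m k. q ^ MAJdr d r w) = (\<Sum>w\<in>ordered_words m k. q ^ INV w)"
proof (cases "sum k {1..m} \<le> d")
  case True
  then show ?thesis by (intro sum.cong) (auto simp: MAJdr_short length_ordered_word)
next
  case False
  define n where "n = sum k {1..m} - d"
  let ?W = "ordered_words m k" and ?g = "drop n"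
  have fibre: "(\<Sum>w\<in>{w\<in>?W. ?g w = v}. f w)
      = (\<Sum>u\<in>{u. mset u = type_mset m k - mset v \<and> last_ordered (u @ v @ [])}. f (u @ v))"
    if v: "v \<in> ?g ` ?W" for v and f :: "nat list \<Rightarrow> 'a"
  proof -
    obtain w0 where w0: "w0 \<in> ?W" "v = drop n w0" using v by auto
    have "mset w0 = mset (take n w0) + mset v" using w0 by (metis append_take_drop_id mset_append)
    then have "type_mset m k = mset (take n w0) + mset v" using w0(1) by (simp add: ordered_words_def)
    then have sub: "mset v \<subseteq># type_mset m k" by simp
    have lv: "length v = d" using w0 False by (simp add: length_ordered_word n_def)
    have len: "length u = n" if "mset u = type_mset m k - mset v" for u
      using arg_cong[OF that, of size] sub lv by (simp add: size_Diff_submset size_type_mset n_def)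
    have "{w\<in>?W. ?g w = v} = (\<lambda>u. u @ v) ` {u. mset u = type_mset m k - mset v \<and> last_ordered (u @ v @ [])}"
    proof (intro equalityI subsetI)
      fix w assume w: "w \<in> {w\<in>?W. ?g w = v}"
      then have "w = take n w @ v" by (metis (mono_tags, lifting) append_take_drop_id mem_Collect_eq)
      moreover have "mset (take n w) = type_mset m k - mset v"
        using w calculation by (metis (mono_tags, lifting) add_diff_cancel_right' mem_Collect_eq mset_append ordered_words_def)
      ultimately show "w \<in> (\<lambda>u. u @ v) ` {u. mset u = type_mset m k - mset v \<and> last_ordered (u @ v @ [])}"
        using w by (intro image_eqI[of _ _ "take n w"]) (auto simp: ordered_words_def)
    next
      fix w assume "w \<in> (\<lambda>u. u @ v) ` {u. mset u = type_mset m k - mset v \<and> last_ordered (u @ v @ [])}"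
      then obtain u where u: "w = u @ v" "mset u = type_mset m k - mset v" "last_ordered (u @ v)" by auto
      then show "w \<in> {w\<in>?W. ?g w = v}"
        using sub len[OF u(2)] by (auto simp: ordered_words_def)
    qed
    then show ?thesis by (simp add: sum.reindex inj_on_def)
  qed
  have group: "(\<Sum>w\<in>?W. f w) = (\<Sum>v\<in>?g ` ?W. \<Sum>w\<in>{w\<in>?W. ?g w = v}. f w)" for f :: "nat list \<Rightarrow> 'a"
    by (rule sum.group[symmetric]) auto
  show ?thesis
    unfolding group
  proof (rule sum.cong[OF refl])
    fix v assume v: "v \<in> ?g ` ?W"
    then have "length v = d" using False by (auto simp: length_ordered_word n_def)
    with assms show "(\<Sum>w\<in>{w\<in>?W. ?g w = v}. q ^ MAJdr d r w) = (\<Sum>w\<in>{w\<in>?W. ?g w = v}. q ^ INV w)"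
      unfolding fibre[OF v] by (intro sum_MAJdr_fixed_suffix)
  qed
qed

section \<open>Zeilberger's statistic\<close>

lemma MAJ_snoc: "MAJ (u @ [x]) = MAJ u + (if u \<noteq> [] \<and> last u > x then length u else 0)"
  using MAJdr_snoc[of 1 "[]" 1 u x] by (auto simp: MAJ_eq_MAJdr Suc_le_eq filter_empty_conv)

lemma MAJ_constant:
  assumes "set u \<subseteq> {a}"
  shows "MAJ u = 0"
proof -
  have "u ! i = a" if "i < length u" for i
    using assms nth_mem[OF that] by auto
  then have "Des u = {}" by (auto simp: Des_def)
  then show ?thesis by (simp add: MAJ_def)
qed

section \<open>The order of the last occurrences and its effect on Zeilberger's statistic\<close>

abbreviation before :: "'a \<Rightarrow> 'a list \<Rightarrow> 'a list" where
  "before x \<equiv> takeWhile (\<lambda>y. y \<noteq> x)"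

abbreviation without :: "'a \<Rightarrow> 'a list \<Rightarrow> 'a list" where
  "without x \<equiv> filter (\<lambda>y. y \<noteq> x)"

abbreviation only :: "'a \<Rightarrow> 'a \<Rightarrow> 'a list \<Rightarrow> 'a list" where
  "only a b \<equiv> filter (\<lambda>y. y = a \<or> y = b)"

text \<open>\<open>remdups\<close> keeps the last occurrence of each letter.\<close>

definition last_occs :: "'a list \<Rightarrow> 'a list" where
  "last_occs w = rev (remdups w)"

lemma last_occs_Nil [simp]: "last_occs [] = []"
  by (simp add: last_occs_def)

lemma last_occs_snoc: "last_occs (w @ [x]) = x # without x (last_occs w)"
proof -
  have "remdups (w @ [x]) = without x (remdups w) @ [x]"
    by (induction w) auto
  then show ?thesis by (simp add: last_occs_def rev_filter)
qed

lemma set_last_occs [simp]: "set (last_occs w) = set w"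
  by (simp add: last_occs_def)

lemma distinct_last_occs [simp]: "distinct (last_occs w)"
  by (simp add: last_occs_def)

lemma in_takeWhile_filter:
  assumes "a \<noteq> x" "a \<noteq> b"
  shows "b \<in> set (before x (without a l)) \<longleftrightarrow> b \<in> set (before x l)"
proof (induction l)
  case (Cons y l)
  then show ?case using assms by (cases "y = x"; cases "y = a") simp_all
qed simp

lemma takeWhile_neq_append: "x \<notin> set ys \<Longrightarrow> before x (ys @ x # zs) = ys"
  by (induction ys) (simp_all add: eq_commute[of x])

lemma filter_neq_id: "x \<notin> set l \<Longrightarrow> without x l = l"
  by (induction l) (simp_all add: eq_commute[of x])

text \<open>Both sides say that \<open>b\<close> occurs and that its last occurrence lies to the
  right of every \<open>x\<close>.\<close>

lemma last_filter_pair: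
  assumes "b \<noteq> x"
  shows "only x b w \<noteq> [] \<and> last (only x b w) = b
    \<longleftrightarrow> b \<in> set (before x (last_occs w))"
proof (induction w rule: rev_induct)
  case (snoc a w)
  show ?case using snoc assms by (cases "a = x"; cases "a = b") (auto simp: last_occs_snoc in_takeWhile_filter)
qed simp

text \<open>A subword with only one kind of letter has no descent. Hence the pairs can be taken from
  a set of letters that stays the same when a letter is appended.\<close>

lemma Zstat_superset:
  assumes "finite S" "set w \<subseteq> S"
  shows "Zstat w = (\<Sum>(a, b)\<in>{(a, b). a \<in> S \<and> b \<in> S \<and> a < b}. MAJ (only a b w))"
  unfolding Zstat_def
proof (rule sum.mono_neutral_left)
  show "finite {(a, b). a \<in> S \<and> b \<in> S \<and> a < b}"
    by (rule finite_subset[of _ "S \<times> S"]) (use assms in auto)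
  show "{(a, b). a \<in> set w \<and> b \<in> set w \<and> a < b} \<subseteq> {(a, b). a \<in> S \<and> b \<in> S \<and> a < b}"
    using assms by auto
  show "\<forall>i\<in>{(a, b). a \<in> S \<and> b \<in> S \<and> a < b} - {(a, b). a \<in> set w \<and> b \<in> set w \<and> a < b}.
      (case i of (a, b) \<Rightarrow> MAJ (only a b w)) = 0"
  proof
    fix i assume "i \<in> {(a, b). a \<in> S \<and> b \<in> S \<and> a < b} - {(a, b). a \<in> set w \<and> b \<in> set w \<and> a < b}"
    then obtain a b where i: "i = (a, b)" "a \<notin> set w \<or> b \<notin> set w" by auto
    then have "set (only a b w) \<subseteq> {a} \<or> set (only a b w) \<subseteq> {b}"
      by auto
    then show "(case i of (a, b) \<Rightarrow> MAJ (only a b w)) = 0"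
      using MAJ_constant i by auto
  qed
qed

text \<open>Only the subwords of \<open>x\<close> and another letter \<open>b\<close> grow. If
  \<open>b < x\<close>, no descent arises; if \<open>b > x\<close>, one arises exactly when the
  subword ended in \<open>b\<close>, and its position is the length of the subword, the number of
  copies of \<open>x\<close> and \<open>b\<close>.\<close>

lemma Zstat_snoc:
  "Zstat (w @ [x]) = Zstat w + (\<Sum>b\<leftarrow>before x (last_occs w).
      if b > x then count (mset w) x + count (mset w) b else 0)"
proof -
  define S where "S = insert x (set w)"
  let ?T = "{(a, b). a \<in> S \<and> b \<in> S \<and> a < b}"
  let ?tw = "before x (last_occs w)"
  let ?h = "\<lambda>(a, b). if a = x \<and> b \<in> set ?tw then count (mset w) x + count (mset w) b else 0"
  have fin: "finite ?T" by (rule finite_subset[of _ "S \<times> S"]) (auto simp: S_def)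
  have len: "length (only x b w) = count (mset w) x + count (mset w) b" if "b \<noteq> x" for b
    using that by (induction w) auto
  have "MAJ (only a b (w @ [x])) = MAJ (only a b w) + ?h (a, b)"
    if "a < b" for a b
  proof -
    let ?u = "only a b w"
    consider "x \<noteq> a" "x \<noteq> b" | "x = b" | "x = a" by auto
    then show ?thesis
    proof cases
      case 2
      have "last ?u \<le> x" if "?u \<noteq> []" using last_in_set[OF that] 2 \<open>a < b\<close> by auto
      then show ?thesis using 2 that by (auto simp: MAJ_snoc)
    next
      case 3
      have "last ?u > x \<longleftrightarrow> last ?u = b" if "?u \<noteq> []" using last_in_set[OF that] 3 \<open>a < b\<close> by auto
      then show ?thesis using 3 that last_filter_pair[of b x w] len[of b] by (auto simp: MAJ_snoc)
    qed auto
  qed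
  then have "Zstat (w @ [x]) = (\<Sum>(a, b)\<in>?T. MAJ (only a b w) + ?h (a, b))"
    by (subst Zstat_superset[of S]) (auto simp: S_def intro!: sum.cong)
  also have "\<dots> = Zstat w + sum ?h ?T"
  proof -
    have "(\<Sum>(a, b)\<in>?T. MAJ (only a b w) + ?h (a, b))
      = (\<Sum>p\<in>?T. (case p of (a, b) \<Rightarrow> MAJ (only a b w)) + ?h p)"
      by (rule sum.cong) auto
    moreover have "Zstat w = (\<Sum>(a, b)\<in>?T. MAJ (only a b w))"
      by (rule Zstat_superset) (auto simp: S_def)
    ultimately show ?thesis by (simp only: sum.distrib)
  qed
  also have "sum ?h ?T = (\<Sum>p\<in>Pair x ` {b \<in> set ?tw. b > x}. ?h p)"
    by (rule sum.mono_neutral_right)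
      (use fin set_takeWhileD[of _ "\<lambda>y. y \<noteq> x" "last_occs w"] in \<open>auto simp: S_def\<close>)
  also have "\<dots> = (\<Sum>b\<in>{b \<in> set ?tw. b > x}. count (mset w) x + count (mset w) b)"
    by (subst sum.reindex) (auto simp: inj_on_def)
  also have "\<dots> = (\<Sum>b\<in>set ?tw. if b > x then count (mset w) x + count (mset w) b else 0)"
    by (rule sum.inter_filter) simp
  also have "\<dots> = (\<Sum>b\<leftarrow>?tw. if b > x then count (mset w) x + count (mset w) b else 0)"
    by (rule sum.distinct_set_conv_list) (simp add: distinct_takeWhile)
  finally show ?thesis .
qed

section \<open>The product formula for every order of the last occurrences\<close>

abbreviation sum_above :: "(nat \<Rightarrow> nat) \<Rightarrow> nat \<Rightarrow> nat list \<Rightarrow> nat" where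
  "sum_above c x t \<equiv> \<Sum>b\<leftarrow>t. if b > x then c b else 0"

text \<open>
  The generating function of \<open>Zstat\<close> over the words with \<open>c a\<close> copies of the letter \<open>a\<close> whose
  letters have their last occurrences, from right to left, in the order of the given list.
\<close>

fun last_occs_poly :: "'a::comm_semiring_1 \<Rightarrow> (nat \<Rightarrow> nat) \<Rightarrow> nat list \<Rightarrow> 'a" where
  "last_occs_poly q c [] = 1"
| "last_occs_poly q c (x # t) = last_occs_poly q c t
     * q ^ sum_above c x t * gbinom q (\<Sum>b\<leftarrow>t. c b) (c x - 1)"

lemma last_occs_poly_cong:
  "(\<And>a. a \<in> set t \<Longrightarrow> c a = c' a) \<Longrightarrow> last_occs_poly q c t = last_occs_poly q c' t"
proof (induction t)
  case (Cons x t)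
  then have "map c t = map c' t" "map (\<lambda>b. if b > x then c b else 0) t = map (\<lambda>b. if b > x then c' b else 0) t"
    by auto
  with Cons show ?case by (simp only: last_occs_poly.simps) auto
qed simp

lemma sum_list_take_drop:
  fixes f :: "'a \<Rightarrow> nat"
  shows "sum_list (map f (take i xs)) + sum_list (map f (drop i xs)) = sum_list (map f xs)"
  by (metis append_take_drop_id map_append sum_list_append)

text \<open>This is the effect of removing a final letter \<open>x\<close> of which \<open>a\<close>
  copies remain: the last of these may take any place \<open>i\<close> in the order \<open>t\<close>
  of the others. In the induction on \<open>t\<close>, the term \<open>i = 0\<close> has
  \<open>x\<close> in front of the head \<open>z\<close>, and all other terms share the factor
  belonging to \<open>z\<close>. \<open>gbinom_trinomial\<close> brings the two coefficients into
  the same form, and the dual Pascal rule adds them.\<close>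

lemma sum_last_occs_poly_insert:
  fixes q :: "'a::comm_semiring_1"
  assumes "x \<notin> set t" "a \<ge> 1" "c x = a" "\<And>b. b \<in> set t \<Longrightarrow> c b \<ge> 1"
  shows "(\<Sum>i\<le>length t. q ^ sum_above (\<lambda>b. a + c b) x (take i t)
        * last_occs_poly q c (take i t @ x # drop i t))
    = last_occs_poly q c t * q ^ sum_above c x t * gbinom q (\<Sum>b\<leftarrow>t. c b) a"
  using assms
proof (induction t)
  case Nil
  then show ?case by simp
next
  case (Cons z t)
  define N where "N = (\<Sum>b\<leftarrow>t. c b)"
  define G where "G = sum_above c x t"
  define H where "H = sum_above c z t"
  define L where "L = last_occs_poly q c t"
  have zx: "z \<noteq> x" "c z \<ge> 1" using Cons.prems by auto
  have IH: "(\<Sum>i\<le>length t. q ^ sum_above (\<lambda>b. a + c b) x (take i t)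
        * last_occs_poly q c (take i t @ x # drop i t)) = L * q ^ G * gbinom q N a"
    unfolding L_def G_def N_def by (rule Cons.IH) (use Cons.prems in auto)
  have summand: "q ^ (\<Sum>b\<leftarrow>take (Suc i) (z # t). if b > x then a + c b else 0)
        * last_occs_poly q c (take (Suc i) (z # t) @ x # drop (Suc i) (z # t))
      = q ^ sum_above (\<lambda>b. a + c b) x (take i t) * last_occs_poly q c (take i t @ x # drop i t)
        * (q ^ (a + (if z > x then c z else 0) + H) * gbinom q (N + a) (c z - 1))" for i
  proof -
    have "(\<Sum>b\<leftarrow>take i t @ x # drop i t. c b) = N + a"
      using sum_list_take_drop[of c i t] Cons.prems by (simp add: N_def)
    moreover have "sum_above c z (take i t @ x # drop i t) = H + (if x > z then a else 0)"
      using sum_list_take_drop[of "\<lambda>b. if b > z then c b else 0" i t] Cons.prems by (simp add: H_def)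
    ultimately have L: "last_occs_poly q c (z # (take i t @ x # drop i t))
      = last_occs_poly q c (take i t @ x # drop i t) * q ^ (H + (if x > z then a else 0)) * gbinom q (N + a) (c z - 1)"
      by (simp only: last_occs_poly.simps)
    \<comment> \<open>Whichever of \<open>x\<close> and \<open>z\<close> is larger, \<open>a\<close>
      appears exactly once. This is what makes a product formula possible for every order.\<close>
    have "(if z > x then a + c z else 0) + (if x > z then a else 0) = a + (if z > x then c z else 0)"
      using zx by auto
    then have "q ^ (if z > x then a + c z else 0) * q ^ (if x > z then a else 0) = q ^ (a + (if z > x then c z else 0))"
      by (metis power_add)
    then have e: "q ^ (if z > x then a + c z else 0) * q ^ (H + (if x > z then a else 0))
        = q ^ (a + (if z > x then c z else 0) + H)"
      by (simp only: power_add mult_ac)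
    define P where "P = last_occs_poly q c (take i t @ x # drop i t)"
    define S where "S = sum_above (\<lambda>b. a + c b) x (take i t)"
    have "q ^ (\<Sum>b\<leftarrow>take (Suc i) (z # t). if b > x then a + c b else 0)
        * last_occs_poly q c (take (Suc i) (z # t) @ x # drop (Suc i) (z # t))
      = (q ^ (if z > x then a + c z else 0) * q ^ S)
        * (P * q ^ (H + (if x > z then a else 0)) * gbinom q (N + a) (c z - 1))"
      by (simp only: take_Suc_Cons drop_Suc_Cons append_Cons L list.map sum_list.Cons power_add P_def S_def)
    also have "\<dots> = q ^ S * P * ((q ^ (if z > x then a + c z else 0) * q ^ (H + (if x > z then a else 0)))
        * gbinom q (N + a) (c z - 1))"
      by (simp only: mult_ac)
    finally show ?thesis unfolding e P_def S_def .
  qed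
  have zpos: "\<exists>n. N + c z = Suc n" "\<exists>j. a = Suc j"
    using zx Cons.prems(2) by (auto intro: Suc_le_D simp: not0_implies_Suc)
  then obtain n j where nj: "N + c z = Suc n" "a = Suc j" by auto
  have tri: "gbinom q N a * gbinom q (N + a) (c z - 1) = gbinom q N (c z - 1) * gbinom q n a"
  proof -
    have "N + (c z - 1) = n" using nj zx by simp
    then show ?thesis using gbinom_trinomial[of q N a "c z - 1"] by (simp add: mult.commute)
  qed
  have pascal: "gbinom q (N + c z) (a - 1) + q ^ a * gbinom q n a = gbinom q (N + c z) a"
    using gbinom_Suc_Suc'[of q n j] nj by (simp add: add.commute del: gbinom.simps)
  have "(\<Sum>i\<le>length (z # t). q ^ (\<Sum>b\<leftarrow>take i (z # t). if b > x then a + c b else 0)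
        * last_occs_poly q c (take i (z # t) @ x # drop i (z # t)))
    = last_occs_poly q c (x # z # t)
      + (\<Sum>i\<le>length t. q ^ sum_above (\<lambda>b. a + c b) x (take i t) * last_occs_poly q c (take i t @ x # drop i t)
        * (q ^ (a + (if z > x then c z else 0) + H) * gbinom q (N + a) (c z - 1)))"
    unfolding length_Cons sum.atMost_Suc_shift summand by simp
  also have "\<dots> = last_occs_poly q c (x # z # t)
      + L * q ^ G * gbinom q N a * (q ^ (a + (if z > x then c z else 0) + H) * gbinom q (N + a) (c z - 1))"
    unfolding sum_distrib_right[symmetric] IH ..
  also have "L * q ^ G * gbinom q N a * (q ^ (a + (if z > x then c z else 0) + H) * gbinom q (N + a) (c z - 1))
      = L * q ^ H * gbinom q N (c z - 1) * q ^ (G + (if z > x then c z else 0)) * (q ^ a * gbinom q n a)"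
  proof -
    have "L * q ^ G * gbinom q N a * (q ^ (a + (if z > x then c z else 0) + H) * gbinom q (N + a) (c z - 1))
      = L * q ^ H * (q ^ (G + (if z > x then c z else 0)) * q ^ a) * (gbinom q N a * gbinom q (N + a) (c z - 1))"
      by (simp only: power_add mult_ac)
    then show ?thesis unfolding tri by (simp only: mult_ac)
  qed
  also have "last_occs_poly q c (x # z # t)
      = L * q ^ H * gbinom q N (c z - 1) * q ^ (G + (if z > x then c z else 0)) * gbinom q (N + c z) (a - 1)"
    using Cons.prems(3) by (simp add: L_def H_def G_def N_def add.commute)
  also have "\<dots> + L * q ^ H * gbinom q N (c z - 1) * q ^ (G + (if z > x then c z else 0)) * (q ^ a * gbinom q n a)
      = L * q ^ H * gbinom q N (c z - 1) * q ^ (G + (if z > x then c z else 0)) * gbinom q (N + c z) a"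
    unfolding distrib_left[symmetric] pascal ..
  also have "\<dots> = last_occs_poly q c (z # t) * q ^ sum_above c x (z # t) * gbinom q (\<Sum>b\<leftarrow>z # t. c b) a"
    by (simp add: L_def H_def G_def N_def add.commute)
  finally show ?case .
qed

text \<open>The order \<open>t\<close> has to be arbitrary: its first entry is the final letter of
  the word, and after the removal of this letter its previous occurrence may take any place in the
  order. If no copy remains, the order of the rest is simply the tail of \<open>t\<close>.\<close>

theorem sum_Zstat_last_occs:
  fixes q :: "'a::comm_semiring_1"
  assumes "distinct t" "set t = set_mset C"
  shows "(\<Sum>w\<in>{w. mset w = C \<and> last_occs w = t}. q ^ Zstat w) = last_occs_poly q (count C) t"
  using assms
proof (induction "size C" arbitrary: C t)
  case 0
  then have "{w. mset w = C \<and> last_occs w = t} = {[]}" by auto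
  then show ?case using 0 by (simp add: Zstat_def)
next
  case (Suc n)
  then have C: "C \<noteq> {#}" by auto
  then obtain x t' where t: "t = x # t'" using Suc.prems by (cases t) auto
  define C' where "C' = C - {#x#}"
  define a where "a = count C' x"
  have xC: "x \<in># C" "x \<notin> set t'" "distinct t'" using Suc.prems t by auto
  have C'_simps: "n = size C'" "count C x = Suc a" "\<And>b. b \<noteq> x \<Longrightarrow> count C' b = count C b"
    using Suc.hyps(2) xC by (auto simp: C'_def a_def size_Diff_singleton)
  have mem: "b \<in># C' \<longleftrightarrow> (if b = x then a > 0 else b \<in># C)" for b
    using C'_simps(3)[of b] by (cases "b = x") (simp_all only: a_def simp_thms if_True if_False flip: count_greater_zero_iff)
  have set_t': "set t' = set_mset C - {x}" using Suc.prems t xC by auto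
  have cnt: "count C' b = count C b" if "b \<in> set t'" for b
    using that xC(2) C'_simps(3)[of b] by blast
  let ?W = "{w. mset w = C' \<and> without x (last_occs w) = t'}"
  have "(\<Sum>w\<in>{w. mset w = C \<and> last_occs w = t}. q ^ Zstat w)
    = (\<Sum>z\<in>set_mset C. \<Sum>w\<in>{w. mset w = C - {#z#} \<and> last_occs (w @ [z]) = t}. q ^ Zstat (w @ [z]))"
    by (rule sum_words_snoc[OF C])
  also have "\<dots> = (\<Sum>z\<in>{x}. \<Sum>w\<in>{w. mset w = C - {#z#} \<and> last_occs (w @ [z]) = t}. q ^ Zstat (w @ [z]))"
    by (rule sum.mono_neutral_right) (use xC in \<open>auto simp: last_occs_snoc t intro!: sum.neutral\<close>)
  also have "\<dots> = (\<Sum>w\<in>?W. q ^ Zstat (w @ [x]))"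
    by (simp add: last_occs_snoc t C'_def)
  also have "\<dots> = last_occs_poly q (count C) t' * q ^ sum_above (count C) x t'
      * gbinom q (\<Sum>b\<leftarrow>t'. count C b) a"
  proof (cases "a = 0")
    case True
    have xn: "x \<notin> set w" if "mset w = C'" for w
      using True by (metis a_def count_eq_zero_iff set_mset_mset that)
    have W: "?W = {w. mset w = C' \<and> last_occs w = t'}"
    proof -
      have "without x (last_occs w) = last_occs w" if "mset w = C'" for w
        using xn[OF that] by (simp add: filter_neq_id)
      then show ?thesis by auto
    qed
    have "q ^ Zstat (w @ [x]) = q ^ Zstat w * q ^ sum_above (count C) x t'" if "w \<in> ?W" for w
    proof -
      have w: "mset w = C'" "last_occs w = t'" using that W by auto
      have "before x t' = t'" using xC(2) by (auto simp: takeWhile_eq_all_conv)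
      moreover have "map (\<lambda>b. if b > x then count C' x + count C' b else 0) t' = map (\<lambda>b. if b > x then count C b else 0) t'"
        using True by (simp add: cnt a_def)
      ultimately have "(\<Sum>b\<leftarrow>before x t'. if b > x then count C' x + count C' b else 0)
        = sum_above (count C) x t'"
        by (simp only:)
      then show ?thesis by (simp only: Zstat_snoc power_add w)
    qed
    then have "(\<Sum>w\<in>?W. q ^ Zstat (w @ [x])) = (\<Sum>w\<in>?W. q ^ Zstat w) * q ^ sum_above (count C) x t'"
      unfolding sum_distrib_right by (rule sum.cong[OF refl])
    also have "(\<Sum>w\<in>?W. q ^ Zstat w) = last_occs_poly q (count C') t'"
      unfolding W
    proof (rule Suc.hyps(1))
      show "set t' = set_mset C'"
        unfolding set_t' by (rule set_eqI) (simp add: mem True)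
    qed (fact C'_simps xC)+
    also have "\<dots> = last_occs_poly q (count C) t'"
      by (rule last_occs_poly_cong) (rule cnt)
    finally show ?thesis using True by simp
  next
    case False
    let ?g = "\<lambda>w. length (before x (last_occs w))"
    let ?t = "\<lambda>i. take i t' @ x # drop i t'"
    have char: "without x l = t' \<and> length (before x l) = i \<longleftrightarrow> l = ?t i \<and> i \<le> length t'"
      if "x \<in> set l" "distinct l" for l i
    proof
      assume l: "without x l = t' \<and> length (before x l) = i"
      have "\<exists>ys zs. l = ys @ x # zs \<and> x \<notin> set ys" using that(1) by (rule split_list_first)
      then obtain ys zs where ys: "l = ys @ x # zs" "x \<notin> set ys" by auto
      then have "before x l = ys" by (simp add: takeWhile_neq_append)
      moreover have "without x l = ys @ zs" using ys that(2) by (simp add: filter_neq_id)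
      ultimately have "t' = ys @ zs" "i = length ys" using l by metis+
      then show "l = ?t i \<and> i \<le> length t'" using ys(1) by simp
    next
      assume l: "l = ?t i \<and> i \<le> length t'"
      have "x \<notin> set (take i t')" "x \<notin> set (drop i t')"
        using xC(2) by (auto dest: in_set_takeD in_set_dropD)
      moreover from this have "without x (take i t') = take i t'" "without x (drop i t') = drop i t'"
        by (simp_all add: filter_neq_id)
      ultimately show "without x l = t' \<and> length (before x l) = i"
        using l by (simp add: takeWhile_neq_append)
    qed
    have xin: "x \<in> set w" if "mset w = C'" for w
      using False by (metis a_def count_eq_zero_iff set_mset_mset that)
    have fibre: "{w \<in> ?W. ?g w = i} = {w. mset w = C' \<and> last_occs w = ?t i}" if "i \<le> length t'" for i
    proof -
      have "w \<in> ?W \<and> ?g w = i \<longleftrightarrow> mset w = C' \<and> last_occs w = ?t i" for w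
        using char[of "last_occs w" i] xin[of w] that by auto
      then show ?thesis by auto
    qed
    have "(\<Sum>w\<in>?W. q ^ Zstat (w @ [x])) = (\<Sum>i\<le>length t'. \<Sum>w\<in>{w \<in> ?W. ?g w = i}. q ^ Zstat (w @ [x]))"
    proof (rule sum.group[symmetric])
      show "?g ` ?W \<subseteq> {..length t'}"
      proof
        fix i assume "i \<in> ?g ` ?W"
        then obtain w where w: "w \<in> ?W" "i = ?g w" by auto
        with char[of "last_occs w" i] xin[of w] show "i \<in> {..length t'}" by auto
      qed
    qed auto
    also have "\<dots> = (\<Sum>i\<le>length t'. q ^ sum_above (\<lambda>b. a + count C' b) x (take i t')
        * last_occs_poly q (count C') (?t i))"
    proof (rule sum.cong[OF refl])
      fix i assume "i \<in> {..length t'}"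
      then have i: "i \<le> length t'" by simp
      have "q ^ Zstat (w @ [x]) = q ^ sum_above (\<lambda>b. a + count C' b) x (take i t') * q ^ Zstat w"
        if "w \<in> {w. mset w = C' \<and> last_occs w = ?t i}" for w
      proof -
        have w: "mset w = C'" "last_occs w = ?t i" using that by auto
        have tw: "before x (?t i) = take i t'"
          using xC(2) by (intro takeWhile_neq_append) (auto dest: in_set_takeD)
        show ?thesis unfolding Zstat_snoc w tw a_def by (simp only: power_add mult.commute)
      qed
      then have "(\<Sum>w\<in>{w \<in> ?W. ?g w = i}. q ^ Zstat (w @ [x]))
        = q ^ sum_above (\<lambda>b. a + count C' b) x (take i t') * (\<Sum>w\<in>{w. mset w = C' \<and> last_occs w = ?t i}. q ^ Zstat w)"
        unfolding fibre[OF i] sum_distrib_left by (rule sum.cong[OF refl])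
      also have "(\<Sum>w\<in>{w. mset w = C' \<and> last_occs w = ?t i}. q ^ Zstat w) = last_occs_poly q (count C') (?t i)"
      proof (rule Suc.hyps(1))
        have "set (take i t') \<union> set (drop i t') = set t'" by (metis append_take_drop_id set_append)
        moreover have "set_mset C' = insert x (set t')"
          unfolding set_t' by (rule set_eqI) (use False in \<open>simp add: mem\<close>)
        ultimately show "set (?t i) = set_mset C'" by auto
        show "distinct (?t i)" using xC by (auto dest: in_set_takeD in_set_dropD simp: set_take_disj_set_drop_if_distinct)
      qed (fact C'_simps(1))
      finally show "(\<Sum>w\<in>{w \<in> ?W. ?g w = i}. q ^ Zstat (w @ [x]))
        = q ^ sum_above (\<lambda>b. a + count C' b) x (take i t') * last_occs_poly q (count C') (?t i)" .
    qed
    also have "\<dots> = last_occs_poly q (count C') t' * q ^ sum_above (count C') x t' * gbinom q (\<Sum>b\<leftarrow>t'. count C' b) a"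
    proof (rule sum_last_occs_poly_insert)
      show "count C' b \<ge> 1" if "b \<in> set t'" for b
      proof -
        have "b \<noteq> x" "b \<in># C" using that set_t' by auto
        then show ?thesis using C'_simps(3)[of b] by (simp add: Suc_le_eq)
      qed
    qed (use xC False in \<open>auto simp: a_def\<close>)
    also have "last_occs_poly q (count C') t' = last_occs_poly q (count C) t'"
      by (rule last_occs_poly_cong) (rule cnt)
    also have "map (count C') t' = map (count C) t'" by (simp add: cnt)
    also have "map (\<lambda>b. if b > x then count C' b else 0) t' = map (\<lambda>b. if b > x then count C b else 0) t'"
      by (simp add: cnt)
    finally show ?thesis .
  qed
  also have "\<dots> = last_occs_poly q (count C) t" using C'_simps by (simp add: t)
  finally show ?case .
qed

lemma last_ordered_iff_sorted: "last_ordered w \<longleftrightarrow> sorted (remdups w)"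
  by (induction w) (auto simp: order.order_iff_strict)

lemma count_type_mset: "count (type_mset m k) i = (if 1 \<le> i \<and> i \<le> m then k i else 0)"
  by (induction m) (auto simp: type_mset_Suc)

text \<open>For last occurrences in increasing order, the list read from right to left is
  decreasing; every \<open>sum_above\<close> vanishes and only the Gaussian binomial coefficients
  remain.\<close>

theorem sum_Zstat:
  fixes q :: "'a::comm_semiring_1"
  assumes "\<And>i. i \<in> {1..m} \<Longrightarrow> k i \<ge> 1"
  shows "(\<Sum>w\<in>ordered_words m k. q ^ Zstat w) = word_poly q m k"
proof -
  let ?C = "type_mset m k" and ?t = "rev [1..<Suc m]"
  have C: "set_mset ?C = {1..m}"
    using assms by (auto simp: count_type_mset set_mset_def Suc_le_eq)
  have "last_ordered w \<longleftrightarrow> last_occs w = ?t" if "mset w = ?C" for w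
  proof -
    have "set w = {1..m}" using that C by (metis set_mset_mset)
    then have "sorted (remdups w) \<longleftrightarrow> remdups w = [1..<Suc m]"
      using sorted_distinct_set_unique[of "remdups w" "[1..<Suc m]"]
      by (auto simp: atLeastLessThanSuc_atLeastAtMost simp del: upt_Suc)
    then show ?thesis by (simp add: last_ordered_iff_sorted last_occs_def del: upt_Suc)
  qed
  then have "ordered_words m k = {w. mset w = ?C \<and> last_occs w = ?t}"
    by (auto simp: ordered_words_def)
  then have "(\<Sum>w\<in>ordered_words m k. q ^ Zstat w) = last_occs_poly q (count ?C) ?t"
    using C by (simp only:) (rule sum_Zstat_last_occs; auto)
  also have "\<dots> = last_occs_poly q k ?t"
    by (rule last_occs_poly_cong) (auto simp: count_type_mset)
  also have "\<dots> = word_poly q m k"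
  proof (induction m)
    case (Suc m)
    have "(\<Sum>b\<leftarrow>rev [1..<Suc m]. if b > Suc m then k b else 0) = 0"
      by (auto simp: sum_list_eq_0_iff)
    moreover have "(\<Sum>b\<leftarrow>rev [1..<Suc m]. k b) = sum k {1..m}"
      by (metis atLeastLessThanSuc_atLeastAtMost interv_sum_list_conv_sum_set_nat rev_map sum_list_rev set_upt)
    moreover have "rev [1..<Suc (Suc m)] = Suc m # rev [1..<Suc m]" by simp
    ultimately show ?case using Suc by (simp only: last_occs_poly.simps word_poly_Suc power_0 mult_1_right)
  qed simp
  finally show ?thesis .
qed

section \<open>Sums over marked words\<close>

text \<open>\<open>esum q [l1, \<dots>, ln] f\<close> is the image of the product of the \<open>1 + y * q ^ li\<close> under the linear map
  that sends \<open>y ^ t\<close> to \<open>f t\<close>.\<close>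

fun esum :: "'a::comm_semiring_1 \<Rightarrow> nat list \<Rightarrow> (nat \<Rightarrow> 'a) \<Rightarrow> 'a" where
  "esum q [] f = f 0"
| "esum q (l # ls) f = esum q ls f + q ^ l * esum q ls (\<lambda>t. f (Suc t))"

lemma esum_add: "esum q ls (\<lambda>t. f t + g t) = esum q ls f + esum q ls g"
  by (induction ls arbitrary: f g) (simp_all add: algebra_simps)

lemma esum_mult: "esum q ls (\<lambda>t. c * f t) = c * esum q ls f"
  by (induction ls arbitrary: f) (simp_all add: algebra_simps)

lemma esum_0: "esum q ls (\<lambda>t. 0) = 0"
  using esum_mult[of q ls 0 "\<lambda>t. 0"] by simp

lemma esum_delta: "esum q ls (\<lambda>t. if t = 0 then 1 else 0) = 1"
  by (induction ls) (simp_all add: esum_0)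

lemma esum_append: "esum q (xs @ ys) f = esum q xs (\<lambda>s. esum q ys (\<lambda>t. f (s + t)))"
  by (induction xs arbitrary: f) simp_all

lemma esum_move: "esum q (xs @ l # ys) f = esum q (l # xs @ ys) f"
  by (induction xs arbitrary: f) (simp_all add: algebra_simps)

lemma esum_mset_cong: "mset xs = mset ys \<Longrightarrow> esum q xs f = esum q ys f"
proof (induction xs arbitrary: ys f)
  case (Cons x xs)
  then have "x \<in> set ys" by (metis list.set_intros(1) mset_eq_setD)
  then obtain us vs where ys: "ys = us @ x # vs" by (auto dest: split_list)
  with Cons.prems have "mset xs = mset (us @ vs)" by simp
  then have "esum q xs g = esum q (us @ vs) g" for g by (rule Cons.IH)
  then show ?case unfolding ys esum_move by simp
qed simp

text \<open>Replacing \<open>y\<close> by \<open>y * q ^ d\<close> in the product raises every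
  exponent by \<open>d\<close>.\<close>

lemma esum_scale: "esum q ls (\<lambda>t. q ^ (d * t) * f t) = esum q (map (\<lambda>l. l + d) ls) f"
proof (induction ls arbitrary: f)
  case (Cons l ls)
  have "esum q ls (\<lambda>t. q ^ (d * Suc t) * f (Suc t)) = q ^ d * esum q ls (\<lambda>t. q ^ (d * t) * f (Suc t))"
    unfolding esum_mult[symmetric] by (simp add: power_add mult.assoc)
  then show ?case by (simp only: esum.simps list.map Cons power_add mult.assoc)
qed simp

lemma esum_upt_Suc:
  "esum q [1..<Suc (Suc n)] f = esum q [1..<Suc n] f + q ^ Suc n * esum q [1..<Suc n] (\<lambda>t. f (Suc t))"
proof -
  have "esum q [1..<Suc (Suc n)] f = esum q (Suc n # [1..<Suc n]) f"
    by (rule esum_mset_cong) simp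
  then show ?thesis by simp
qed

text \<open>Here the factor \<open>1 + y * q\<close> is split off instead of the one with the
  largest exponent. The other factors are those for \<open>n\<close> with \<open>y * q\<close> in
  place of \<open>y\<close>, which produces the powers of \<open>q\<close>.\<close>

lemma esum_upt_Suc':
  "esum q [1..<Suc (Suc n)] f = esum q [1..<Suc n] (\<lambda>t. q ^ Suc t * f (Suc t) + q ^ t * f t)"
proof -
  have "[1..<Suc (Suc n)] = 1 # map (\<lambda>l. l + 1) [1..<Suc n]"
    using upt_conv_Cons[of 1 "Suc (Suc n)"] map_Suc_upt[of 1 "Suc n"] by (simp del: upt_Suc)
  then have "esum q [1..<Suc (Suc n)] f = esum q [1..<Suc n] (\<lambda>t. q ^ t * f t)
      + q * esum q [1..<Suc n] (\<lambda>t. q ^ t * f (Suc t))"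
    using esum_scale[of q "[1..<Suc n]" 1 f] esum_scale[of q "[1..<Suc n]" 1 "\<lambda>t. f (Suc t)"]
    by (simp del: upt_Suc)
  then show ?thesis
    unfolding esum_mult[symmetric] esum_add[symmetric] by (simp add: add.commute mult.assoc del: upt_Suc)
qed

text \<open>
  \<open>msum q t j f\<close> sums over the ways of inserting \<open>j\<close> copies of a new largest letter, one of them at
  the end, into a word with \<open>t\<close> marked letters: a marked letter either keeps its mark or is
  preceded by a copy of the new letter. The function \<open>f\<close> is applied to the number of kept marks.
\<close>

fun msum :: "'a::comm_semiring_1 \<Rightarrow> nat \<Rightarrow> nat \<Rightarrow> (nat \<Rightarrow> 'a) \<Rightarrow> 'a" where
  "msum q t 0 f = 0"
| "msum q 0 (Suc j) f = f 0"
| "msum q (Suc t) (Suc j) f = msum q t (Suc j) (\<lambda>s. f (Suc s)) + (q ^ Suc t * msum q (Suc t) j f + q ^ t * msum q t j f)"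

lemma msum_add: "msum q t j (\<lambda>s. f s + g s) = msum q t j f + msum q t j g"
proof (induction q t j f arbitrary: g rule: msum.induct)
  case (3 q t j f)
  show ?case unfolding msum.simps "3.IH" by (simp only: algebra_simps)
qed simp_all

lemma msum_mult: "msum q t j (\<lambda>s. c * f s) = c * msum q t j f"
proof (induction q t j f rule: msum.induct)
  case (3 q t j f)
  show ?case unfolding msum.simps "3.IH" by (simp only: algebra_simps)
qed simp_all

text \<open>Splitting off the largest exponent makes the case \<open>Suc t\<close> of
  \<open>msum\<close> applicable. Its last two summands have exactly the form that
  \<open>esum_upt_Suc'\<close> produces, so they recombine to a sum over all of
  \<open>[1..<Suc n]\<close> with one copy fewer. The coefficients add up by the defining Pascal
  rule.\<close>

lemma esum_msum:
  "esum q [1..<Suc n] (\<lambda>t. msum q t (Suc j) f) = gbinom q n j * esum q [1..<Suc n] f"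
proof (induction "n + j" arbitrary: n j f rule: less_induct)
  case less
  let ?L = "\<lambda>n. esum q [1..<Suc n]"
  show ?case
  proof (cases n)
    case (Suc n')
    let ?c = "if j = 0 then 0 else q ^ n * gbinom q n (j - 1)"
    have "?L n (\<lambda>t. msum q t (Suc j) f)
      = ?L n' (\<lambda>t. msum q t (Suc j) f)
        + q ^ n * ?L n' (\<lambda>t. msum q t (Suc j) (\<lambda>s. f (Suc s)) + (q ^ Suc t * msum q (Suc t) j f + q ^ t * msum q t j f))"
      unfolding Suc esum_upt_Suc by (simp del: upt_Suc)
    also have "?L n' (\<lambda>t. msum q t (Suc j) (\<lambda>s. f (Suc s)) + (q ^ Suc t * msum q (Suc t) j f + q ^ t * msum q t j f))
      = ?L n' (\<lambda>t. msum q t (Suc j) (\<lambda>s. f (Suc s))) + ?L n (\<lambda>t. msum q t j f)"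
      unfolding Suc esum_upt_Suc' esum_add ..
    also have "?L n' (\<lambda>t. msum q t (Suc j) f) = gbinom q n' j * ?L n' f"
      by (rule less) (simp add: Suc)
    also have "?L n' (\<lambda>t. msum q t (Suc j) (\<lambda>s. f (Suc s))) = gbinom q n' j * ?L n' (\<lambda>t. f (Suc t))"
      by (rule less) (simp add: Suc)
    also have "?L n (\<lambda>t. msum q t j f) = (if j = 0 then 0 else gbinom q n (j - 1) * ?L n f)"
    proof (cases j)
      case 0
      then show ?thesis by (simp add: esum_0 del: upt_Suc)
    next
      case (Suc j')
      then show ?thesis using less[of n j' f] by (simp del: upt_Suc)
    qed
    also have "gbinom q n' j * ?L n' f + q ^ n * (gbinom q n' j * ?L n' (\<lambda>t. f (Suc t))
        + (if j = 0 then 0 else gbinom q n (j - 1) * ?L n f))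
      = gbinom q n' j * (?L n' f + q ^ n * ?L n' (\<lambda>t. f (Suc t)))
        + ?c * ?L n f"
      by (simp add: algebra_simps del: upt_Suc)
    also have "?L n' f + q ^ n * ?L n' (\<lambda>t. f (Suc t)) = ?L n f"
      unfolding Suc esum_upt_Suc ..
    also have "gbinom q n' j * ?L n f + ?c * ?L n f
      = (gbinom q n' j + ?c) * ?L n f"
      by (simp only: distrib_right)
    also have "gbinom q n' j + ?c = gbinom q n j"
      unfolding Suc by (cases j) simp_all
    finally show ?thesis .
  qed simp
qed

text \<open>
  A mark on a letter stands for a copy, just before it, of a letter larger than all others.
  \<open>crossings y p v\<close> counts the descents from a letter at least \<open>y\<close> to a letter below \<open>y\<close> in \<open>v\<close>;
  \<open>p\<close> tells whether the letter preceding \<open>v\<close> is at least \<open>y\<close>. In \<open>marked_stat D z p v\<close> the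
  letter preceding \<open>v\<close> is \<open>p\<close>, the virtual letter is \<open>z\<close>, and a descent from \<open>b\<close> to \<open>c\<close> that is followed
  by \<open>n\<close> further copies of \<open>c\<close> has weight \<open>D b c n\<close>.
\<close>

fun crossings :: "nat \<Rightarrow> bool \<Rightarrow> (nat \<times> bool) list \<Rightarrow> nat" where
  "crossings y p [] = 0"
| "crossings y p ((c, f) # v) = of_bool ((p \<or> f) \<and> c < y) + crossings y (y \<le> c) v"

fun marked_stat :: "(nat \<Rightarrow> nat \<Rightarrow> nat \<Rightarrow> nat) \<Rightarrow> nat \<Rightarrow> nat \<Rightarrow> (nat \<times> bool) list \<Rightarrow> nat" where
  "marked_stat D z p [] = 0"
| "marked_stat D z p ((c, f) # v) =
     (if f then D z c (count_list (map fst v) c) else if c < p then D p c (count_list (map fst v) c) else 0)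
     + crossings c False v + marked_stat D z c v"

abbreviation marks :: "(nat \<times> bool) list \<Rightarrow> nat" where
  "marks v \<equiv> length (filter snd v)"

text \<open>The flag \<open>p\<close> records that a copy of \<open>x\<close> has just been removed.
  A mark of the result stands for a virtual letter, a copy of \<open>x\<close>, or both: seen from
  the smaller letters, they are one and the same virtual letter.\<close>

fun base :: "nat \<Rightarrow> bool \<Rightarrow> (nat \<times> bool) list \<Rightarrow> (nat \<times> bool) list" where
  "base x p [] = []"
| "base x p ((c, f) # v) = (if c < x then (c, f \<or> p) # base x False v else base x True v)"

lemma map_fst_base: "map fst (base x p v) = below x (map fst v)"
  by (induction x p v rule: base.induct) auto

lemma count_list_base: "a < x \<Longrightarrow> count_list (map fst (base x p v)) a = count_list (map fst v) a"
  by (induction x p v rule: base.induct) auto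

text \<open>Copies of \<open>x\<close> and virtual letters lie on the same side of \<open>y\<close>,
  so merging them leaves the crossings at \<open>y\<close> unchanged.\<close>

lemma crossings_base: "y < x \<Longrightarrow> crossings y p (base x p0 v) = crossings y (p \<or> p0) v"
  by (induction x p0 v arbitrary: p rule: base.induct) auto

lemma crossings_max: "crossings x p v = marks (base x p v)"
  by (induction x p v rule: base.induct) (auto simp: not_less)

section \<open>Marked words with a given base\<close>

definition fibre :: "nat \<Rightarrow> (nat \<times> bool) list \<Rightarrow> nat \<Rightarrow> (nat \<times> bool) list set" where
  "fibre x b j = {v. base x False v = b \<and> not_below x (map fst v) = replicate j x
     \<and> v \<noteq> [] \<and> fst (last v) = x}"

lemma fibre_0 [simp]: "fibre x b 0 = {}"
proof -
  have False if "v \<in> fibre x b 0" for v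
  proof -
    have "last v \<in> set v" "fst (last v) = x" "not_below x (map fst v) = []"
      using that by (auto simp: fibre_def)
    then show False by (force simp: filter_empty_conv)
  qed
  then show ?thesis by auto
qed

lemma base_True_Nil: "base x True v = [] \<longleftrightarrow> base x False v = []"
  by (cases v) auto

text \<open>Behind a removed copy of \<open>x\<close> the next surviving letter is marked in any
  case. It may have been marked anyway, or be an unmarked letter directly behind that copy.\<close>

lemma base_True_Cons:
  "base x True v = (a, f) # b \<longleftrightarrow> f \<and> (base x False v = (a, True) # b
     \<or> (\<exists>u. v = (a, False) # u \<and> a < x \<and> base x False u = b))"
proof (induction v)
  case (Cons p v)
  obtain c g where p: "p = (c, g)" by (cases p)
  show ?case
  proof (cases "c < x")
    case True
    then show ?thesis by (cases g) (auto simp: p)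
  next
    case False
    have "base x True v = (a, f) # b \<Longrightarrow> f" using Cons by blast
    then show ?thesis using False by (auto simp: p)
  qed
qed simp

lemma fibre_Nil_Suc:
  "fibre x [] (Suc j) = (\<Union>f. (#) (x, f) ` (if j = 0 then {[]} else fibre x [] j))"
proof (intro equalityI subsetI)
  fix v assume v: "v \<in> fibre x [] (Suc j)"
  then obtain c f u where u: "v = (c, f) # u" by (cases v) (auto simp: fibre_def)
  have c: "c = x" and b: "base x False u = []" "not_below x (map fst u) = replicate j x"
    using v by (auto simp: fibre_def u base_True_Nil split: if_splits)
  show "v \<in> (\<Union>f. (#) (x, f) ` (if j = 0 then {[]} else fibre x [] j))"
  proof (cases "u = []")
    case True
    then show ?thesis using b u c by auto
  next
    case False
    have "j \<noteq> 0"
    proof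
      assume "j = 0"
      then have "u \<in> fibre x [] 0" using b False v by (auto simp: fibre_def u)
      then show False by simp
    qed
    then show ?thesis using False b v by (auto simp: fibre_def u c)
  qed
qed (auto simp: fibre_def base_True_Nil split: if_splits)

lemma fibre_Cons_False:
  "a < x \<Longrightarrow> fibre x ((a, False) # b) j = (#) (a, False) ` fibre x b j"
proof (intro equalityI subsetI)
  fix v assume a: "a < x" and v: "v \<in> fibre x ((a, False) # b) j"
  then obtain c f u where u: "v = (c, f) # u" by (cases v) (auto simp: fibre_def)
  show "v \<in> (#) (a, False) ` fibre x b j"
    using v a by (cases "u = []") (auto simp: fibre_def u base_True_Cons split: if_splits)
qed (auto simp: fibre_def)

text \<open>These are the three summands of \<open>msum\<close>: the word starts with the marked
  letter, with a copy of \<open>x\<close> after which the mark is still to be produced, or with a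
  copy of \<open>x\<close> that itself produces the mark.\<close>

lemma fibre_Cons_True:
  assumes "a < x"
  shows "fibre x ((a, True) # b) (Suc j) = (#) (a, True) ` fibre x b (Suc j)
    \<union> (\<Union>f. (#) (x, f) ` (fibre x ((a, True) # b) j \<union> (#) (a, False) ` fibre x b j))"
    (is "_ = ?R")
proof (intro equalityI subsetI)
  fix v assume v: "v \<in> fibre x ((a, True) # b) (Suc j)"
  then obtain c f u where u: "v = (c, f) # u" by (cases v) (auto simp: fibre_def)
  show "v \<in> ?R"
  proof (cases "c < x")
    case True
    then have "c = a" "f" "base x False u = b" "not_below x (map fst u) = replicate (Suc j) x"
      using v by (auto simp: fibre_def u)
    moreover from this have "u \<noteq> []" by auto
    ultimately have "u \<in> fibre x b (Suc j)" using v by (auto simp: fibre_def u)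
    with \<open>c = a\<close> \<open>f\<close> show ?thesis by (auto simp: u)
  next
    case False
    have r: "not_below x (map fst u) = replicate j x" and c: "c = x"
      using v False by (auto simp: fibre_def u)
    have b: "base x True u = (a, True) # b" using v False by (auto simp: fibre_def u)
    then have ne: "u \<noteq> []" by auto
    then have l: "fst (last u) = x" using v by (auto simp: fibre_def u)
    from b show ?thesis unfolding base_True_Cons
    proof (elim conjE disjE exE)
      assume "base x False u = (a, True) # b"
      then have "u \<in> fibre x ((a, True) # b) j" using r ne l by (auto simp: fibre_def)
      then show ?thesis by (auto simp: u c)
    next
      fix u' assume u': "u = (a, False) # u'" "a < x" "base x False u' = b"
      then have "u' \<noteq> []" using l by auto
      then have "u' \<in> fibre x b j" using r l u' by (auto simp: fibre_def)
      then show ?thesis by (auto simp: u c u')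
    qed
  qed
next
  fix v assume "v \<in> ?R"
  then show "v \<in> fibre x ((a, True) # b) (Suc j)"
    using assms by (auto simp: fibre_def base_True_Cons)
qed

lemma finite_fibre: "finite (fibre x b j)"
proof (rule finite_subset)
  show "fibre x b j \<subseteq> {v. set v \<subseteq> (set (map fst b) \<union> {x}) \<times> UNIV \<and> length v = length b + j}"
  proof
    fix v assume v: "v \<in> fibre x b j"
    have "length (map fst v) = length (below x (map fst v)) + length (not_below x (map fst v))"
      by (rule sum_length_filter_compl[symmetric])
    moreover have "below x (map fst v) = map fst b" using v map_fst_base[of x False v] by (auto simp: fibre_def)
    moreover have "not_below x (map fst v) = replicate j x" using v by (auto simp: fibre_def)
    moreover have "fst c \<in> set (map fst b) \<union> {x}" if "c \<in> set v" for c
    proof -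
      have "fst c \<in> set (below x (map fst v)) \<or> fst c \<in> set (not_below x (map fst v))"
        using that by auto
      then show ?thesis using calculation(2,3) by (auto split: if_splits)
    qed
    ultimately show "v \<in> {v. set v \<subseteq> (set (map fst b) \<union> {x}) \<times> UNIV \<and> length v = length b + j}"
      by (force simp: subset_iff mem_Times_iff)
  qed
  show "finite {v. set v \<subseteq> (set (map fst b) \<union> {x}) \<times> (UNIV :: bool set) \<and> length v = length b + j}"
    by (rule finite_lists_length_eq) auto
qed

section \<open>Summation over the words with a given base\<close>

lemma count_list_filter: "count_list (filter P w) x = (if P x then count_list w x else 0)"
  by (induction w) auto

lemma count_list_fibre: "v \<in> fibre x b j \<Longrightarrow> count_list (map fst v) x = j"
proof -
  assume "v \<in> fibre x b j"
  then have "count_list (not_below x (map fst v)) x = count_list (replicate j x) x"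
    by (simp add: fibre_def)
  moreover have "count_list (replicate j x) x = j" by (induction j) auto
  ultimately show ?thesis by (simp add: count_list_filter)
qed

lemma sum_UN_bool_Cons:
  assumes "finite A"
  shows "(\<Sum>v\<in>(\<Union>f. (#) (x, f) ` A). h v) = (\<Sum>u\<in>A. h ((x, False) # u)) + (\<Sum>u\<in>A. h ((x, True) # u))"
proof -
  have "(\<Union>f. (#) (x, f) ` A) = (#) (x, False) ` A \<union> (#) (x, True) ` A"
    by (auto simp: UN_bool_eq)
  then have "(\<Sum>v\<in>(\<Union>f. (#) (x, f) ` A). h v) = sum h ((#) (x, False) ` A) + sum h ((#) (x, True) ` A)"
    by (simp only:) (rule sum.union_disjoint; use assms in auto)
  then show ?thesis by (simp add: sum.reindex)
qed

text \<open>The \<open>j\<close> copies of \<open>x\<close> are marked independently, and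
  \<open>fl n\<close> is the weight of a mark on the copy followed by \<open>n\<close> others. Each
  of the \<open>s\<close> marks kept from the base gains \<open>d\<close>, because its virtual
  letter is no longer \<open>x\<close> but a larger one.\<close>

definition flag_fun :: "'a::comm_semiring_1 \<Rightarrow> (nat \<Rightarrow> nat) \<Rightarrow> nat \<Rightarrow> nat \<Rightarrow> (nat \<Rightarrow> 'a) \<Rightarrow> nat \<Rightarrow> 'a" where
  "flag_fun q fl d j f s = q ^ (d * s) * esum q (map fl (rev [0..<j])) (\<lambda>t. f (s + t))"

lemma flag_fun_Suc:
  "flag_fun q fl d (Suc j) f s = flag_fun q fl d j f s + q ^ fl j * flag_fun q fl d j (\<lambda>s. f (Suc s)) s"
  by (simp add: flag_fun_def algebra_simps)

lemma msum_flag_fun_Suc: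
  "msum q t i (flag_fun q fl d (Suc j) f)
    = msum q t i (flag_fun q fl d j f) + q ^ fl j * msum q t i (flag_fun q fl d j (\<lambda>s. f (Suc s)))"
  unfolding msum_mult[symmetric] msum_add[symmetric] flag_fun_Suc[symmetric] ..

lemma flag_fun_shift:
  "flag_fun q fl d j f (Suc s) = q ^ d * flag_fun q fl d j (\<lambda>s. f (Suc s)) s"
  by (simp add: flag_fun_def power_add mult.assoc)

text \<open>Compared with the base, a kept mark gains \<open>d\<close>, a mark on a copy of
  \<open>x\<close> costs \<open>D z x n\<close>, and each copy of \<open>x\<close> adds the
  crossings to its right, which are the marks of the base behind it; these are the exponents
  \<open>Suc t\<close> and \<open>t\<close> in \<open>msum\<close>. An unmarked copy of
  \<open>x\<close> is no descent bottom, since the letters and \<open>p\<close> are at most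
  \<open>x\<close>.\<close>

lemma sum_fibre:
  fixes q :: "'a::comm_semiring_1"
  assumes D: "\<And>c n. c < x \<Longrightarrow> D z c n = D x c n + d"
    and "p \<le> x" "\<forall>c\<in>set b. fst c < x"
  shows "(\<Sum>v\<in>fibre x b j. f (marks v) * q ^ marked_stat D z p v)
    = q ^ marked_stat D x p b * msum q (marks b) j (flag_fun q (D z x) d j f)"
  using assms(2,3)
proof (induction "length b + j" arbitrary: b j f p rule: less_induct)
  case less
  let ?F = "flag_fun q (D z x) d" and ?S = "\<lambda>f p v. f (marks v) * q ^ marked_stat D z p v"
  note IH = less.hyps
  consider (zero) "j = 0" | (Nil) j' where "b = []" "j = Suc j'"
    | (False) a b' j' where "b = (a, False) # b'" "a < x" "j = Suc j'"
    | (True) a b' j' where "b = (a, True) # b'" "a < x" "j = Suc j'"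
  proof (cases j)
    case (Suc j')
    show ?thesis
    proof (cases b)
      case (Cons c b')
      obtain a g where "c = (a, g)" by (cases c)
      then show ?thesis using that(3,4) Suc Cons less.prems(2) by (cases g) auto
    qed (use that Suc in auto)
  qed (use that in auto)
  then show ?case
  proof cases
    case zero
    then show ?thesis by simp
  next
    case (Nil j')
    let ?A = "if j' = 0 then {[]} else fibre x [] j'"
    have u: "count_list (map fst u) x = j'" "crossings x False u = 0" if "u \<in> ?A" for u
      using that count_list_fibre[of u x "[]" j'] by (auto simp: crossings_max fibre_def split: if_splits)
    have A: "(\<Sum>u\<in>?A. f (marks u) * q ^ marked_stat D z x u) = ?F j' f 0" for f
      using IH[of "[]" j' x f] Nil by (cases j') (auto simp: flag_fun_def)
    have "(\<Sum>v\<in>fibre x b j. ?S f p v) = (\<Sum>u\<in>?A. ?S f p ((x, False) # u)) + (\<Sum>u\<in>?A. ?S f p ((x, True) # u))"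
      unfolding Nil fibre_Nil_Suc by (rule sum_UN_bool_Cons) (simp add: finite_fibre)
    also have "(\<Sum>u\<in>?A. ?S f p ((x, False) # u)) = (\<Sum>u\<in>?A. ?S f x u)"
      by (rule sum.cong) (use u less.prems in auto)
    also have "(\<Sum>u\<in>?A. ?S f p ((x, True) # u)) = q ^ D z x j' * (\<Sum>u\<in>?A. ?S (\<lambda>s. f (Suc s)) x u)"
      unfolding sum_distrib_left by (rule sum.cong) (use u in \<open>auto simp: power_add mult_ac\<close>)
    finally have "(\<Sum>v\<in>fibre x b j. ?S f p v) = ?F j' f 0 + q ^ D z x j' * ?F j' (\<lambda>s. f (Suc s)) 0"
      unfolding A[of f] A[of "\<lambda>s. f (Suc s)"] .
    then show ?thesis using Nil by (simp add: flag_fun_Suc)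
  next
    case (False a b' j')
    have "(\<Sum>v\<in>fibre x b j. ?S f p v) = (\<Sum>u\<in>fibre x b' j. ?S f p ((a, False) # u))"
      unfolding False(1) fibre_Cons_False[OF False(2)] by (simp add: sum.reindex)
    also have "\<dots> = q ^ ((if a < p then D p a (count_list (map fst b') a) else 0) + crossings a False b')
        * (\<Sum>u\<in>fibre x b' j. ?S f a u)"
      unfolding sum_distrib_left
    proof (rule sum.cong[OF refl])
      fix u assume "u \<in> fibre x b' j"
      then have u: "base x False u = b'" by (simp add: fibre_def)
      show "?S f p ((a, False) # u) = q ^ ((if a < p then D p a (count_list (map fst b') a) else 0) + crossings a False b') * ?S f a u"
        using crossings_base[OF False(2), of False False u] count_list_base[OF False(2), of False u]
        by (simp add: u power_add mult_ac)
    qed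
    also have "(\<Sum>u\<in>fibre x b' j. ?S f a u) = q ^ marked_stat D x a b' * msum q (marks b') j (?F j f)"
      using less.prems False by (intro IH) auto
    finally show ?thesis by (simp add: False(1) power_add mult_ac)
  next
    case (True a b' j')
    let ?f = "\<lambda>g. if g then \<lambda>s. f (Suc s) else f"
    let ?k = "count_list (map fst b') a" and ?c = "crossings a False b'"
    define Q where "Q = q ^ marked_stat D x p b"
    have Q: "Q = q ^ (D x a ?k + ?c + marked_stat D x a b')" by (simp add: Q_def True(1))
    have bx: "\<forall>c\<in>set b'. fst c < x" using less.prems True by simp
    have u: "count_list (map fst u) a = ?k" "crossings a False u = ?c" "crossings x False u = marks b'"
      if "u \<in> fibre x b' i" for u i
      using that crossings_base[OF True(2), of False False u] count_list_base[OF True(2), of False u]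
      by (auto simp: fibre_def crossings_max)
    let ?B = "(#) (a, True) ` fibre x b' j"
    let ?A = "fibre x b j'" and ?A' = "(#) (a, False) ` fibre x b' j'"
    have IH1: "(\<Sum>u\<in>fibre x b' i. ?S f a u) = q ^ marked_stat D x a b' * msum q (marks b') i (?F i f)" if "i \<le> j" for i f
      using less.prems True that by (intro IH) auto
    have IH2: "(\<Sum>u\<in>?A. ?S f x u) = Q * msum q (Suc (marks b')) j' (?F j' f)" for f
      using IH[of b j' x f] less.prems True by (simp add: Q_def)
    have S1: "(\<Sum>v\<in>?B. ?S f p v) = Q * msum q (marks b') j (\<lambda>s. ?F j f (Suc s))"
    proof -
      have "(\<Sum>v\<in>?B. ?S f p v) = (\<Sum>u\<in>fibre x b' j. ?S f p ((a, True) # u))"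
        by (simp add: sum.reindex)
      also have "\<dots> = q ^ d * q ^ (D x a ?k + ?c) * (\<Sum>u\<in>fibre x b' j. ?S (\<lambda>s. f (Suc s)) a u)"
        unfolding sum_distrib_left by (rule sum.cong) (use u D[OF True(2)] in \<open>auto simp: power_add mult_ac\<close>)
      finally show ?thesis
        using IH1[OF order_refl, of "\<lambda>s. f (Suc s)"] by (simp add: Q flag_fun_shift msum_mult power_add mult_ac)
    qed
    have S2: "(\<Sum>u\<in>?A. ?S f p ((x, g) # u)) = q ^ Suc (marks b') * (if g then q ^ D z x j' else 1) * (\<Sum>u\<in>?A. ?S (?f g) x u)" for g
      unfolding sum_distrib_left
    proof (rule sum.cong[OF refl])
      fix u assume "u \<in> ?A"
      then have "count_list (map fst u) x = j'" "crossings x False u = Suc (marks b')"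
        using count_list_fibre[of u x b j'] by (auto simp: fibre_def crossings_max True(1))
      then show "?S f p ((x, g) # u) = q ^ Suc (marks b') * (if g then q ^ D z x j' else 1) * ?S (?f g) x u"
        using less.prems(1) by (simp add: power_add mult_ac)
    qed
    have S3: "(\<Sum>u\<in>?A'. ?S f p ((x, g) # u)) = q ^ marks b' * (if g then q ^ D z x j' else 1) * (Q * msum q (marks b') j' (?F j' (?f g)))" for g
    proof -
      have "(\<Sum>u\<in>?A'. ?S f p ((x, g) # u)) = (\<Sum>u\<in>fibre x b' j'. ?S f p ((x, g) # (a, False) # u))"
        by (simp add: sum.reindex)
      also have "\<dots> = q ^ marks b' * (if g then q ^ D z x j' else 1) * q ^ (D x a ?k + ?c)
          * (\<Sum>u\<in>fibre x b' j'. ?S (?f g) a u)"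
        unfolding sum_distrib_left
        by (rule sum.cong) (use u count_list_fibre True(2) less.prems(1) in \<open>auto simp: power_add mult_ac\<close>)
      also have "(\<Sum>u\<in>fibre x b' j'. ?S (?f g) a u)
          = q ^ marked_stat D x a b' * msum q (marks b') j' (?F j' (?f g))"
        using True(3) by (intro IH1) simp
      finally show ?thesis by (simp only: Q power_add mult_ac)
    qed
    have disj: "?A \<inter> ?A' = {}"
    proof -
      have "(a, False) # u \<notin> ?A" for u using True(2) by (simp add: fibre_def True(1))
      then show ?thesis by blast
    qed
    have "(\<Sum>v\<in>fibre x b j. ?S f p v) = (\<Sum>v\<in>?B. ?S f p v) + (\<Sum>v\<in>(\<Union>g. (#) (x, g) ` (?A \<union> ?A')). ?S f p v)"
    proof -
      have "fibre x b j = ?B \<union> (\<Union>g. (#) (x, g) ` (?A \<union> ?A'))"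
        using fibre_Cons_True[OF True(2), of b' j'] by (simp add: True)
      moreover have "?B \<inter> (\<Union>g. (#) (x, g) ` (?A \<union> ?A')) = {}" using True(2) by auto
      ultimately show ?thesis
        by (simp only:) (rule sum.union_disjoint; simp add: finite_fibre)
    qed
    also have "(\<Sum>v\<in>(\<Union>g. (#) (x, g) ` (?A \<union> ?A')). ?S f p v)
       = (\<Sum>u\<in>?A. ?S f p ((x, False) # u)) + (\<Sum>u\<in>?A'. ?S f p ((x, False) # u))
         + ((\<Sum>u\<in>?A. ?S f p ((x, True) # u)) + (\<Sum>u\<in>?A'. ?S f p ((x, True) # u)))"
      by (subst sum_UN_bool_Cons) (simp_all only: sum.union_disjoint[OF _ _ disj] finite_fibre finite_imageI finite_UnI)
    also have "\<dots> = Q * (q ^ Suc (marks b') * msum q (Suc (marks b')) j' (?F j f) + q ^ marks b' * msum q (marks b') j' (?F j f))"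
      unfolding S2 S3
      unfolding if_True if_False IH2[of f] IH2[of "\<lambda>s. f (Suc s)"] True(3) msum_flag_fun_Suc
      by (simp only: algebra_simps mult_1_right mult_1_left)
    also have "(\<Sum>v\<in>?B. ?S f p v) + Q * (q ^ Suc (marks b') * msum q (Suc (marks b')) j' (?F j f) + q ^ marks b' * msum q (marks b') j' (?F j f))
        = Q * msum q (marks b) j (?F j f)"
      unfolding S1 by (simp add: True(1,3) distrib_left)
    finally show ?thesis by (simp only: Q_def)
  qed
qed

section \<open>The generating function of all marked words\<close>

definition marked_words :: "nat \<Rightarrow> (nat \<Rightarrow> nat) \<Rightarrow> (nat \<times> bool) list set" where
  "marked_words m k = {v. map fst v \<in> ordered_words m k}"

lemma finite_marked_words [simp]: "finite (marked_words m k)"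
proof (rule finite_subset)
  show "marked_words m k \<subseteq> {v. set v \<subseteq> {1..m} \<times> UNIV \<and> length v = sum k {1..m}}"
  proof
    fix v assume v: "v \<in> marked_words m k"
    then have "length (map fst v) = sum k {1..m}" "set (map fst v) \<subseteq> {1..m}"
      using length_ordered_word set_ordered_word unfolding marked_words_def by blast+
    then show "v \<in> {v. set v \<subseteq> {1..m} \<times> UNIV \<and> length v = sum k {1..m}}" by force
  qed
qed (rule finite_lists_length_eq; simp)

text \<open>The induction closes because of \<open>ms\<close>: the old exponents raised by
  \<open>d\<close>, together with the weights of marks on the new copies, are again the numbers from
  1 to the length of the word.\<close>

lemma sum_marked_words_Suc:
  fixes q :: "'a::comm_semiring_1"
  assumes IH: "\<And>f. (\<Sum>v\<in>marked_words m k. f (marks v) * q ^ marked_stat D (Suc m) 0 v)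
      = word_poly q m k * esum q [1..<Suc (sum k {1..m})] f"
    and k: "k (Suc m) \<ge> 1"
    and D: "\<And>c n. c < Suc m \<Longrightarrow> D (Suc (Suc m)) c n = D (Suc m) c n + d"
    and ms: "mset (map (\<lambda>l. l + d) [1..<Suc (sum k {1..m})] @ map (D (Suc (Suc m)) (Suc m)) (rev [0..<k (Suc m)]))
      = mset [1..<Suc (sum k {1..Suc m})]"
  shows "(\<Sum>v\<in>marked_words (Suc m) k. f (marks v) * q ^ marked_stat D (Suc (Suc m)) 0 v)
      = word_poly q (Suc m) k * esum q [1..<Suc (sum k {1..Suc m})] f"
proof -
  define x where "x = Suc m"
  let ?N = "sum k {1..m}" and ?K = "k x"
  let ?F = "flag_fun q (D (Suc x) x) d ?K f"
  have mem: "v \<in> marked_words x k \<longleftrightarrow> base x False v \<in> marked_words m k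
      \<and> not_below x (map fst v) = replicate ?K x \<and> v \<noteq> [] \<and> fst (last v) = x" for v
  proof (cases "v = []")
    case True
    then show ?thesis using ordered_words_Suc[of k m "[]"] k by (auto simp: marked_words_def x_def)
  next
    case False
    then show ?thesis
      using ordered_words_Suc[of k m "map fst v"] k by (simp add: marked_words_def map_fst_base x_def last_map)
  qed
  have "(\<Sum>v\<in>marked_words x k. f (marks v) * q ^ marked_stat D (Suc x) 0 v)
    = (\<Sum>b\<in>marked_words m k. \<Sum>v\<in>{v\<in>marked_words x k. base x False v = b}. f (marks v) * q ^ marked_stat D (Suc x) 0 v)"
    by (rule sum.group[symmetric]) (auto simp: mem)
  also have "\<dots> = (\<Sum>b\<in>marked_words m k. msum q (marks b) ?K ?F * q ^ marked_stat D x 0 b)"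
  proof (rule sum.cong[OF refl])
    fix b assume b: "b \<in> marked_words m k"
    then have "{v\<in>marked_words x k. base x False v = b} = fibre x b ?K"
      by (auto simp: mem fibre_def)
    moreover have "\<forall>c\<in>set b. fst c < x"
      using b set_ordered_word[of "map fst b" m k] by (fastforce simp: marked_words_def x_def)
    ultimately show "(\<Sum>v\<in>{v\<in>marked_words x k. base x False v = b}. f (marks v) * q ^ marked_stat D (Suc x) 0 v)
      = msum q (marks b) ?K ?F * q ^ marked_stat D x 0 b"
      using sum_fibre[of x D "Suc x" d 0 b f q ?K] D by (simp add: x_def mult.commute)
  qed
  also have "\<dots> = word_poly q m k * esum q [1..<Suc ?N] (\<lambda>t. msum q t ?K ?F)"
    unfolding x_def by (rule IH)
  also have "esum q [1..<Suc ?N] (\<lambda>t. msum q t ?K ?F) = gbinom q ?N (?K - 1) * esum q [1..<Suc ?N] ?F"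
    using esum_msum[of q ?N "?K - 1" ?F] k by (simp add: x_def del: upt_Suc)
  also have "esum q [1..<Suc ?N] ?F = esum q [1..<Suc (sum k {1..Suc m})] f"
    unfolding flag_fun_def esum_scale esum_append[symmetric]
    by (rule esum_mset_cong) (use ms in \<open>simp only: x_def\<close>)
  finally show ?thesis by (simp add: x_def word_poly_Suc mult.assoc)
qed

section \<open>The statistics MAK and MAD\<close>

lemma descent_block_decreasing:
  assumes "(a, b) \<in> descent_blocks w" "a \<le> i" "i < j" "j \<le> b"
  shows "w ! j < w ! i"
  using assms(3,4)
proof (induction j)
  case (Suc j)
  have "w ! Suc j < w ! j" using assms(1,2) Suc.prems by (auto simp: descent_blocks_def)
  then show ?case using Suc by (cases "i = j") auto
qed simp

lemma descent_blocks_disjoint: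
  assumes "(a, b) \<in> descent_blocks w" "(a', b') \<in> descent_blocks w" "a \<le> p" "p < b" "a' \<le> p" "p < b'"
  shows "a = a' \<and> b = b'"
proof -
  have 1: "\<not> a < a'" if "(a, b) \<in> descent_blocks w" "(a', b') \<in> descent_blocks w" "p < b" "a' \<le> p" for a b a' b'
  proof
    assume "a < a'"
    then have "a \<le> a' - 1" "a' - 1 < b" "Suc (a' - 1) = a'" using that by auto
    moreover have "\<forall>q. a \<le> q \<and> q < b \<longrightarrow> w ! q > w ! Suc q" "a' > 0 \<longrightarrow> w ! (a' - 1) \<le> w ! a'"
      using that by (simp_all add: descent_blocks_def)
    ultimately show False using \<open>a < a'\<close> by (metis gr_zeroI less_zeroE not_le)
  qed
  have 2: "\<not> b < b'" if "(a, b) \<in> descent_blocks w" "(a', b') \<in> descent_blocks w" "p < b" "a' \<le> p" for a b a' b'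
  proof
    assume "b < b'"
    then have "w ! b > w ! Suc b" "w ! b \<le> w ! Suc b"
      using that by (auto simp: descent_blocks_def)
    then show False by simp
  qed
  show ?thesis
    using 1[of a b a' b'] 1[of a' b' a b] 2[of a b a' b'] 2[of a' b' a b] assms by auto
qed

lemma descent_in_block:
  assumes "Suc p < length w" "w ! Suc p < w ! p"
  shows "\<exists>a b. (a, b) \<in> descent_blocks w \<and> a \<le> p \<and> p < b"
proof -
  have left: "\<exists>a\<le>p. (\<forall>q. a \<le> q \<and> q < p \<longrightarrow> w ! q > w ! Suc q) \<and> (a > 0 \<longrightarrow> w ! (a - 1) \<le> w ! a)" for p
  proof (induction p)
    case (Suc p)
    then obtain a where a: "a \<le> p" "\<forall>q. a \<le> q \<and> q < p \<longrightarrow> w ! q > w ! Suc q" "a > 0 \<longrightarrow> w ! (a - 1) \<le> w ! a"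
      by auto
    show ?case
    proof (cases "w ! p > w ! Suc p")
      case True
      then show ?thesis using a by (intro exI[of _ a]) (auto simp: less_Suc_eq)
    next
      case False
      then show ?thesis by (intro exI[of _ "Suc p"]) auto
    qed
  qed simp
  have right: "\<exists>b\<ge>p. b < length w \<and> (\<forall>q. p \<le> q \<and> q < b \<longrightarrow> w ! q > w ! Suc q) \<and> (Suc b < length w \<longrightarrow> w ! b \<le> w ! Suc b)"
    if "p < length w" for p
    using that
  proof (induction "length w - p" arbitrary: p rule: less_induct)
    case less
    show ?case
    proof (cases "Suc p < length w \<and> w ! p > w ! Suc p")
      case True
      then have "length w - Suc p < length w - p" "Suc p < length w" by auto
      from less.hyps[OF this] obtain b where b: "b \<ge> Suc p" "b < length w" "\<forall>q. Suc p \<le> q \<and> q < b \<longrightarrow> w ! q > w ! Suc q"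
        "Suc b < length w \<longrightarrow> w ! b \<le> w ! Suc b"
        by blast
      moreover have "\<forall>q. p \<le> q \<and> q < b \<longrightarrow> w ! q > w ! Suc q"
        using True b(3) by (metis Suc_leI le_neq_implies_less)
      ultimately show ?thesis by (intro exI[of _ b]) auto
    next
      case False
      then show ?thesis using less.prems by (intro exI[of _ p]) auto
    qed
  qed
  obtain a where a: "a \<le> p" "\<forall>q. a \<le> q \<and> q < p \<longrightarrow> w ! q > w ! Suc q" "a > 0 \<longrightarrow> w ! (a - 1) \<le> w ! a"
    using left by auto
  obtain b where b: "b \<ge> Suc p" "b < length w" "\<forall>q. Suc p \<le> q \<and> q < b \<longrightarrow> w ! q > w ! Suc q"
      "Suc b < length w \<longrightarrow> w ! b \<le> w ! Suc b"
    using right[OF assms(1)] by auto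
  have "\<forall>q. a \<le> q \<and> q < b \<longrightarrow> w ! q > w ! Suc q"
    using a(2) b(3) assms(2) by (metis Suc_leI le_neq_implies_less not_le)
  then have "(a, b) \<in> descent_blocks w" using a b by (auto simp: descent_blocks_def)
  then show ?thesis using a b by (intro exI[of _ a] exI[of _ b]) auto
qed

text \<open>A descent block embraces a letter exactly when one of its descents passes over the letter.\<close>

lemma right_embracing_eq_card_descents:
  assumes "i < length w"
  shows "right_embracing w i = card {p. i < p \<and> Suc p < length w \<and> w ! i \<le> w ! p \<and> w ! Suc p < w ! i}"
proof -
  define S where "S = {B \<in> descent_blocks w. i < fst B \<and> embraces w B (w ! i)}"
  define P where "P = (\<lambda>B. {p. fst B \<le> p \<and> p < snd B \<and> w ! i \<le> w ! p \<and> w ! Suc p < w ! i})"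
  have fin: "finite S"
    by (rule finite_subset[of _ "{..<length w} \<times> {..<length w}"]) (auto simp: S_def descent_blocks_def)
  have single: "card (P B) = 1" if "B \<in> S" for B
  proof -
    obtain a b where B: "B = (a, b)" by (cases B)
    have ab: "(a, b) \<in> descent_blocks w" "w ! a \<ge> w ! i" "w ! i > w ! b" "a \<le> b"
      using that by (auto simp: S_def B embraces_def descent_blocks_def)
    \<comment> \<open>The first place of the block at which it has dropped below the letter
      \<open>w ! i\<close>; the descent into this place is the only one of the block that passes
      over that letter.\<close>
    define j where "j = (LEAST j. a \<le> j \<and> w ! j < w ! i)"
    have j: "a \<le> j \<and> w ! j < w ! i" unfolding j_def by (rule LeastI[of _ b]) (use ab in auto)
    have jb: "j \<le> b" unfolding j_def by (rule Least_le) (use ab in auto)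
    have "j \<noteq> a" using j ab by auto
    then obtain p where p: "j = Suc p" "a \<le> p" using j by (cases j) auto
    have "\<not> (a \<le> p \<and> w ! p < w ! i)" using not_less_Least[of p "\<lambda>j. a \<le> j \<and> w ! j < w ! i"] p by (simp add: j_def[symmetric])
    then have pP: "p \<in> P B" using p j jb by (auto simp: P_def B)
    have "p' = p" if "p' \<in> P B" for p'
    proof (rule ccontr)
      assume "p' \<noteq> p"
      then consider "Suc p \<le> p'" | "Suc p' \<le> p" by linarith
      then show False
      proof cases
        case 1
        then have "w ! p' \<le> w ! Suc p"
          using descent_block_decreasing[OF ab(1), of "Suc p" p'] p that by (cases "p' = Suc p") (auto simp: P_def B)
        then show False using that pP by (auto simp: P_def)
      next
        case 2
        then have "w ! p \<le> w ! Suc p'"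
          using descent_block_decreasing[OF ab(1), of "Suc p'" p] that pP by (cases "p = Suc p'") (auto simp: P_def B)
        then show False using that pP by (auto simp: P_def)
      qed
    qed
    then have "P B = {p}" using pP by blast
    then show ?thesis by simp
  qed
  have "{p. i < p \<and> Suc p < length w \<and> w ! i \<le> w ! p \<and> w ! Suc p < w ! i} = (\<Union>B\<in>S. P B)"
  proof (intro equalityI subsetI)
    fix p assume p: "p \<in> {p. i < p \<and> Suc p < length w \<and> w ! i \<le> w ! p \<and> w ! Suc p < w ! i}"
    then have "w ! Suc p < w ! p" by auto
    then obtain a b where ab: "(a, b) \<in> descent_blocks w" "a \<le> p" "p < b"
      using descent_in_block[of p w] p by auto
    have "i < a"
    proof (rule ccontr)
      assume "\<not> i < a"
      then have "w ! p < w ! i" using descent_block_decreasing[OF ab(1), of i p] ab p by auto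
      then show False using p by auto
    qed
    moreover have "w ! p \<le> w ! a" using descent_block_decreasing[OF ab(1), of a p] ab by (cases "a = p") auto
    moreover have "w ! b \<le> w ! Suc p" using descent_block_decreasing[OF ab(1), of "Suc p" b] ab by (cases "b = Suc p") auto
    ultimately have "(a, b) \<in> S" using ab p by (auto simp: S_def embraces_def)
    moreover have "p \<in> P (a, b)" using ab p by (auto simp: P_def)
    ultimately show "p \<in> (\<Union>B\<in>S. P B)" by blast
  next
    fix p assume "p \<in> (\<Union>B\<in>S. P B)"
    then show "p \<in> {p. i < p \<and> Suc p < length w \<and> w ! i \<le> w ! p \<and> w ! Suc p < w ! i}"
      by (auto simp: S_def P_def descent_blocks_def)
  qed
  also have "card (\<Union>B\<in>S. P B) = (\<Sum>B\<in>S. card (P B))"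
  proof (rule card_UN_disjoint[OF fin])
    show "\<forall>B\<in>S. finite (P B)" by (auto simp: P_def)
    show "\<forall>B\<in>S. \<forall>B'\<in>S. B \<noteq> B' \<longrightarrow> P B \<inter> P B' = {}"
      using descent_blocks_disjoint by (fastforce simp: S_def P_def)
  qed
  also have "\<dots> = card S" using single by simp
  finally show ?thesis by (simp add: right_embracing_def S_def)
qed

section \<open>The statistics as values of \<open>marked_stat\<close> at words without marks\<close>

abbreviation unmarked :: "nat list \<Rightarrow> (nat \<times> bool) list" where
  "unmarked \<equiv> map (\<lambda>a. (a, False))"

lemma crossings_unmarked:
  "crossings y p (unmarked w) = of_bool (p \<and> w \<noteq> [] \<and> hd w < y)
     + card {i. Suc i < length w \<and> y \<le> w ! i \<and> w ! Suc i < y}"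
proof (induction w arbitrary: p)
  case (Cons c w)
  have "{i. Suc i < length (c # w) \<and> y \<le> (c # w) ! i \<and> (c # w) ! Suc i < y}
      = (if w \<noteq> [] \<and> y \<le> c \<and> hd w < y then {0} else {}) \<union> Suc ` {i. Suc i < length w \<and> y \<le> w ! i \<and> w ! Suc i < y}"
    (is "_ = ?A \<union> _")
  proof (intro equalityI subsetI)
    fix i assume "i \<in> {i. Suc i < length (c # w) \<and> y \<le> (c # w) ! i \<and> (c # w) ! Suc i < y}"
    then show "i \<in> ?A \<union> Suc ` {i. Suc i < length w \<and> y \<le> w ! i \<and> w ! Suc i < y}"
      by (cases i) (auto simp: hd_conv_nth)
  qed (auto simp: hd_conv_nth split: if_splits)
  moreover have "finite {i. Suc i < length w \<and> y \<le> w ! i \<and> w ! Suc i < y}"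
    by (rule finite_subset[of _ "{..<length w}"]) auto
  ultimately have "card {i. Suc i < length (c # w) \<and> y \<le> (c # w) ! i \<and> (c # w) ! Suc i < y}
      = card ?A + card {i. Suc i < length w \<and> y \<le> w ! i \<and> w ! Suc i < y}"
    by (simp only:) (subst card_Un_disjoint; auto simp: card_image)
  then show ?case by (simp add: Cons)
qed simp

text \<open>Embracing is counted only to the right, so a letter put in front changes none of the
  other embracing numbers.\<close>

lemma Res_Cons: "Res (a # w) = crossings a False (unmarked w) + Res w"
proof -
  let ?P = "\<lambda>w i. {p. i < p \<and> Suc p < length w \<and> w ! i \<le> w ! p \<and> w ! Suc p < w ! i}"
  have R: "Res w = (\<Sum>i<length w. card (?P w i))" for w
    unfolding Res_def by (rule sum.cong) (auto simp: right_embracing_eq_card_descents)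
  have shift: "{p. i < p \<and> Suc p < length (a # w) \<and> y \<le> (a # w) ! p \<and> (a # w) ! Suc p < y}
      = Suc ` {p. i \<le> p \<and> Suc p < length w \<and> y \<le> w ! p \<and> w ! Suc p < y}" for i y
  proof (intro equalityI subsetI)
    fix p assume "p \<in> {p. i < p \<and> Suc p < length (a # w) \<and> y \<le> (a # w) ! p \<and> (a # w) ! Suc p < y}"
    then show "p \<in> Suc ` {p. i \<le> p \<and> Suc p < length w \<and> y \<le> w ! p \<and> w ! Suc p < y}"
      by (cases p) auto
  qed auto
  have "Res (a # w) = card (?P (a # w) 0) + (\<Sum>i<length w. card (?P (a # w) (Suc i)))"
    unfolding R by (simp add: sum.lessThan_Suc_shift del: sum.lessThan_Suc)
  also have "card (?P (a # w) 0) = crossings a False (unmarked w)"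
    using shift[of 0 a] by (simp add: card_image crossings_unmarked)
  also have "(\<Sum>i<length w. card (?P (a # w) (Suc i))) = Res w"
    unfolding R
  proof (rule sum.cong[OF refl])
    fix i assume "i \<in> {..<length w}"
    show "card (?P (a # w) (Suc i)) = card (?P w i)"
      using shift[of "Suc i" "w ! i"] by (simp add: card_image Suc_le_eq)
  qed
  finally show ?thesis .
qed

text \<open>Copies of the descent bottom are counted to its right because the recursion of
  \<open>marked_stat\<close> sees only the rest of the word;
  \<open>letter_value_ordered_word\<close> translates this into the value, which counts copies to
  the left.\<close>

definition descent_sum :: "(nat \<Rightarrow> nat \<Rightarrow> nat \<Rightarrow> nat) \<Rightarrow> nat list \<Rightarrow> nat" where
  "descent_sum D w = (\<Sum>i\<in>Des w. D (w ! i) (w ! Suc i) (count_list (drop (Suc (Suc i)) w) (w ! Suc i)))"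

lemma finite_Des [simp]: "finite (Des w)"
  by (rule finite_subset[of _ "{..<length w}"]) (auto simp: Des_def)

lemma descent_sum_Cons:
  "descent_sum D (a # c # w) = (if c < a then D a c (count_list w c) else 0) + descent_sum D (c # w)"
proof -
  have "Des (a # c # w) = (if c < a then {0} else {}) \<union> Suc ` Des (c # w)" (is "_ = ?A \<union> _")
  proof (intro equalityI subsetI)
    fix i assume "i \<in> Des (a # c # w)"
    then show "i \<in> ?A \<union> Suc ` Des (c # w)" by (cases i) (auto simp: Des_def)
  qed (auto simp: Des_def split: if_splits)
  then show ?thesis
    unfolding descent_sum_def by (simp only:) (subst sum.union_disjoint; auto simp: sum.reindex)
qed

lemma marked_stat_unmarked:
  "marked_stat D z p (unmarked w) = descent_sum D (p # w) + Res w"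
proof (induction w arbitrary: p)
  case Nil
  then show ?case by (simp add: descent_sum_def Des_def Res_def)
next
  case (Cons c w)
  then show ?case by (simp add: descent_sum_Cons Res_Cons comp_def)
qed

lemma descent_sum_0: "descent_sum D (0 # w) = descent_sum D w"
proof (cases w)
  case Nil
  then show ?thesis by (simp add: descent_sum_def Des_def)
qed (simp add: descent_sum_Cons)

lemma card_less_ordered_word:
  assumes "w \<in> ordered_words m k" "c \<le> Suc m"
  shows "card {j. j < length w \<and> w ! j < c} = sum k {1..<c}"
proof -
  have "card {j. j < length w \<and> w ! j < c} = length (below c w)"
    by (simp only: length_filter_conv_card)
  also have "\<dots> = size (filter_mset (\<lambda>a. a < c) (mset w))"
    by (metis mset_filter size_mset)
  also have "mset w = type_mset m k" using assms(1) by (simp add: ordered_words_def)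
  also have "size (filter_mset (\<lambda>a. a < c) (type_mset m k)) = sum k {1..<c}"
    using assms(2)
  proof (induction m)
    case (Suc m)
    show ?case
    proof (cases "c = Suc (Suc m)")
      case True
      have "filter_mset (\<lambda>a. a < c) (type_mset (Suc m) k) = type_mset (Suc m) k"
        using set_type_mset[of "Suc m" k] True by (subst filter_mset_eq_conv) auto
      then show ?thesis using True by (simp add: size_type_mset atLeastLessThanSuc_atLeastAtMost del: sum.op_ivl_Suc)
    next
      case False
      then have "filter_mset (\<lambda>a. a < c) (replicate_mset (k (Suc m)) (Suc m)) = {#}" using Suc.prems by auto
      then show ?thesis using Suc False by (simp add: type_mset_Suc)
    qed
  qed (cases c; simp)
  finally show ?thesis .
qed

lemma letter_value_ordered_word:
  assumes "w \<in> ordered_words m k" "i < length w"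
  shows "letter_value w i = sum k {1..w ! i} - count_list (drop (Suc i) w) (w ! i)"
    and "count_list (drop (Suc i) w) (w ! i) < sum k {1..w ! i}"
proof -
  let ?c = "w ! i"
  have c: "1 \<le> ?c" "?c \<le> m" using set_ordered_word[OF assms(1)] nth_mem[OF assms(2)] by auto
  have split: "w = take i w @ ?c # drop (Suc i) w" using assms(2) by (rule id_take_nth_drop)
  have "count_list w ?c = count (mset w) ?c" by (simp add: count_mset)
  then have "count_list w ?c = k ?c" using assms(1) c by (simp add: ordered_words_def count_type_mset)
  moreover have "count_list w ?c = count_list (take i w) ?c + Suc (count_list (drop (Suc i) w) ?c)"
    by (subst (1) split) simp
  moreover have "card {j. j < i \<and> w ! j = ?c} = count_list (take i w) ?c"
  proof -
    have "count_list l ?c = length (filter (\<lambda>a. a = ?c) l)" for l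
      by (induction l) auto
    then have "count_list (take i w) ?c = length (filter (\<lambda>a. a = ?c) (take i w))" .
    also have "\<dots> = card {j. j < i \<and> w ! j = ?c}"
      unfolding length_filter_conv_card by (rule arg_cong[where f = card]) (use assms(2) in auto)
    finally show ?thesis by simp
  qed
  moreover have "sum k {1..?c} = sum k {1..<?c} + k ?c"
    using c by (simp flip: atLeastLessThanSuc_atLeastAtMost)
  moreover have "height w ?c = Suc (sum k {1..<?c})"
    using card_less_ordered_word[OF assms(1), of ?c] c by (simp add: height_def)
  ultimately show "letter_value w i = sum k {1..?c} - count_list (drop (Suc i) w) ?c"
    "count_list (drop (Suc i) w) ?c < sum k {1..?c}"
    by (simp_all add: letter_value_def)
qed

text \<open>The value of a descent bottom \<open>c\<close> with \<open>n\<close> further copies to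
  its right. In \<open>MAD_weight\<close> it is subtracted from the height of the descent top
  \<open>b\<close>; for the virtual letter this height is one more than the number of ordinary
  letters.\<close>

definition MAK_weight :: "(nat \<Rightarrow> nat) \<Rightarrow> nat \<Rightarrow> nat \<Rightarrow> nat \<Rightarrow> nat" where
  "MAK_weight k b c n = sum k {1..c} - n"

definition MAD_weight :: "(nat \<Rightarrow> nat) \<Rightarrow> nat \<Rightarrow> nat \<Rightarrow> nat \<Rightarrow> nat" where
  "MAD_weight k b c n = Suc (sum k {1..<b}) - (sum k {1..c} - n)"

lemma MAK_eq_marked_stat:
  assumes "w \<in> ordered_words m k"
  shows "MAK w = marked_stat (MAK_weight k) z 0 (unmarked w)"
proof -
  have "Dbot w = descent_sum (MAK_weight k) w"
    unfolding Dbot_def descent_sum_def MAK_weight_def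
    by (rule sum.cong) (auto simp: Des_def letter_value_ordered_word(1)[OF assms])
  then show ?thesis by (simp add: MAK_def marked_stat_unmarked descent_sum_0)
qed

lemma MAD_eq_marked_stat:
  assumes w: "w \<in> ordered_words m k"
  shows "MAD w = marked_stat (MAD_weight k) z 0 (unmarked w)"
proof -
  have le: "letter_value w (Suc i) \<le> height w (w ! i)" if "i \<in> Des w" for i
  proof -
    let ?c = "w ! Suc i" and ?b = "w ! i"
    have i: "Suc i < length w" "?c < ?b" using that by (auto simp: Des_def)
    then have "?b \<le> m" using set_ordered_word[OF w] nth_mem[OF Suc_lessD[OF i(1)]] by (meson atLeastAtMost_iff subsetD)
    then have "height w ?b = Suc (sum k {1..<?b})"
      using card_less_ordered_word[OF w, of ?b] by (simp add: height_def)
    moreover have "sum k {1..?c} \<le> sum k {1..<?b}" using i by (intro sum_mono2) auto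
    ultimately show ?thesis using letter_value_ordered_word(1)[OF w i(1)] by simp
  qed
  have h: "height w (w ! i) = Suc (sum k {1..<w ! i})" if "i < length w" for i
    using card_less_ordered_word[OF w, of "w ! i"] set_ordered_word[OF w] nth_mem[OF that]
    by (force simp: height_def)
  have "Ddif w = (\<Sum>i\<in>Des w. height w (w ! i) - letter_value w (Suc i))"
    unfolding Ddif_def Dtop_def Dbot_def by (rule sum_subtractf_nat[symmetric]) (use le in auto)
  also have "\<dots> = descent_sum (MAD_weight k) w"
    unfolding descent_sum_def MAD_weight_def
    by (rule sum.cong) (auto simp: Des_def letter_value_ordered_word(1)[OF w] h)
  finally show ?thesis by (simp add: MAD_def marked_stat_unmarked descent_sum_0)
qed

lemma marked_words_0 [simp]: "marked_words 0 k = {[]}"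
  by (auto simp: marked_words_def)

lemma sum_marked_words:
  fixes q :: "'a::comm_semiring_1"
  assumes k: "\<And>i. i \<in> {1..m} \<Longrightarrow> k i \<ge> 1"
    and D: "\<And>x c n. x \<in> {1..m} \<Longrightarrow> c < x \<Longrightarrow> D (Suc x) c n = D x c n + d x"
    and ms: "\<And>x. x \<in> {1..m} \<Longrightarrow> mset (map (\<lambda>l. l + d x) [1..<Suc (sum k {1..<x})] @ map (D (Suc x) x) (rev [0..<k x]))
      = mset [1..<Suc (sum k {1..x})]"
  shows "(\<Sum>v\<in>marked_words m k. f (marks v) * q ^ marked_stat D (Suc m) 0 v)
    = word_poly q m k * esum q [1..<Suc (sum k {1..m})] f"
  using assms
proof (induction m arbitrary: f)
  case (Suc m)
  show ?case
  proof (rule sum_marked_words_Suc)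
    show "mset (map (\<lambda>l. l + d (Suc m)) [1..<Suc (sum k {1..m})] @ map (D (Suc (Suc m)) (Suc m)) (rev [0..<k (Suc m)]))
      = mset [1..<Suc (sum k {1..Suc m})]"
      using Suc.prems(3)[of "Suc m"] by (simp only: atLeastLessThanSuc_atLeastAtMost) simp
  qed (use Suc in auto)
qed simp

lemma sum_marked_words_unmarked:
  fixes q :: "'a::comm_semiring_1"
  shows "(\<Sum>v\<in>marked_words m k. (if marks v = 0 then 1 else 0) * q ^ g v) = (\<Sum>w\<in>ordered_words m k. q ^ g (unmarked w))"
proof -
  have "{v \<in> marked_words m k. marks v = 0} = unmarked ` ordered_words m k"
  proof (intro equalityI subsetI)
    fix v assume v: "v \<in> {v \<in> marked_words m k. marks v = 0}"
    then have "v = unmarked (map fst v)"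
      by (auto simp: filter_empty_conv intro!: map_idI[symmetric])
    then show "v \<in> unmarked ` ordered_words m k" using v unfolding marked_words_def by blast
  next
    fix v assume "v \<in> unmarked ` ordered_words m k"
    then show "v \<in> {v \<in> marked_words m k. marks v = 0}"
      by (auto simp: marked_words_def comp_def filter_empty_conv)
  qed
  moreover have "inj_on unmarked (ordered_words m k)"
    by (rule inj_on_inverseI[where g = "map fst"]) (simp add: comp_def)
  ultimately have "(\<Sum>w\<in>ordered_words m k. q ^ g (unmarked w)) = (\<Sum>v\<in>{v \<in> marked_words m k. marks v = 0}. q ^ g v)"
    by (simp add: sum.reindex)
  also have "\<dots> = (\<Sum>v\<in>marked_words m k. if marks v = 0 then q ^ g v else 0)"
    by (rule sum.inter_filter) simp
  finally show ?thesis by (simp add: if_distrib if_distribR cong: if_cong)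
qed

theorem sum_MAK:
  fixes q :: "'a::comm_semiring_1"
  assumes "\<And>i. i \<in> {1..m} \<Longrightarrow> k i \<ge> 1"
  shows "(\<Sum>w\<in>ordered_words m k. q ^ MAK w) = word_poly q m k"
proof -
  have "(\<Sum>w\<in>ordered_words m k. q ^ MAK w) = (\<Sum>w\<in>ordered_words m k. q ^ marked_stat (MAK_weight k) (Suc m) 0 (unmarked w))"
    by (rule sum.cong) (auto simp: MAK_eq_marked_stat[of _ m k "Suc m"])
  also have "\<dots> = word_poly q m k * esum q [1..<Suc (sum k {1..m})] (\<lambda>t. if t = 0 then 1 else 0)"
    unfolding sum_marked_words_unmarked[symmetric]
  proof (rule sum_marked_words[where d = "\<lambda>x. 0" and f = "\<lambda>t. if t = 0 then 1 else 0"])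
    fix x assume x: "x \<in> {1..m}"
    define N where "N = sum k {1..<x}"
    have sum: "sum k {1..x} = N + k x"
      using x by (simp add: N_def flip: atLeastLessThanSuc_atLeastAtMost)
    \<comment> \<open>The weight does not depend on the descent top, hence \<open>d = 0\<close> and
      the old exponents stay. The marks on the copies of \<open>x\<close> weigh the values of these
      copies, which are \<open>N + 1\<close> to \<open>N + k x\<close>.\<close>
    have w: "map (MAK_weight k (Suc x) x) (rev [0..<k x]) = [Suc N..<Suc (N + k x)]"
      by (rule nth_equalityI) (auto simp: MAK_weight_def sum[simplified] rev_nth simp del: upt_Suc)
    have e: "[1..<Suc (sum k {1..x})] = [1..<Suc N] @ [Suc N..<Suc (N + k x)]"
      unfolding sum using upt_add_eq_append[of 1 "Suc N" "k x"] by (simp del: upt_Suc)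
    show "mset (map (\<lambda>l. l + 0) [1..<Suc (sum k {1..<x})] @ map (MAK_weight k (Suc x) x) (rev [0..<k x]))
      = mset [1..<Suc (sum k {1..x})]"
      unfolding w e N_def[symmetric] by (simp del: upt_Suc)
  qed (use assms in \<open>auto simp: MAK_weight_def\<close>)
  finally show ?thesis by (simp only: esum_delta mult_1_right)
qed

theorem sum_MAD:
  fixes q :: "'a::comm_semiring_1"
  assumes "\<And>i. i \<in> {1..m} \<Longrightarrow> k i \<ge> 1"
  shows "(\<Sum>w\<in>ordered_words m k. q ^ MAD w) = word_poly q m k"
proof -
  have "(\<Sum>w\<in>ordered_words m k. q ^ MAD w) = (\<Sum>w\<in>ordered_words m k. q ^ marked_stat (MAD_weight k) (Suc m) 0 (unmarked w))"
    by (rule sum.cong) (auto simp: MAD_eq_marked_stat[of _ m k "Suc m"])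
  also have "\<dots> = word_poly q m k * esum q [1..<Suc (sum k {1..m})] (\<lambda>t. if t = 0 then 1 else 0)"
    unfolding sum_marked_words_unmarked[symmetric]
  proof (rule sum_marked_words[where d = k and f = "\<lambda>t. if t = 0 then 1 else 0"])
    fix x assume x: "x \<in> {1..m}"
    define N where "N = sum k {1..<x}"
    have sum: "sum k {1..x} = N + k x" and N: "sum k {1..<x} = N"
      using x by (simp_all add: N_def flip: atLeastLessThanSuc_atLeastAtMost)
    \<comment> \<open>The height of the virtual letter grows by \<open>k x\<close>, which shifts the
      old exponents and leaves the gap from 1 to \<open>k x\<close>. It is filled by the copies of
      \<open>x\<close>: a mark on the one followed by \<open>n\<close> others weighs
      \<open>Suc n\<close>.\<close>
    have w: "map (MAD_weight k (Suc x) x) (rev [0..<k x]) = rev [1..<Suc (k x)]"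
      by (rule nth_equalityI) (use x in \<open>auto simp: MAD_weight_def sum[simplified] N[simplified] rev_nth simp del: upt_Suc\<close>)
    have w': "map (\<lambda>l. l + k x) [1..<Suc N] = [Suc (k x)..<Suc (k x + N)]"
      by (rule nth_equalityI) (auto simp del: upt_Suc)
    have e: "[1..<Suc (sum k {1..x})] = [1..<Suc (k x)] @ [Suc (k x)..<Suc (k x + N)]"
      unfolding sum using upt_add_eq_append[of 1 "Suc (k x)" N] by (simp add: add.commute del: upt_Suc)
    show "mset (map (\<lambda>l. l + k x) [1..<Suc (sum k {1..<x})] @ map (MAD_weight k (Suc x) x) (rev [0..<k x]))
      = mset [1..<Suc (sum k {1..x})]"
      unfolding w w' e N by (simp only: mset_append mset_rev add.commute)
  next
    fix x c n assume x: "x \<in> {1..m}" "c < x"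
    have "sum k {1..<Suc x} = sum k {1..<x} + k x" using x by simp
    moreover have "sum k {1..c} \<le> sum k {1..<x}" using x by (intro sum_mono2) auto
    ultimately show "MAD_weight k (Suc x) c n = MAD_weight k x c n + k x"
      by (simp add: MAD_weight_def)
  qed (use assms in auto)
  finally show ?thesis by (simp only: esum_delta mult_1_right)
qed

section \<open>Denert's statistic\<close>

text \<open>A pair holds the letter of the nondecreasing rearrangement and the letter of the word at
  the same place. In this form the word can be cut and its letters altered without renumbering
  places.\<close>

fun excs :: "(nat \<times> nat) list \<Rightarrow> nat list" where
  "excs [] = []"
| "excs ((a, b) # ps) = (if a < b then b # excs ps else excs ps)"

fun nexcs :: "(nat \<times> nat) list \<Rightarrow> nat list" where
  "nexcs [] = []"
| "nexcs ((a, b) # ps) = (if a < b then nexcs ps else b # nexcs ps)"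

fun exc_sum :: "nat \<Rightarrow> (nat \<times> nat) list \<Rightarrow> nat" where
  "exc_sum n [] = 0"
| "exc_sum n ((a, b) # ps) = (if a < b then Suc n else 0) + exc_sum (Suc n) ps"

lemma excs_append: "excs (ps @ qs) = excs ps @ excs qs"
  by (induction ps rule: excs.induct) auto

lemma nexcs_append: "nexcs (ps @ qs) = nexcs ps @ nexcs qs"
  by (induction ps rule: nexcs.induct) auto

lemma exc_sum_append: "exc_sum n (ps @ qs) = exc_sum n ps + exc_sum (n + length ps) qs"
  by (induction n ps rule: exc_sum.induct) auto

abbreviation imv_below :: "nat \<Rightarrow> nat list \<Rightarrow> nat" where
  "imv_below z \<equiv> pairs (\<lambda>a b. b \<le> a \<and> b < z)"

abbreviation max_imv :: "nat \<Rightarrow> nat list \<Rightarrow> nat" where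
  "max_imv x \<equiv> pairs (\<lambda>a b. x \<le> a \<and> b = x)"

abbreviation max_inv :: "nat \<Rightarrow> nat list \<Rightarrow> nat" where
  "max_inv x \<equiv> pairs (\<lambda>a b. a = x \<and> b < x)"

text \<open>Letters not below \<open>z\<close> are virtual: pairs of them do not count.\<close>

definition den :: "nat \<Rightarrow> (nat \<times> nat) list \<Rightarrow> nat" where
  "den z ps = exc_sum 0 ps + imv_below z (excs ps) + pairs (>) (nexcs ps)"

lemma nths_excs:
  assumes "length a = length w" "\<And>i. i < length w \<Longrightarrow> i \<in> B \<longleftrightarrow> a ! i < w ! i"
  shows "nths w B = excs (zip a w) \<and> nths w (- B) = nexcs (zip a w)"
  using assms
proof (induction a w arbitrary: B rule: list_induct2)
  case (Cons x a y w)
  have "i \<in> {j. Suc j \<in> B} \<longleftrightarrow> a ! i < w ! i" if "i < length w" for i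
    using Cons.prems[of "Suc i"] that by simp
  from Cons.IH[OF this]
  have "nths w {j. Suc j \<in> B} = excs (zip a w)" "nths w {j. Suc j \<notin> B} = nexcs (zip a w)"
    by (simp_all add: Collect_neg_eq)
  then show ?case using Cons.prems[of 0] by (simp add: nths_Cons)
qed simp

lemma sum_exc_places:
  assumes "length a = length w"
  shows "(\<Sum>i\<in>{i. i < length w \<and> a ! i < w ! i}. Suc (n + i)) = exc_sum n (zip a w)"
  using assms
proof (induction a w arbitrary: n rule: list_induct2)
  case (Cons x a y w)
  have "{i. i < length (y # w) \<and> (x # a) ! i < (y # w) ! i}
      = (if x < y then {0} else {}) \<union> Suc ` {i. i < length w \<and> a ! i < w ! i}" (is "_ = ?A \<union> _")
  proof (intro equalityI subsetI)
    fix i assume "i \<in> {i. i < length (y # w) \<and> (x # a) ! i < (y # w) ! i}"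
    then show "i \<in> ?A \<union> Suc ` {i. i < length w \<and> a ! i < w ! i}" by (cases i) auto
  qed (auto split: if_splits)
  then have "(\<Sum>i\<in>{i. i < length (y # w) \<and> (x # a) ! i < (y # w) ! i}. Suc (n + i))
      = (\<Sum>i\<in>?A. Suc (n + i)) + (\<Sum>i\<in>{i. i < length w \<and> a ! i < w ! i}. Suc (Suc n + i))"
    by (simp only:) (subst sum.union_disjoint; auto simp: sum.reindex)
  then show ?case using Cons.IH[of "Suc n"] by simp
qed simp

lemma excs_subset: "set (excs ps) \<subseteq> snd ` set ps"
  by (induction ps rule: excs.induct) auto

lemma pairs_cong:
  "(\<And>a b. a \<in> set w \<Longrightarrow> b \<in> set w \<Longrightarrow> R a b \<longleftrightarrow> R' a b) \<Longrightarrow> pairs R w = pairs R' w"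
proof (induction w)
  case (Cons a w)
  have "filter (R a) w = filter (R' a) w" by (rule filter_cong) (use Cons.prems in auto)
  then show ?case using Cons by simp
qed simp

lemma pairs_filter:
  assumes "\<And>a b. R a b \<Longrightarrow> Q a \<and> Q b"
  shows "pairs R (filter Q w) = pairs R w"
proof (induction w)
  case (Cons a w)
  have "filter (R a) (filter Q w) = filter (R a) w"
    unfolding filter_filter by (rule filter_cong) (use assms in auto)
  moreover have "filter (R a) w = []" if "\<not> Q a" using assms that by (auto simp: filter_empty_conv)
  ultimately show ?case using Cons by auto
qed simp

lemma DEN_eq_den:
  assumes "\<And>a. a \<in> set w \<Longrightarrow> a < z"
  shows "DEN w = den z (zip (sort w) w)"
proof -
  have "nths w (exc_places w) = excs (zip (sort w) w) \<and> nths w (- exc_places w) = nexcs (zip (sort w) w)"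
    by (rule nths_excs) (auto simp: exc_places_def)
  moreover have "(\<Sum>i\<in>exc_places w. Suc i) = exc_sum 0 (zip (sort w) w)"
    using sum_exc_places[of "sort w" w 0] by (simp add: exc_places_def)
  moreover have "pairs (\<ge>) (excs (zip (sort w) w)) = imv_below z (excs (zip (sort w) w))"
  proof (rule pairs_cong)
    fix a b assume "b \<in> set (excs (zip (sort w) w))"
    then have "b \<in> set w" using excs_subset[of "zip (sort w) w"] by (force dest: set_zip_rightD)
    then show "b \<le> a \<longleftrightarrow> b \<le> a \<and> b < z" using assms by auto
  qed
  ultimately show ?thesis
    by (simp add: DEN_def den_def Exc_def Nexc_def imv_eq_pairs INV_eq_pairs)
qed

section \<open>Words with virtual letters at excedance places\<close>

fun sorted_word :: "nat \<Rightarrow> (nat \<Rightarrow> nat) \<Rightarrow> nat list" where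
  "sorted_word 0 k = []"
| "sorted_word (Suc m) k = sorted_word m k @ replicate (k (Suc m)) (Suc m)"

lemma length_sorted_word: "length (sorted_word m k) = sum k {1..m}"
  by (induction m) auto

lemma set_sorted_word: "set (sorted_word m k) \<subseteq> {1..m}"
  by (induction m) (force split: if_splits)+

lemma sort_ordered_word: "w \<in> ordered_words m k \<Longrightarrow> sort w = sorted_word m k"
proof (rule properties_for_sort)
  show "mset (sorted_word m k) = mset w" if "w \<in> ordered_words m k"
  proof -
    have "mset (sorted_word m k) = type_mset m k" by (induction m) (auto simp: type_mset_Suc)
    then show ?thesis using that by (simp add: ordered_words_def)
  qed
  show "sorted (sorted_word m k)"
  proof (induction m)
    case (Suc m)
    have "a \<le> m" if "a \<in> set (sorted_word m k)" for a
      using set_sorted_word[of m k] that by auto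
    then show ?case using Suc by (auto simp: sorted_append le_SucI)
  qed simp
qed

text \<open>
  \<open>Suc m\<close> is a virtual letter larger than all others. Only excedance places may hold it, and the
  places behind the first \<open>sum k {1..m}\<close> are those of larger letters, to be held by smaller ones.
\<close>

definition den_words :: "nat \<Rightarrow> (nat \<Rightarrow> nat) \<Rightarrow> nat list set" where
  "den_words m k = {v. set v \<subseteq> {..Suc m} \<and> below (Suc m) v \<in> ordered_words m k
     \<and> Suc m \<notin> set (drop (sum k {1..m}) v)}"

text \<open>Behind the sorted word the letters are compared with \<open>Suc m\<close>, which none of
  them exceeds, so no excedance lies there. The padding by \<open>length v\<close> letters is long
  enough, and \<open>zip\<close> cuts off the surplus.\<close>

definition den_stat :: "nat \<Rightarrow> (nat \<Rightarrow> nat) \<Rightarrow> nat list \<Rightarrow> nat" where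
  "den_stat m k v = den (Suc m) (zip (sorted_word m k @ replicate (length v) (Suc m)) v)"

lemma length_eq_filter_count:
  "set v \<subseteq> {..Suc m} \<Longrightarrow> length v = length (below (Suc m) v) + count_list v (Suc m)"
  by (induction v) auto

lemma count_list_take: "a \<notin> set (drop n v) \<Longrightarrow> count_list v a \<le> n"
proof -
  assume "a \<notin> set (drop n v)"
  then have "count_list (drop n v) a = 0" by (simp add: count_list_0_iff)
  moreover have "count_list v a = count_list (take n v) a + count_list (drop n v) a"
    by (metis append_take_drop_id count_list_append)
  ultimately show ?thesis using count_le_length[of "take n v" a] by simp
qed

lemma finite_den_words [simp]: "finite (den_words m k)"
proof (rule finite_subset)
  show "den_words m k \<subseteq> {v. set v \<subseteq> {..Suc m} \<and> length v \<le> sum k {1..m} + sum k {1..m}}"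
  proof
    fix v assume v: "v \<in> den_words m k"
    have "length (below (Suc m) v) = sum k {1..m}"
      using v length_ordered_word unfolding den_words_def by blast
    moreover have "count_list v (Suc m) \<le> sum k {1..m}"
      using v by (auto simp: den_words_def intro: count_list_take)
    ultimately show "v \<in> {v. set v \<subseteq> {..Suc m} \<and> length v \<le> sum k {1..m} + sum k {1..m}}"
      using v length_eq_filter_count[of v m] by (auto simp: den_words_def)
  qed
qed (rule finite_lists_length_le; simp)

text \<open>\<open>qsub q t c = q ^ (c choose 2) * [t choose c]\<close>\<close>

fun qsub :: "'a::comm_semiring_1 \<Rightarrow> nat \<Rightarrow> nat \<Rightarrow> 'a" where
  "qsub q t 0 = 1"
| "qsub q 0 (Suc c) = 0"
| "qsub q (Suc t) (Suc c) = q ^ Suc c * qsub q t (Suc c) + q ^ c * qsub q t c"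

lemma qsub_eq_0: "t < c \<Longrightarrow> qsub q t c = 0"
proof (induction t arbitrary: c)
  case 0
  then show ?case by (cases c) auto
next
  case (Suc t)
  then show ?case by (cases c) auto
qed

text \<open>In this second Pascal rule the power of \<open>q\<close> depends on \<open>t\<close>, as
  it does in the recursion of \<open>msum\<close>.\<close>

lemma qsub_Suc_Suc': "qsub q (Suc t) (Suc c) = qsub q t (Suc c) + q ^ t * qsub q t c"
proof (induction t arbitrary: c)
  case 0
  then show ?case by (cases c) auto
next
  case (Suc t)
  have "qsub q (Suc (Suc t)) (Suc c) = q ^ Suc c * (qsub q t (Suc c) + q ^ t * qsub q t c) + q ^ c * qsub q (Suc t) c"
    by (simp only: qsub.simps(3)[of q "Suc t"] Suc)
  also have "q ^ c * qsub q (Suc t) c = q ^ c * qsub q t c + (if c = 0 then 0 else q ^ c * q ^ t * qsub q t (c - 1))"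
    using Suc[of "c - 1"] by (cases c) (simp_all add: algebra_simps del: qsub.simps(3))
  also have "q ^ Suc c * (qsub q t (Suc c) + q ^ t * qsub q t c) + \<dots>
      = (q ^ Suc c * qsub q t (Suc c) + q ^ c * qsub q t c)
        + q ^ Suc t * (q ^ c * qsub q t c + (if c = 0 then 0 else q ^ (c - 1) * qsub q t (c - 1)))"
    by (cases c) (simp_all add: algebra_simps)
  also have "q ^ c * qsub q t c + (if c = 0 then 0 else q ^ (c - 1) * qsub q t (c - 1)) = qsub q (Suc t) c"
    by (cases c) simp_all
  finally show ?case by simp
qed

text \<open>For \<open>DEN\<close>, \<open>c\<close> copies of the new letter replace virtual
  letters, and the other \<open>j - c\<close>, besides the final one, are shuffled into the later
  places. The closed form identifies the sum over \<open>c\<close> with the operator already known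
  from \<open>MAK\<close> and \<open>MAD\<close>.\<close>

lemma msum_eq_sum:
  "msum q t (Suc j) f = (\<Sum>c\<le>j. qsub q t c * gbinom q t (j - c) * f (t - c))"
proof (induction "t + j" arbitrary: t j f rule: less_induct)
  case less
  note IH = less.hyps
  show ?case
  proof (cases t)
    case 0
    have "(\<Sum>c\<le>j. qsub q 0 c * gbinom q 0 (j - c) * f (0 - c)) = (\<Sum>c\<in>{0}. qsub q 0 c * gbinom q 0 (j - c) * f (0 - c))"
      by (rule sum.mono_neutral_right) (auto simp: qsub_eq_0)
    then show ?thesis by (simp add: 0)
  next
    case (Suc t')
    let ?g = "\<lambda>c. gbinom q t' (j - c) * f (t - c)"
    have 1: "msum q t' (Suc j) (\<lambda>s. f (Suc s)) = (\<Sum>c\<le>j. qsub q t' c * ?g c)"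
    proof -
      have "qsub q t' c * gbinom q t' (j - c) * f (Suc (t' - c)) = qsub q t' c * ?g c" for c
        by (cases "c \<le> t'") (auto simp: Suc qsub_eq_0 Suc_diff_le mult.assoc)
      then show ?thesis using IH[of t' j "\<lambda>s. f (Suc s)"] by (simp add: Suc)
    qed
    show ?thesis
    proof (cases j)
      case 0
      then show ?thesis using 1 by (simp add: Suc)
    next
      case (Suc i)
      let ?h = "\<lambda>c. q ^ t * (qsub q t c * gbinom q t (i - c) * f (t - c))"
      have "msum q t (Suc j) f = (\<Sum>c\<le>j. qsub q t' c * ?g c)
        + (q ^ t * (\<Sum>c\<le>i. qsub q t c * gbinom q t (i - c) * f (t - c))
          + q ^ t' * (\<Sum>c\<le>i. qsub q t' c * gbinom q t' (i - c) * f (t' - c)))"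
        using IH[of t i f] IH[of t' i f] 1 by (simp add: Suc \<open>t = Suc t'\<close>)
      also have "q ^ t' * (\<Sum>c\<le>i. qsub q t' c * gbinom q t' (i - c) * f (t' - c)) = (\<Sum>c\<le>i. q ^ t' * qsub q t' c * ?g (Suc c))"
        by (simp add: Suc \<open>t = Suc t'\<close> sum_distrib_left mult.assoc)
      also have "(\<Sum>c\<le>j. qsub q t' c * ?g c) = qsub q t' 0 * ?g 0 + (\<Sum>c\<le>i. qsub q t' (Suc c) * ?g (Suc c))"
        unfolding Suc by (rule sum.atMost_Suc_shift)
      also have "qsub q t' 0 * ?g 0 + (\<Sum>c\<le>i. qsub q t' (Suc c) * ?g (Suc c))
        + (q ^ t * (\<Sum>c\<le>i. qsub q t c * gbinom q t (i - c) * f (t - c)) + (\<Sum>c\<le>i. q ^ t' * qsub q t' c * ?g (Suc c)))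
        = qsub q t 0 * ?g 0 + (\<Sum>c\<le>i. qsub q t (Suc c) * ?g (Suc c))
        + (\<Sum>c\<le>i. ?h c)"
        unfolding \<open>t = Suc t'\<close> qsub_Suc_Suc' distrib_right sum.distrib sum_distrib_left qsub.simps(1)
        by (simp only: ac_simps)
      also have "qsub q t 0 * ?g 0 + (\<Sum>c\<le>i. qsub q t (Suc c) * ?g (Suc c)) = (\<Sum>c\<le>j. qsub q t c * ?g c)"
        unfolding Suc by (rule sum.atMost_Suc_shift[symmetric])
      also have "(\<Sum>c\<le>j. qsub q t c * ?g c) = (\<Sum>c\<le>i. qsub q t c * ?g c) + qsub q t j * f (t - j)"
        unfolding Suc by simp
      also have "(\<Sum>c\<le>i. qsub q t c * ?g c) + qsub q t j * f (t - j) + (\<Sum>c\<le>i. ?h c)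
        = (\<Sum>c\<le>i. qsub q t c * ?g c + ?h c) + qsub q t j * f (t - j)"
        unfolding sum.distrib by (simp only: ac_simps)
      also have "(\<Sum>c\<le>i. qsub q t c * ?g c + ?h c)
        = (\<Sum>c\<le>i. qsub q t c * gbinom q t (j - c) * f (t - c))"
      proof (rule sum.cong[OF refl])
        fix c assume "c \<in> {..i}"
        then have "j - c = Suc (i - c)" by (simp add: Suc Suc_diff_le)
        then have g: "gbinom q t (j - c) = gbinom q t' (j - c) + q ^ t * gbinom q t (i - c)"
          by (simp add: \<open>t = Suc t'\<close>)
        show "qsub q t c * ?g c + ?h c = qsub q t c * gbinom q t (j - c) * f (t - c)"
          unfolding g by (simp only: algebra_simps)
      qed
      also have "\<dots> + qsub q t j * f (t - j) = (\<Sum>c\<le>j. qsub q t c * gbinom q t (j - c) * f (t - c))"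
        unfolding Suc by simp
      finally show ?thesis .
    qed
  qed
qed

section \<open>The places of the smaller letters: virtual letters become copies of the next
  letter\<close>

definition den_prefixes :: "nat \<Rightarrow> nat list \<Rightarrow> nat \<Rightarrow> nat list set" where
  "den_prefixes x p' c = {p. map (min x) p = p' \<and> set p \<subseteq> {..Suc x} \<and> count_list p x = c}"

lemma finite_den_prefixes: "finite (den_prefixes x p' c)"
  by (rule finite_subset[OF _ finite_lists_length_eq[of "{..Suc x}" "length p'"]]) (auto simp: den_prefixes_def)

lemma den_prefixes_Cons_less:
  "a < x \<Longrightarrow> den_prefixes x (a # p') c = (#) a ` den_prefixes x p' c"
proof (intro equalityI subsetI)
  fix p assume a: "a < x" and p: "p \<in> den_prefixes x (a # p') c"
  then obtain b p2 where "p = b # p2" by (auto simp: den_prefixes_def)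
  moreover have "b = a" using a p calculation by (auto simp: den_prefixes_def min_def split: if_splits)
  ultimately show "p \<in> (#) a ` den_prefixes x p' c"
    using a p by (auto simp: den_prefixes_def)
qed (auto simp: den_prefixes_def)

lemma den_prefixes_Cons_eq:
  "den_prefixes x (x # p') c = (#) (Suc x) ` den_prefixes x p' c
     \<union> (if c = 0 then {} else (#) x ` den_prefixes x p' (c - 1))"
proof (intro equalityI subsetI)
  fix p assume p: "p \<in> den_prefixes x (x # p') c"
  then obtain a p2 where "p = a # p2" by (auto simp: den_prefixes_def)
  moreover have "a = x \<or> a = Suc x" using p calculation by (auto simp: den_prefixes_def min_def split: if_splits)
  ultimately show "p \<in> (#) (Suc x) ` den_prefixes x p' c \<union> (if c = 0 then {} else (#) x ` den_prefixes x p' (c - 1))"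
    using p by (auto simp: den_prefixes_def)
qed (auto simp: den_prefixes_def split: if_splits)

lemma count_list_den_prefix:
  assumes "p \<in> den_prefixes x p' c"
  shows "count_list p (Suc x) = count_list p' x - c" "c \<le> count_list p' x"
proof -
  have "count_list (map (min x) p) x = count_list p x + count_list p (Suc x)" if "set p \<subseteq> {..Suc x}" for p
    using that by (induction p) (auto simp: min_def)
  then have "count_list p' x = c + count_list p (Suc x)" using assms by (auto simp: den_prefixes_def)
  then show "count_list p (Suc x) = count_list p' x - c" "c \<le> count_list p' x" by auto
qed

text \<open>A virtual letter of \<open>p'\<close>, whether it becomes \<open>x\<close> or the new
  virtual letter \<open>Suc x\<close>, forms a counted pair with every \<open>x\<close> to its
  right. This gives the powers \<open>q ^ Suc c\<close> and \<open>q ^ c\<close> in the recursion of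
  \<open>qsub\<close>.\<close>

lemma sum_den_prefixes:
  fixes q :: "'a::comm_semiring_1"
  assumes "set p' \<subseteq> {..x}"
  shows "(\<Sum>p\<in>den_prefixes x p' c. q ^ max_imv x p) = qsub q (count_list p' x) c"
  using assms
proof (induction p' arbitrary: c)
  case Nil
  show ?case
  proof (cases c)
    case 0
    then have "den_prefixes x [] c = {[]}" by (auto simp: den_prefixes_def)
    then show ?thesis by (simp add: 0)
  next
    case (Suc c')
    then have "den_prefixes x [] c = {}" by (auto simp: den_prefixes_def)
    then show ?thesis by (simp add: Suc)
  qed
next
  case (Cons a p')
  let ?R = "\<lambda>a b. x \<le> a \<and> b = x"
  have count: "length (filter (\<lambda>b. b = x) p) = c" if "p \<in> den_prefixes x p' c" for p c
  proof -
    have "length (filter (\<lambda>b. b = x) p) = count_list p x" by (induction p) auto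
    then show ?thesis using that by (simp add: den_prefixes_def)
  qed
  show ?case
  proof (cases "a < x")
    case True
    then show ?thesis using Cons by (simp add: den_prefixes_Cons_less sum.reindex)
  next
    case False
    then have a: "a = x" using Cons.prems by auto
    have 1: "(\<Sum>p\<in>(#) y ` den_prefixes x p' i. q ^ pairs ?R p) = q ^ i * qsub q (count_list p' x) i" if "x \<le> y" for i y
    proof -
      have "(\<Sum>p\<in>(#) y ` den_prefixes x p' i. q ^ pairs ?R p) = (\<Sum>p\<in>den_prefixes x p' i. q ^ i * q ^ pairs ?R p)"
        by (subst sum.reindex) (use that in \<open>auto simp: count power_add intro!: sum.cong\<close>)
      then show ?thesis using Cons by (simp flip: sum_distrib_left)
    qed
    show ?thesis
    proof (cases c)
      case 0
      then show ?thesis using 1 by (simp add: a den_prefixes_Cons_eq)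
    next
      case (Suc i)
      have "(\<Sum>p\<in>den_prefixes x (x # p') c. q ^ pairs ?R p)
        = (\<Sum>p\<in>(#) (Suc x) ` den_prefixes x p' c. q ^ pairs ?R p) + (\<Sum>p\<in>(#) x ` den_prefixes x p' i. q ^ pairs ?R p)"
        unfolding den_prefixes_Cons_eq
        by (subst sum.union_disjoint[symmetric]) (auto simp: Suc finite_den_prefixes)
      then show ?thesis by (simp add: 1 a Suc)
    qed
  qed
qed

section \<open>The places of the next letter and those behind them\<close>

fun top_sum :: "nat \<Rightarrow> nat \<Rightarrow> nat \<Rightarrow> nat list \<Rightarrow> nat" where
  "top_sum z n j [] = 0"
| "top_sum z n j (a # r) = (if j = 0 then 0 else of_bool (a = z) * Suc n + top_sum z (Suc n) (j - 1) r)"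

lemma top_sum_0 [simp]: "top_sum z n 0 r = 0"
  by (cases r) auto

definition last_below :: "nat \<Rightarrow> nat list \<Rightarrow> bool" where
  "last_below x r \<longleftrightarrow> below (Suc x) r \<noteq> [] \<and> last (below (Suc x) r) = x"

definition den_suffixes :: "nat \<Rightarrow> nat list \<Rightarrow> nat \<Rightarrow> nat \<Rightarrow> nat list set" where
  "den_suffixes x r' l j = {r. below x r = r' \<and> set r \<subseteq> {..Suc x} \<and> count_list r x = l
     \<and> Suc x \<notin> set (drop j r) \<and> last_below x r}"

lemma finite_den_suffixes: "finite (den_suffixes x r' l j)"
proof (rule finite_subset)
  show "den_suffixes x r' l j \<subseteq> {r. set r \<subseteq> {..Suc x} \<and> length r \<le> length r' + l + j}"
  proof
    fix r assume r: "r \<in> den_suffixes x r' l j"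
    have "length r = length (below x r) + count_list r x + count_list r (Suc x)" if "set r \<subseteq> {..Suc x}" for r
      using that by (induction r) auto
    then have "length r = length r' + l + count_list r (Suc x)" using r by (auto simp: den_suffixes_def)
    moreover have "count_list r (Suc x) \<le> j" using r by (auto simp: den_suffixes_def intro: count_list_take)
    ultimately show "r \<in> {r. set r \<subseteq> {..Suc x} \<and> length r \<le> length r' + l + j}"
      using r by (auto simp: den_suffixes_def)
  qed
qed (rule finite_lists_length_le; simp)

lemma den_suffixes_0: "den_suffixes x r' 0 j = {}"
proof -
  have False if "r \<in> den_suffixes x r' 0 j" for r
  proof -
    have "last (below (Suc x) r) \<in> set (below (Suc x) r)" "last (below (Suc x) r) = x"
      using that last_in_set unfolding den_suffixes_def last_below_def by blast+
    then have "x \<in> set r" by auto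
    then show False using that by (auto simp: den_suffixes_def count_list_0_iff)
  qed
  then show ?thesis by auto
qed

lemma last_below_Cons:
  "last_below x (a # r) \<longleftrightarrow> (if below (Suc x) r = [] then a = x else last_below x r)"
  by (auto simp: last_below_def)

lemma den_suffixes_rec:
  assumes "l \<ge> 1" "j \<le> length r' + l"
  shows "den_suffixes x r' l j = (if j = 0 then {} else (#) (Suc x) ` den_suffixes x r' l (j - 1))
     \<union> (case r' of [] \<Rightarrow> {} | a # r'' \<Rightarrow> if a < x then (#) a ` den_suffixes x r'' l (j - 1) else {})
     \<union> (#) x ` (if l = 1 \<and> r' = [] then {[]} else den_suffixes x r' (l - 1) (j - 1))"
    (is "_ = ?A \<union> ?B \<union> ?C")
proof (intro equalityI subsetI)
  fix r assume r: "r \<in> den_suffixes x r' l j"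
  then obtain a r2 where ar: "r = a # r2" by (cases r) (auto simp: den_suffixes_def last_below_def)
  have tl: "Suc x \<notin> set (drop (j - 1) r2)"
    using r by (cases j) (auto simp: den_suffixes_def ar)
  have s2: "set r2 \<subseteq> {..Suc x}" using r by (auto simp: den_suffixes_def ar)
  have lb: "last_below x r2" if "below (Suc x) r2 \<noteq> []"
    using r that by (auto simp: den_suffixes_def ar last_below_Cons)
  have a: "a = x" if "below (Suc x) r2 = []"
    using r that by (auto simp: den_suffixes_def ar last_below_Cons)
  have "a \<le> Suc x" using r by (auto simp: den_suffixes_def ar)
  then consider "a = Suc x" | "a < x" | "a = x" by linarith
  then show "r \<in> ?A \<union> ?B \<union> ?C"
  proof cases
    case 1
    then have "j \<noteq> 0" using r by (cases j) (auto simp: den_suffixes_def ar)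
    moreover have "last_below x r2" using lb a 1 by auto
    ultimately have "r \<in> ?A" using r tl s2 1 by (auto simp: den_suffixes_def ar)
    then show ?thesis by simp
  next
    case 2
    then have "last_below x r2" using lb a by auto
    moreover have "r' = a # below x r2" using r 2 by (auto simp: den_suffixes_def ar)
    ultimately have "r \<in> ?B" using r tl s2 2 by (auto simp: den_suffixes_def ar)
    then show ?thesis by simp
  next
    case 3
    have f: "below x r2 = r'" "count_list r2 x = l - 1" using r 3 by (auto simp: den_suffixes_def ar)
    show ?thesis
    proof (cases "below (Suc x) r2 = []")
      case True
      then have n: "\<forall>a\<in>set r2. a = Suc x"
        using s2 by (auto simp: filter_empty_conv intro!: antisym simp del: not_less simp flip: not_less)
      then have "x \<notin> set r2" "\<forall>a\<in>set r2. \<not> a < x" by force+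
      then have "r' = []" "count_list r2 x = 0"
        unfolding f(1)[symmetric] by (simp_all add: count_list_0_iff filter_empty_conv)
      then have "l = 1" "j - 1 = 0" using f(2) assms by auto
      then have "r2 = []" using tl n by (cases r2) auto
      then show ?thesis using \<open>l = 1\<close> \<open>r' = []\<close> 3 by (simp add: ar)
    next
      case False
      then have "r2 \<in> den_suffixes x r' (l - 1) (j - 1)" using f lb tl s2 by (auto simp: den_suffixes_def)
      moreover have "\<not> (l = 1 \<and> r' = [])" using calculation den_suffixes_0 by auto
      ultimately have "r \<in> ?C" using 3 by (auto simp: ar)
      then show ?thesis by simp
    qed
  qed
next
  fix r assume r: "r \<in> ?A \<union> ?B \<union> ?C"
  have ne: "below (Suc x) r2 \<noteq> []" if "last_below x r2" for r2 using that by (simp add: last_below_def)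
  have tl: "Suc x \<notin> set (drop j (a # r2))" if "Suc x \<notin> set (drop (j - 1) r2)" "a \<noteq> Suc x \<or> j \<noteq> 0" for a r2
    using that by (cases j) auto
  from r consider "r \<in> ?A" | "r \<in> ?B" | "r \<in> ?C" by blast
  then show "r \<in> den_suffixes x r' l j"
  proof cases
    case 1
    then obtain r2 where r2: "j \<noteq> 0" "r = Suc x # r2" "r2 \<in> den_suffixes x r' l (j - 1)" by (auto split: if_splits)
    then show ?thesis using tl[of r2 "Suc x"] ne[of r2] by (auto simp: den_suffixes_def last_below_Cons)
  next
    case 2
    then obtain a r'' r2 where r2: "r' = a # r''" "a < x" "r = a # r2" "r2 \<in> den_suffixes x r'' l (j - 1)"
      by (auto split: list.splits if_splits)
    then show ?thesis using tl[of r2 a] ne[of r2] by (auto simp: den_suffixes_def last_below_Cons)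
  next
    case 3
    then obtain r2 where r2: "r = x # r2" "r2 \<in> (if l = 1 \<and> r' = [] then {[]} else den_suffixes x r' (l - 1) (j - 1))" by auto
    show ?thesis
    proof (cases "l = 1 \<and> r' = []")
      case True
      then show ?thesis using r2 by (cases j) (auto simp: den_suffixes_def last_below_def)
    next
      case False
      then have "r2 \<in> den_suffixes x r' (l - 1) (j - 1)" using r2(2) by (simp only: if_False)
      then show ?thesis using tl[of r2 x] ne[of r2] assms(1) r2(1) by (auto simp: den_suffixes_def last_below_Cons)
    qed
  qed
qed

text \<open>Virtual letters may occupy any subset of the first \<open>j\<close> places, since by
  \<open>j \<le> length r' + l\<close> there are enough other letters to fill the gaps; this yields
  the exponents \<open>Suc n\<close> to \<open>n + j\<close>. Independently, the other letters form
  a shuffle of \<open>r'\<close> with \<open>l\<close> copies of \<open>x\<close>, one of them at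
  the end.\<close>

lemma sum_den_suffixes:
  fixes q :: "'a::comm_semiring_1"
  assumes "l \<ge> 1" "j \<le> length r' + l" "set r' \<subseteq> {..<x}"
  shows "(\<Sum>r\<in>den_suffixes x r' l j. f (count_list r (Suc x)) * q ^ (top_sum (Suc x) n j r + max_inv x r))
    = gbinom q (length r') (l - 1) * esum q [Suc n..<Suc (n + j)] f"
  using assms
proof (induction "length r' + l + j" arbitrary: r' l j n f rule: less_induct)
  case less
  let ?R = "\<lambda>a b. a = x \<and> b < x"
  let ?S = "\<lambda>f n j r. f (count_list r (Suc x)) * q ^ (top_sum (Suc x) n j r + pairs ?R r)"
  let ?A = "if j = 0 then {} else (#) (Suc x) ` den_suffixes x r' l (j - 1)"
  let ?B = "case r' of [] \<Rightarrow> {} | a # r'' \<Rightarrow> if a < x then (#) a ` den_suffixes x r'' l (j - 1) else {}"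
  let ?C' = "if l = 1 \<and> r' = [] then {[]} else den_suffixes x r' (l - 1) (j - 1)"
  let ?C = "(#) x ` ?C'"
  let ?e = "esum q [Suc (Suc n)..<Suc (Suc n + (j - 1))]"
  have fin: "finite ?A" "finite ?B" "finite ?C"
    by (auto simp: finite_den_suffixes split: list.splits)
  have A: "(\<Sum>r\<in>?A. ?S f n j r) = (if j = 0 then 0 else q ^ Suc n * (gbinom q (length r') (l - 1) * ?e (\<lambda>t. f (Suc t))))"
  proof (cases "j = 0")
    case False
    have "(\<Sum>r\<in>?A. ?S f n j r) = (\<Sum>r\<in>den_suffixes x r' l (j - 1). ?S f n j (Suc x # r))"
      using False by (simp add: sum.reindex)
    also have "\<dots> = q ^ Suc n * (\<Sum>r\<in>den_suffixes x r' l (j - 1). ?S (\<lambda>t. f (Suc t)) (Suc n) (j - 1) r)"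
      unfolding sum_distrib_left by (rule sum.cong) (use False in \<open>auto simp: power_add mult_ac\<close>)
    also have "(\<Sum>r\<in>den_suffixes x r' l (j - 1). ?S (\<lambda>t. f (Suc t)) (Suc n) (j - 1) r)
        = gbinom q (length r') (l - 1) * ?e (\<lambda>t. f (Suc t))"
      by (rule less.hyps) (use False less.prems in auto)
    finally show ?thesis using False by simp
  qed simp
  have B: "(\<Sum>r\<in>?B. ?S f n j r) = (if r' = [] then 0 else gbinom q (length r' - 1) (l - 1) * ?e f)"
  proof (cases r')
    case (Cons a r'')
    have a: "a < x" using less.prems Cons by simp
    have "(\<Sum>r\<in>?B. ?S f n j r) = (\<Sum>r\<in>den_suffixes x r'' l (j - 1). ?S f n j (a # r))"
      using a by (simp add: Cons sum.reindex)
    also have "\<dots> = (\<Sum>r\<in>den_suffixes x r'' l (j - 1). ?S f (Suc n) (j - 1) r)"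
      by (rule sum.cong) (use a in auto)
    also have "\<dots> = gbinom q (length r'') (l - 1) * ?e f"
      by (rule less.hyps) (use Cons less.prems in auto)
    finally show ?thesis by (simp add: Cons)
  qed simp
  have C: "(\<Sum>r\<in>?C. ?S f n j r) = q ^ length r' * ((if l = 1 then (if r' = [] then 1 else 0) else gbinom q (length r') (l - 2)) * ?e f)"
  proof -
    have "(\<Sum>r\<in>?C. ?S f n j r) = (\<Sum>r\<in>?C'. ?S f n j (x # r))"
      by (simp only: sum.reindex inj_on_Cons1 o_def)
    also have "\<dots> = q ^ length r' * (\<Sum>r\<in>?C'. ?S f (Suc n) (j - 1) r)"
      unfolding sum_distrib_left
    proof (rule sum.cong[OF refl])
      fix r assume "r \<in> ?C'"
      then have "filter (\<lambda>b. b < x) r = r'" by (auto simp: den_suffixes_def split: if_splits)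
      then show "?S f n j (x # r) = q ^ length r' * ?S f (Suc n) (j - 1) r"
        by (simp add: power_add mult_ac)
    qed
    also have "(\<Sum>r\<in>?C'. ?S f (Suc n) (j - 1) r) = (if l = 1 then (if r' = [] then 1 else 0) else gbinom q (length r') (l - 2)) * ?e f"
    proof (cases "l = 1")
      case True
      then show ?thesis using less.prems(2) by (auto simp: den_suffixes_0)
    next
      case False
      then have "(\<Sum>r\<in>den_suffixes x r' (l - 1) (j - 1). ?S f (Suc n) (j - 1) r) = gbinom q (length r') (l - 1 - 1) * ?e f"
        by (intro less.hyps) (use less.prems in auto)
      then show ?thesis using False by (simp add: numeral_2_eq_2)
    qed
    finally show ?thesis .
  qed
  have disj: "?A \<inter> ?B = {}" "(?A \<union> ?B) \<inter> ?C = {}"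
    by (auto split: list.splits if_splits)
  have "(\<Sum>r\<in>den_suffixes x r' l j. ?S f n j r) = (\<Sum>r\<in>?A. ?S f n j r) + (\<Sum>r\<in>?B. ?S f n j r) + (\<Sum>r\<in>?C. ?S f n j r)"
    unfolding den_suffixes_rec[OF less.prems(1,2)]
    by (subst sum.union_disjoint[OF _ fin(3) disj(2)], use fin in simp)
       (subst sum.union_disjoint[OF fin(1,2) disj(1)], rule refl)
  also have "\<dots> = (if j = 0 then 0 else q ^ Suc n * (gbinom q (length r') (l - 1) * ?e (\<lambda>t. f (Suc t))))
     + ((if r' = [] then 0 else gbinom q (length r' - 1) (l - 1))
       + q ^ length r' * (if l = 1 then (if r' = [] then 1 else 0) else gbinom q (length r') (l - 2))) * ?e f"
    unfolding A B C by (cases "r' = []") (simp_all add: algebra_simps del: upt_Suc)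
  also have "(if r' = [] then 0 else gbinom q (length r' - 1) (l - 1))
       + q ^ length r' * (if l = 1 then (if r' = [] then 1 else 0) else gbinom q (length r') (l - 2)) = gbinom q (length r') (l - 1)"
  proof (cases r')
    case Nil
    then show ?thesis by simp
  next
    case (Cons a r'')
    show ?thesis
    proof (cases "l = 1")
      case False
      then obtain l' where "l = Suc (Suc l')" using less.prems(1) by (metis One_nat_def Suc_le_D not0_implies_Suc)
      then show ?thesis by (simp add: Cons)
    qed (simp add: Cons)
  qed
  also have "(if j = 0 then 0 else q ^ Suc n * (gbinom q (length r') (l - 1) * ?e (\<lambda>t. f (Suc t)))) + gbinom q (length r') (l - 1) * ?e f
      = gbinom q (length r') (l - 1) * esum q [Suc n..<Suc (n + j)] f"
  proof (cases j)
    case (Suc j')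
    have "[Suc n..<Suc (n + j)] = Suc n # [Suc (Suc n)..<Suc (Suc n + j')]"
      using upt_conv_Cons[of "Suc n" "Suc (n + j)"] by (simp add: Suc del: upt_Suc)
    then show ?thesis by (simp add: Suc algebra_simps del: upt_Suc)
  qed simp
  finally show ?case .
qed

section \<open>The change of Denert's statistic when the largest letter is removed\<close>

lemma in_set_excs: "b \<in> set (excs ps) \<Longrightarrow> \<exists>a. (a, b) \<in> set ps \<and> a < b"
  by (induction ps rule: excs.induct) (auto split: if_splits)

text \<open>At a place of \<open>y\<close> only the virtual letter \<open>Suc y\<close> is an
  excedance; at a later place nothing is. Hence \<open>top_sum\<close> is the whole sum of excedance
  places here.\<close>

lemma exc_sum_tail:
  assumes "set r \<subseteq> {..Suc y}" "Suc y \<notin> set (drop j r)" "length r \<le> j + i"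
  shows "exc_sum n (zip (replicate j y @ replicate i (Suc y)) r) = top_sum (Suc y) n j r
    \<and> nexcs (zip (replicate j y @ replicate i (Suc y)) r) = below (Suc y) r"
  using assms
proof (induction r arbitrary: n j i)
  case (Cons a r)
  show ?case
  proof (cases j)
    case 0
    then obtain i' where i: "i = Suc i'" using Cons.prems by (cases i) auto
    have "a < Suc y" using Cons.prems 0 by (auto simp: le_Suc_eq)
    then show ?thesis using Cons.IH[of 0 i' "Suc n"] Cons.prems 0 i by auto
  next
    case (Suc j')
    have "y < a \<longleftrightarrow> a = Suc y" using Cons.prems(1) by auto
    then show ?thesis using Cons.IH[of j' i "Suc n"] Cons.prems Suc by auto
  qed
qed simp

text \<open>All excedances in the tail are virtual, and \<open>imv_below\<close> ignores pairs whose
  second letter is virtual. So this term comes from the front part alone.\<close>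

lemma den_zip_append:
  assumes "set r \<subseteq> {..Suc y}" "Suc y \<notin> set (drop j r)" "length r \<le> j + i" "length a = length p"
  shows "den (Suc y) (zip a p @ zip (replicate j y @ replicate i (Suc y)) r)
    = exc_sum 0 (zip a p) + top_sum (Suc y) (length p) j r
      + imv_below (Suc y) (excs (zip a p))
      + pairs (>) (nexcs (zip a p) @ below (Suc y) r)"
proof -
  let ?Z = "zip (replicate j y @ replicate i (Suc y)) r"
  have F: "\<not> b < Suc y" if b: "b \<in> set (excs ?Z)" for b
  proof -
    obtain c where "(c, b) \<in> set ?Z" "c < b" using in_set_excs[OF b] by auto
    moreover from this have "c = y \<or> c = Suc y" by (auto dest!: set_zip_leftD split: if_splits)
    ultimately show ?thesis by auto
  qed
  have "filter (\<lambda>b. b \<le> c \<and> b < Suc y) (excs ?Z) = []" for c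
    using F by (auto simp: filter_empty_conv)
  moreover have "imv_below (Suc y) (excs ?Z) = 0"
    by (rule pairs_eq_0) (use F in auto)
  ultimately have "imv_below (Suc y) (excs (zip a p) @ excs ?Z) = imv_below (Suc y) (excs (zip a p))"
    by (simp add: pairs_append)
  then show ?thesis
    using exc_sum_tail[OF assms(1-3), of "length p"] assms(4)
    by (simp add: den_def exc_sum_append excs_append nexcs_append)
qed

text \<open>The sorted letters at these places are below \<open>x\<close>, so a letter from
  \<open>x\<close> upwards is an excedance both before and after it is lowered to
  \<open>x\<close>.\<close>

lemma zip_map_min:
  assumes "length a = length p" "set a \<subseteq> {..<x}"
  shows "excs (zip a (map (min x) p)) = map (min x) (excs (zip a p))"
    and "nexcs (zip a (map (min x) p)) = nexcs (zip a p)"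
    and "exc_sum n (zip a (map (min x) p)) = exc_sum n (zip a p)"
    and "set (nexcs (zip a p)) \<subseteq> {..<x}"
    and "filter (\<lambda>b. x \<le> b) (excs (zip a p)) = filter (\<lambda>b. x \<le> b) p"
  using assms
proof (induction a p arbitrary: n rule: list_induct2)
  case (Cons c a d p)
  { case 1 then show ?case using Cons.IH by (auto simp: min_def) }
  { case 2 then show ?case using Cons.IH by (auto simp: min_def) }
  { case 3 then show ?case using Cons.IH by (auto simp: min_def) }
  { case 4 then show ?case using Cons.IH by auto }
  { case 5 then show ?case using Cons.IH by auto }
qed auto

text \<open>Lowering to \<open>x\<close> does not affect pairs whose second letter is below
  \<open>x\<close>. Pairs ending in a real \<open>x\<close> are lost, because \<open>x\<close>
  becomes the virtual letter.\<close>

lemma pairs_map_min: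
  assumes "set e \<subseteq> {..Suc x}"
  shows "imv_below (Suc x) e
    = imv_below x (map (min x) e) + max_imv x e"
  using assms
proof (induction e)
  case (Cons a e)
  have "length (filter (\<lambda>b. b \<le> a \<and> b < Suc x) e)
    = length (filter (\<lambda>b. b \<le> min x a \<and> b < x) (map (min x) e)) + length (filter (\<lambda>b. x \<le> a \<and> b = x) e)"
    by (induction e) (auto simp: min_def)
  then show ?case using Cons by simp
qed simp

lemma pairs_insert_max:
  assumes "set n \<subseteq> {..<x}"
  shows "pairs (>) (n @ below (Suc x) r)
    = pairs (>) (n @ below x r) + max_inv x r"
proof -
  let ?r = "below (Suc x) r"
  have f: "below x ?r = below x r"
    unfolding filter_filter by (rule filter_cong) auto
  have "pairs (>) (not_below x ?r) = 0" by (rule pairs_eq_0) auto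
  moreover have "pairs (\<lambda>a b. \<not> a < x \<and> b < x) ?r = max_inv x ?r"
    by (rule pairs_cong) auto
  moreover have "\<dots> = max_inv x r"
    by (rule pairs_filter) auto
  ultimately have "pairs (>) ?r = pairs (>) (below x r) + max_inv x r"
    using pairs_filter_split[of ?r x] f by simp
  moreover have "filter ((>) a) ?r = filter ((>) a) (below x r)" if "a \<in> set n" for a
    unfolding filter_filter by (rule filter_cong) (use assms that in auto)
  then have "map (\<lambda>a. length (filter ((>) a) ?r)) n = map (\<lambda>a. length (filter ((>) a) (below x r))) n"
    by (intro map_cong refl) (simp only:)
  ultimately show ?thesis unfolding pairs_append by (simp only: add_ac)
qed

text \<open>The smaller word lacks three contributions: pairs of excedances in front that end in a
  real \<open>x\<close>, the places of virtual letters among the places of \<open>x\<close>, and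
  inversions of copies of \<open>x\<close> with smaller letters behind them.\<close>

lemma den_stat_append:
  assumes "length p = sum k {1..m}" "set p \<subseteq> {..Suc (Suc m)}" "set r \<subseteq> {..Suc (Suc m)}"
    and "Suc (Suc m) \<notin> set (drop (k (Suc m)) r)"
  shows "den_stat (Suc m) k (p @ r) = den_stat m k (map (min (Suc m)) p @ below (Suc m) r)
    + (max_imv (Suc m) p
      + (top_sum (Suc (Suc m)) (sum k {1..m}) (k (Suc m)) r + max_inv (Suc m) r))"
proof -
  define x where "x = Suc m"
  let ?a = "sorted_word m k" and ?r = "below x r" and ?p = "map (min x) p"
  have a: "length ?a = length p" "length ?a = length ?p" "set ?a \<subseteq> {..<x}"
    using assms set_sorted_word[of m k] by (auto simp: length_sorted_word x_def)
  have zip: "zip (?a @ b) (c @ d) = zip ?a c @ zip b d" if "length ?a = length c" for b c d :: "nat list"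
    using that by simp
  have "den_stat x k (p @ r) = exc_sum 0 (zip ?a p) + top_sum (Suc x) (length p) (k x) r
      + imv_below (Suc x) (excs (zip ?a p))
      + pairs (>) (nexcs (zip ?a p) @ below (Suc x) r)"
    using assms a unfolding den_stat_def x_def sorted_word.simps append_assoc
    by (subst zip) (simp, subst den_zip_append, auto)
  moreover have "den_stat m k (?p @ ?r) = exc_sum 0 (zip ?a ?p) + top_sum x (length ?p) 0 ?r
      + imv_below x (excs (zip ?a ?p))
      + pairs (>) (nexcs (zip ?a ?p) @ below x ?r)"
  proof -
    have z: "zip (?a @ replicate (length (?p @ ?r)) (Suc m)) (?p @ ?r)
        = zip ?a ?p @ zip (replicate 0 m @ replicate (length (?p @ ?r)) (Suc m)) ?r"
      by (subst zip) (use a in auto)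
    have "den (Suc m) (zip ?a ?p @ zip (replicate 0 m @ replicate (length (?p @ ?r)) (Suc m)) ?r)
      = exc_sum 0 (zip ?a ?p) + top_sum (Suc m) (length ?p) 0 ?r
      + imv_below (Suc m) (excs (zip ?a ?p))
      + pairs (>) (nexcs (zip ?a ?p) @ below (Suc m) ?r)"
      by (rule den_zip_append) (use a in \<open>auto simp: x_def\<close>)
    then show ?thesis unfolding den_stat_def z by (simp only: x_def)
  qed
  moreover have "imv_below (Suc x) (excs (zip ?a p))
      = imv_below x (map (min x) (excs (zip ?a p))) + max_imv x (excs (zip ?a p))"
  proof (rule pairs_map_min)
    show "set (excs (zip ?a p)) \<subseteq> {..Suc x}"
      using excs_subset[of "zip ?a p"] assms(2) by (fastforce simp: x_def dest: set_zip_rightD)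
  qed
  moreover have "max_imv x (excs (zip ?a p)) = max_imv x p"
    using pairs_filter[of "\<lambda>a b. x \<le> a \<and> b = x" "\<lambda>b. x \<le> b" "excs (zip ?a p)"]
      pairs_filter[of "\<lambda>a b. x \<le> a \<and> b = x" "\<lambda>b. x \<le> b" p]
    by (simp add: zip_map_min(5)[OF a(1,3)])
  moreover have "pairs (>) (nexcs (zip ?a p) @ below (Suc x) r)
      = pairs (>) (nexcs (zip ?a p) @ ?r) + max_inv x r"
    by (rule pairs_insert_max) (rule zip_map_min(4)[OF a(1,3)])
  ultimately show ?thesis
    using assms(1) by (simp add: zip_map_min(1-3)[OF a(1,3)] flip: x_def)
qed

section \<open>Decomposition of the words and the induction for Denert's statistic\<close>

lemma filter_eq_replicate_count: "not_below x (below (Suc x) v) = replicate (count_list v x) x"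
  by (induction v) auto

lemma filter_map_min:
  fixes x :: nat
  shows "below x (map (min x) p) = below x p"
  by (induction p) (auto simp: min_def)

text \<open>In the first \<open>n\<close> places real and virtual top letters are merged, behind
  them both are deleted. What remains free is the number \<open>c\<close> of real copies in front
  and, given \<open>c\<close>, independent choices for the two parts.\<close>

lemma den_words_fibre:
  assumes k: "k (Suc m) \<ge> 1" and b: "b \<in> den_words m k"
  defines "x \<equiv> Suc m" and "n \<equiv> sum k {1..m}"
  shows "{v \<in> den_words x k. map (min x) (take n v) @ below x (drop n v) = b}
    = (\<lambda>(c, p, r). p @ r) ` (SIGMA c:{..k x}. den_prefixes x (take n b) c \<times> den_suffixes x (drop n b) (k x - c) (k x))"
    (is "?L = ?h ` ?R")
proof -
  have sum: "sum k {1..x} = n + k x" by (simp add: x_def n_def)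
  have ow: "w \<in> ordered_words x k \<longleftrightarrow> below x w \<in> ordered_words m k
    \<and> not_below x w = replicate (k x) x \<and> last w = x" for w
    using ordered_words_Suc[of k m w] k by (simp add: x_def)
  have ff: "below x (below (Suc x) v) = below x v" for v
    unfolding filter_filter by (rule filter_cong) auto
  have b': "set b \<subseteq> {..x}" "below x b \<in> ordered_words m k" "x \<notin> set (drop n b)"
    using b by (auto simp: den_words_def x_def n_def)
  have len_f: "length (below x b) = n" using length_ordered_word[OF b'(2)] by (simp add: n_def)
  have len_b: "length b = n + count_list b x"
    using length_eq_filter_count[of b m] b'(1) len_f by (simp add: x_def)
  have dr: "below x (drop n b) = drop n b"
    unfolding filter_id_conv
  proof
    fix a assume a: "a \<in> set (drop n b)"
    then have "a \<le> x" "a \<noteq> x" using b'(1,3) in_set_dropD[OF a] by auto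
    then show "a < x" by simp
  qed
  show ?thesis
  proof (intro equalityI subsetI)
    fix v assume v: "v \<in> ?L"
    define p r where "p = take n v" and "r = drop n v"
    have vpr: "v = p @ r" by (simp add: p_def r_def)
    have vw: "set v \<subseteq> {..Suc x}" "below (Suc x) v \<in> ordered_words x k" "Suc x \<notin> set (drop (n + k x) v)"
      using v unfolding den_words_def sum by blast+
    have "length (below (Suc x) v) = n + k x" using length_ordered_word[OF vw(2)] sum by simp
    then have "n \<le> length v" using length_filter_le[of "\<lambda>a. a < Suc x" v] by linarith
    then have lp: "length p = n" by (simp add: p_def)
    have mp: "map (min x) p = take n b" "below x r = drop n b"
      using v lp by (auto simp: p_def r_def)
    have cnt: "count_list v x = k x"
      using vw(2) unfolding ow filter_eq_replicate_count by (metis length_replicate)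
    then have cnt_r: "count_list p x \<le> k x" "count_list r x = k x - count_list p x" by (auto simp: vpr)
    have set_pr: "set p \<subseteq> {..Suc x}" "set r \<subseteq> {..Suc x}" using vw(1) by (auto simp: vpr)
    have p: "p \<in> den_prefixes x (take n b) (count_list p x)" using mp set_pr by (simp add: den_prefixes_def)
    \<comment> \<open>The closing copy of \<open>x\<close> lies in \<open>r\<close>: if
      \<open>r\<close> held only virtual letters, the base would end after \<open>n\<close> places
      and contain no virtual letter, so no \<open>x\<close> could stand in \<open>p\<close> and all
      \<open>k x\<close> copies would be in \<open>r\<close>.\<close>
    have ne: "below (Suc x) r \<noteq> []"
    proof
      assume e: "below (Suc x) r = []"
      have "below x r = []" using e by (auto simp: filter_empty_conv)
      then have "length b \<le> n" using mp(2) by simp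
      then have "count_list b x = 0" using len_b by simp
      then have "count_list (take n b) x = 0" by (metis append_take_drop_id add_is_0 count_list_append)
      then have "count_list p x = 0" using count_list_den_prefix(2)[OF p] by simp
      then have "count_list r x \<noteq> 0" using cnt_r k by (simp add: x_def)
      then have "x \<in> set r" by (simp add: count_list_0_iff)
      then show False using e by (auto simp: filter_empty_conv)
    qed
    have "last (below (Suc x) v) = x" using vw(2) ow by blast
    then have "last_below x r" using ne by (simp add: vpr last_below_def)
    moreover have "Suc x \<notin> set (drop (k x) r)" using vw(3) by (simp add: r_def add.commute)
    ultimately have "r \<in> den_suffixes x (drop n b) (k x - count_list p x) (k x)"
      using mp set_pr cnt_r by (simp add: den_suffixes_def)
    then have "(count_list p x, p, r) \<in> ?R" using p cnt_r by simp
    then show "v \<in> ?h ` ?R" unfolding vpr by (rule rev_image_eqI) simp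
  next
    fix v assume "v \<in> ?h ` ?R"
    then obtain c p r where v: "v = p @ r" "c \<le> k x" "p \<in> den_prefixes x (take n b) c" "r \<in> den_suffixes x (drop n b) (k x - c) (k x)"
      by auto
    have p: "map (min x) p = take n b" "set p \<subseteq> {..Suc x}" "count_list p x = c" using v(3) by (auto simp: den_prefixes_def)
    have r: "below x r = drop n b" "set r \<subseteq> {..Suc x}" "count_list r x = k x - c" "Suc x \<notin> set (drop (k x) r)"
        "last_below x r"
      using v(4) by (auto simp: den_suffixes_def)
    have lp: "length p = n" using arg_cong[OF p(1), of length] len_b by simp
    have "below x v = below x (take n b) @ below x (drop n b)"
      by (simp add: v(1) r(1) dr filter_map_min flip: p(1))
    then have fv: "below x v = below x b" by (metis append_take_drop_id filter_append)
    have "count_list v x = k x" using p r v by simp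
    moreover have "last (below (Suc x) v) = x" using r(5) by (simp add: v(1) last_below_def)
    ultimately have "below (Suc x) v \<in> ordered_words x k"
      unfolding ow ff fv filter_eq_replicate_count using b'(2) by simp
    moreover have "drop (n + k x) v = drop (k x) r" using lp by (simp add: v(1))
    ultimately have "v \<in> den_words x k" using p(2) r(2,4) unfolding den_words_def sum by (simp add: v(1))
    moreover have "map (min x) (take n v) @ below x (drop n v) = b"
      using lp p(1) r(1) by (simp add: v(1))
    ultimately show "v \<in> ?L" by simp
  qed
qed

lemma sum_den_words_Suc:
  fixes q :: "'a::comm_semiring_1"
  assumes IH: "\<And>f. (\<Sum>v\<in>den_words m k. f (count_list v (Suc m)) * q ^ den_stat m k v)
      = word_poly q m k * esum q [1..<Suc (sum k {1..m})] f"
    and k: "k (Suc m) \<ge> 1"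
  shows "(\<Sum>v\<in>den_words (Suc m) k. f (count_list v (Suc (Suc m))) * q ^ den_stat (Suc m) k v)
      = word_poly q (Suc m) k * esum q [1..<Suc (sum k {1..Suc m})] f"
proof -
  define x where "x = Suc m"
  define n where "n = sum k {1..m}"
  define K where "K = k x"
  let ?T = "\<lambda>v. f (count_list v (Suc x)) * q ^ den_stat x k v"
  let ?F = "\<lambda>s. esum q [Suc n..<Suc (n + K)] (\<lambda>t. f (s + t))"
  let ?base = "\<lambda>v. map (min x) (take n v) @ below x (drop n v)"
  let ?P = "max_imv x"
  let ?Q = "\<lambda>r. top_sum (Suc x) n K r + max_inv x r"
  obtain K' where K': "K = Suc K'" using k by (cases K) (auto simp: K_def x_def)
  have base: "?base v \<in> den_words m k" if "v \<in> den_words x k" for v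
  proof -
    have v: "set v \<subseteq> {..Suc x}" "below (Suc x) v \<in> ordered_words x k"
      using that by (auto simp: den_words_def)
    have "below x (below (Suc x) v) \<in> ordered_words m k"
      using v(2) ordered_words_Suc[of k m "below (Suc x) v"] k by (simp add: x_def)
    moreover have "below x (below (Suc x) v) = below x v"
      unfolding filter_filter by (rule filter_cong) auto
    moreover have "below x (?base v) = below x v"
    proof -
      have "below x (?base v) = below x (take n v) @ below x (drop n v)"
        by (simp add: filter_map_min)
      then show ?thesis by (metis append_take_drop_id filter_append)
    qed
    ultimately have 1: "below x (?base v) \<in> ordered_words m k" by simp
    have "length (below x (?base v)) = n" using length_ordered_word[OF 1] by (simp add: n_def)
    have lv: "n \<le> length v"
      using length_ordered_word[OF v(2)] length_filter_le[of "\<lambda>a. a < Suc x" v] by (simp add: n_def x_def)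
    then have "drop n (?base v) = below x (drop n v)" by simp
    then have "x \<notin> set (drop n (?base v))" by simp
    moreover have "set (?base v) \<subseteq> {..x}" by auto
    ultimately show ?thesis using 1 by (simp add: den_words_def n_def x_def)
  qed
  have fibre: "(\<Sum>v\<in>{v \<in> den_words x k. ?base v = b}. ?T v)
      = msum q (count_list b x) K ?F * q ^ den_stat m k b" if b: "b \<in> den_words m k" for b
  proof -
    define t where "t = count_list b x"
    let ?G = "\<lambda>c r. f (t - c + count_list r (Suc x)) * q ^ ?Q r" and ?D = "q ^ den_stat m k b"
    \<comment> \<open>The value 0 at \<open>c = K\<close> is genuine: with all copies in front, none
      would be left to end the word.\<close>
    let ?H = "\<lambda>c. if c = K then 0 else gbinom q t (K' - c) * ?F (t - c)"
    define p' r' where "p' = take n b" and "r' = drop n b"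
    have b': "set b \<subseteq> {..x}" "below x b \<in> ordered_words m k" "x \<notin> set r'"
      using b by (auto simp: den_words_def x_def n_def r'_def)
    have len_b: "length b = n + t"
      using length_eq_filter_count[of b m] b'(1) length_ordered_word[OF b'(2)] by (simp add: x_def n_def t_def)
    have b_eq: "b = p' @ r'" by (simp add: p'_def r'_def)
    have cnt: "count_list p' x = t" using b'(3) by (simp add: t_def b_eq count_list_0_iff)
    \<comment> \<open>Behind its first \<open>n\<close> places the base has as many letters as it
      has virtual ones in front. So both factors involve the same \<open>t\<close>, as
      \<open>msum_eq_sum\<close> requires.\<close>
    have r': "length r' = t" "set r' \<subseteq> {..<x}" "set p' \<subseteq> {..x}"
    proof -
      show "length r' = t" using len_b by (simp add: r'_def)
      show "set p' \<subseteq> {..x}" using b'(1) unfolding b_eq by simp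
      show "set r' \<subseteq> {..<x}"
      proof
        fix a assume a: "a \<in> set r'"
        then have "a \<le> x" "a \<noteq> x" using b'(1,3) unfolding b_eq by auto
        then show "a \<in> {..<x}" by simp
      qed
    qed
    let ?A = "\<lambda>c. den_prefixes x p' c" and ?B = "\<lambda>c. den_suffixes x r' (K - c) K"
    have inj: "inj_on (\<lambda>(c, p, r). p @ r) (SIGMA c:{..K}. ?A c \<times> ?B c)"
    proof (rule inj_onI, clarsimp)
      fix c p r c2 p2 r2
      assume "p \<in> ?A c" "p2 \<in> ?A c2" "p @ r = p2 @ r2"
      moreover from this have "length p = length p2" by (auto simp: den_prefixes_def dest: map_eq_imp_length_eq)
      ultimately show "c = c2 \<and> p = p2 \<and> r = r2" by (auto simp: den_prefixes_def)
    qed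
    have stat: "f (count_list (p @ r) (Suc x)) * q ^ den_stat x k (p @ r)
      = ?D * (q ^ ?P p * (?G c r))"
      if "p \<in> ?A c" "r \<in> ?B c" for c p r
    proof -
      have p: "map (min x) p = p'" "set p \<subseteq> {..Suc x}" using that(1) by (auto simp: den_prefixes_def)
      have r: "below x r = r'" "set r \<subseteq> {..Suc x}" "Suc x \<notin> set (drop K r)" using that(2) by (auto simp: den_suffixes_def)
      have "length p = n" using arg_cong[OF p(1), of length] len_b by (simp add: p'_def)
      then have "den_stat x k (p @ r) = den_stat m k b + (?P p + ?Q r)"
        using den_stat_append[of p k m r] p r unfolding x_def[symmetric] n_def[symmetric] K_def[symmetric] b_eq by simp
      then show ?thesis using count_list_den_prefix(1)[OF that(1)] cnt by (simp add: power_add mult_ac)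
    qed
    have "(\<Sum>v\<in>{v \<in> den_words x k. ?base v = b}. ?T v)
      = (\<Sum>(c, p, r)\<in>(SIGMA c:{..K}. ?A c \<times> ?B c). f (count_list (p @ r) (Suc x)) * q ^ den_stat x k (p @ r))"
      using den_words_fibre[OF k b] inj
      by (simp only: x_def[symmetric] n_def[symmetric] K_def[symmetric] p'_def[symmetric] r'_def[symmetric])
         (simp add: sum.reindex case_prod_unfold)
    also have "\<dots> = (\<Sum>(c, p, r)\<in>(SIGMA c:{..K}. ?A c \<times> ?B c).
        ?D * (q ^ ?P p * (?G c r)))"
    proof (rule sum.cong[OF refl])
      fix z assume "z \<in> (SIGMA c:{..K}. ?A c \<times> ?B c)"
      then obtain c p r where z: "z = (c, p, r)" "p \<in> ?A c" "r \<in> ?B c" by auto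
      show "(case z of (c, p, r) \<Rightarrow> f (count_list (p @ r) (Suc x)) * q ^ den_stat x k (p @ r))
        = (case z of (c, p, r) \<Rightarrow> ?D * (q ^ ?P p * (?G c r)))"
        unfolding z(1) prod.case by (rule stat[OF z(2,3)])
    qed
    also have "\<dots> = (\<Sum>c\<le>K. \<Sum>(p, r)\<in>?A c \<times> ?B c. ?D * (q ^ ?P p * (?G c r)))"
      by (subst sum.Sigma[symmetric]) (auto simp: finite_den_prefixes finite_den_suffixes case_prod_unfold)
    also have "\<dots> = (\<Sum>c\<le>K. ?D * (qsub q t c * ?H c))"
    proof (rule sum.cong[OF refl])
      fix c assume c: "c \<in> {..K}"
      have "(\<Sum>(p, r)\<in>?A c \<times> ?B c. ?D * (q ^ ?P p * (?G c r)))
        = ?D * ((\<Sum>p\<in>?A c. q ^ ?P p) * (\<Sum>r\<in>?B c. ?G c r))"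
        by (subst sum.cartesian_product[symmetric], subst sum_product) (simp only: sum_distrib_left)
      also have "(\<Sum>p\<in>?A c. q ^ ?P p) = qsub q t c"
        using sum_den_prefixes[OF r'(3)] by (simp add: cnt)
      also have "qsub q t c * (\<Sum>r\<in>?B c. ?G c r)
        = qsub q t c * ?H c"
      proof (cases "c \<le> t")
        case True
        show ?thesis
        proof (cases "c = K")
          case False
          then have "(\<Sum>r\<in>?B c. ?G c r)
            = gbinom q (length r') (K - c - 1) * ?F (t - c)"
            using c r' True by (intro sum_den_suffixes[where f = "\<lambda>s. f (t - c + s)"]) auto
          moreover have "K - c - 1 = K' - c" using False c K' by simp
          ultimately show ?thesis using False r'(1) by simp
        qed (simp add: den_suffixes_0)
      qed (simp add: qsub_eq_0)
      finally show "(\<Sum>(p, r)\<in>?A c \<times> ?B c. ?D * (q ^ ?P p * (?G c r)))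
        = ?D * (qsub q t c * ?H c)" .
    qed
    also have "\<dots> = ?D * (\<Sum>c\<le>K'. qsub q t c * gbinom q t (K' - c) * ?F (t - c))"
    proof -
      have "(\<Sum>c\<le>K'. qsub q t c * ?H c)
        = (\<Sum>c\<le>K'. qsub q t c * gbinom q t (K' - c) * ?F (t - c))"
        by (rule sum.cong) (auto simp: K' mult.assoc)
      then show ?thesis
        unfolding sum_distrib_left[symmetric] K' sum.atMost_Suc by (simp add: K' del: upt_Suc)
    qed
    also have "\<dots> = msum q t K ?F * ?D"
      unfolding K' msum_eq_sum by (simp only: mult.commute)
    finally show ?thesis by (simp only: t_def)
  qed
  have "(\<Sum>v\<in>den_words x k. ?T v)
      = (\<Sum>b\<in>den_words m k. \<Sum>v\<in>{v \<in> den_words x k. ?base v = b}. ?T v)"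
    by (rule sum.group[symmetric]) (use base in auto)
  also have "\<dots> = (\<Sum>b\<in>den_words m k. msum q (count_list b x) K ?F * q ^ den_stat m k b)"
    using fibre by (rule sum.cong[OF refl])
  also have "\<dots> = word_poly q m k * esum q [1..<Suc n] (\<lambda>t. msum q t K ?F)"
    unfolding x_def n_def by (rule IH)
  also have "esum q [1..<Suc n] (\<lambda>t. msum q t K ?F) = gbinom q n K' * esum q [1..<Suc n] ?F"
    unfolding K' by (rule esum_msum)
  \<comment> \<open>New virtual letters on the \<open>K\<close> places of \<open>x\<close> carry the
    place numbers \<open>n + 1\<close> to \<open>n + K\<close>, exactly the missing
    exponents.\<close>
  also have "esum q [1..<Suc n] ?F = esum q [1..<Suc (n + K)] f"
    using upt_add_eq_append[of 1 "Suc n" K] by (simp add: esum_append[symmetric] del: upt_Suc)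
  finally show ?thesis
    using K' by (simp add: word_poly_Suc mult.assoc x_def n_def K_def del: upt_Suc)
qed

lemma sum_den_words:
  fixes q :: "'a::comm_semiring_1"
  assumes "\<And>i. i \<in> {1..m} \<Longrightarrow> k i \<ge> 1"
  shows "(\<Sum>v\<in>den_words m k. f (count_list v (Suc m)) * q ^ den_stat m k v)
      = word_poly q m k * esum q [1..<Suc (sum k {1..m})] f"
  using assms
proof (induction m arbitrary: f)
  case 0
  have "den_words 0 k = {[]}"
  proof (intro equalityI subsetI)
    fix v assume "v \<in> den_words 0 k"
    then have "filter (\<lambda>a. a < Suc 0) v = []" "Suc 0 \<notin> set v" "set v \<subseteq> {..Suc 0}"
      by (auto simp: den_words_def)
    then show "v \<in> {[]}" by (cases v) (auto simp: le_Suc_eq split: if_splits)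
  qed (auto simp: den_words_def)
  then show ?case by (simp add: den_stat_def den_def)
next
  case (Suc m)
  show ?case by (rule sum_den_words_Suc) (use Suc in auto)
qed

theorem sum_DEN:
  fixes q :: "'a::comm_semiring_1"
  assumes "\<And>i. i \<in> {1..m} \<Longrightarrow> k i \<ge> 1"
  shows "(\<Sum>w\<in>ordered_words m k. q ^ DEN w) = word_poly q m k"
proof -
  have DEN: "DEN w = den_stat m k w" if w: "w \<in> ordered_words m k" for w
  proof -
    have "length (sorted_word m k) = length w" using length_ordered_word[OF w] by (simp add: length_sorted_word)
    moreover have "DEN w = den (Suc m) (zip (sort w) w)"
      by (rule DEN_eq_den) (use set_ordered_word[OF w] in auto)
    ultimately show ?thesis by (simp add: den_stat_def sort_ordered_word[OF w] zip_append1)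
  qed
  have set: "{v \<in> den_words m k. count_list v (Suc m) = 0} = ordered_words m k"
  proof (intro equalityI subsetI)
    fix v assume v: "v \<in> {v \<in> den_words m k. count_list v (Suc m) = 0}"
    have "\<forall>a\<in>set v. a < Suc m"
    proof
      fix a assume a: "a \<in> set v"
      have "a \<le> Suc m" "a \<noteq> Suc m" using v a by (auto simp: den_words_def count_list_0_iff)
      then show "a < Suc m" by simp
    qed
    then have "below (Suc m) v = v" by (simp add: filter_id_conv)
    then show "v \<in> ordered_words m k" using v by (simp add: den_words_def)
  next
    fix v assume v: "v \<in> ordered_words m k"
    then have s: "set v \<subseteq> {1..m}" by (rule set_ordered_word)
    then have "below (Suc m) v = v" by (auto simp: filter_id_conv)
    moreover have "Suc m \<notin> set v" using s by auto
    ultimately show "v \<in> {v \<in> den_words m k. count_list v (Suc m) = 0}"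
      using v s by (auto simp: den_words_def count_list_0_iff dest: in_set_dropD)
  qed
  have "(\<Sum>w\<in>ordered_words m k. q ^ DEN w) = (\<Sum>v\<in>{v \<in> den_words m k. count_list v (Suc m) = 0}. q ^ den_stat m k v)"
    unfolding set by (rule sum.cong) (auto simp: DEN)
  also have "\<dots> = (\<Sum>v\<in>den_words m k. if count_list v (Suc m) = 0 then q ^ den_stat m k v else 0)"
    by (rule sum.inter_filter) simp
  also have "\<dots> = (\<Sum>v\<in>den_words m k. (if count_list v (Suc m) = 0 then 1 else 0) * q ^ den_stat m k v)"
    by (rule sum.cong) auto
  also have "\<dots> = word_poly q m k"
    using assms by (subst sum_den_words) (simp_all add: esum_delta del: upt_Suc)
  finally show ?thesis .
qed

section \<open>The order of the last occurrences\<close>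

lemma last_occ_Cons:
  assumes "b \<in> set (a # w)"
  shows "last_occ (a # w) b = (if b \<in> set w then Suc (last_occ w b) else 0)"
proof -
  let ?S = "{i. i < length w \<and> w ! i = b}"
  have eq: "{i. i < length (a # w) \<and> (a # w) ! i = b} = (if a = b then {0} else {}) \<union> Suc ` ?S"
  proof (intro equalityI subsetI)
    fix i assume "i \<in> {i. i < length (a # w) \<and> (a # w) ! i = b}"
    then show "i \<in> (if a = b then {0} else {}) \<union> Suc ` ?S" by (cases i) auto
  qed (auto split: if_splits)
  show ?thesis
  proof (cases "b \<in> set w")
    case True
    then have ne: "?S \<noteq> {}" by (auto simp: in_set_conv_nth)
    have "Max (Suc ` ?S) = Suc (Max ?S)"
      using ne by (intro mono_Max_commute[symmetric]) (auto simp: mono_def)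
    then show ?thesis using True ne unfolding last_occ_def eq by (cases "a = b") simp_all
  next
    case False
    then have "?S = {}" "a = b" using assms by auto
    then have "{i. i < length (a # w) \<and> (a # w) ! i = b} = {0}"
      unfolding eq by (simp only: image_empty Un_empty_right if_True simp_thms)
    then show ?thesis using False unfolding last_occ_def by simp
  qed
qed

text \<open>A letter \<open>a\<close> put in front shifts the last occurrences of the letters of
  \<open>w\<close> by one. If it does not recur, its own last occurrence is 0, so it has to be
  smaller than all others.\<close>

lemma last_ordered_iff_strict_mono_on: "last_ordered w \<longleftrightarrow> strict_mono_on (set w) (last_occ w)"
proof (induction w)
  case Nil
  then show ?case by (simp add: strict_mono_on_def)
next
  case (Cons a w)
  have 1: "strict_mono_on (set w) (last_occ (a # w)) \<longleftrightarrow> strict_mono_on (set w) (last_occ w)"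
    unfolding strict_mono_on_def by (intro all_cong1) (auto simp: last_occ_Cons)
  show ?case
  proof (cases "a \<in> set w")
    case True
    then show ?thesis using Cons 1 by (simp add: insert_absorb)
  next
    case False
    have "strict_mono_on (set (a # w)) (last_occ (a # w)) \<longleftrightarrow> strict_mono_on (set w) (last_occ (a # w)) \<and> (\<forall>b\<in>set w. a < b)"
    proof (intro iffI conjI ballI)
      assume s: "strict_mono_on (set (a # w)) (last_occ (a # w))"
      show "strict_mono_on (set w) (last_occ (a # w))"
        using s by (auto simp: strict_mono_on_def)
      fix b assume b: "b \<in> set w"
      have "\<not> b < a"
      proof
        assume "b < a"
        then have "last_occ (a # w) b < last_occ (a # w) a" using s b by (auto simp: strict_mono_on_def)
        then show False using False by (simp add: last_occ_Cons)
      qed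
      then show "a < b" using b False by (metis linorder_neqE_nat)
    next
      assume s: "strict_mono_on (set w) (last_occ (a # w)) \<and> (\<forall>b\<in>set w. a < b)"
      then show "strict_mono_on (set (a # w)) (last_occ (a # w))"
        using False by (auto simp: strict_mono_on_def last_occ_Cons dest: less_asym)
    qed
    then show ?thesis using Cons 1 False by simp
  qed
qed

lemma partition_words_eq:
  assumes "\<And>i. i \<in> {1..m} \<Longrightarrow> k i \<ge> 1"
  shows "partition_words m k = ordered_words m k"
proof -
  have C: "set_mset (type_mset m k) = {1..m}"
    using assms by (auto simp: count_type_mset set_mset_def Suc_le_eq)
  have "set w = {1..m}" if "mset w = type_mset m k" for w
    using that C by (metis set_mset_mset)
  then show ?thesis
    by (auto simp: partition_words_def ordered_words_def permutations_of_multiset_def last_ordered_iff_strict_mono_on)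
qed

theorem theorem2p1:
  fixes m d r :: nat and k :: "nat \<Rightarrow> nat"
  assumes "\<And>i. i \<in> {1..m} \<Longrightarrow> k i \<ge> 1"
    and "d \<ge> 1"
    and "r \<ge> 1"
  shows "gen_poly (partition_words m k) INV = gen_poly (partition_words m k) MAJ
    \<and> gen_poly (partition_words m k) MAJ = gen_poly (partition_words m k) (MAJd d)
    \<and> gen_poly (partition_words m k) (MAJd d) = gen_poly (partition_words m k) Zstat
    \<and> gen_poly (partition_words m k) Zstat = gen_poly (partition_words m k) (rMAJ r)
    \<and> gen_poly (partition_words m k) (rMAJ r) = gen_poly (partition_words m k) DEN
    \<and> gen_poly (partition_words m k) DEN = gen_poly (partition_words m k) MAK
    \<and> gen_poly (partition_words m k) MAK = gen_poly (partition_words m k) MAD"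
proof -
  define q where "q = (monom 1 1 :: int poly)"
  have P: "partition_words m k = ordered_words m k"
    by (rule partition_words_eq) (rule assms(1))
  have gen: "gen_poly (partition_words m k) st = (\<Sum>w\<in>ordered_words m k. q ^ st w)" for st
    unfolding P by (simp add: gen_poly_def q_def monom_power)
  have MAJdr: "(\<Sum>w\<in>ordered_words m k. q ^ MAJdr d r w) = word_poly q m k" if "d \<ge> 1" "r \<ge> 1" for d r
    using sum_MAJdr[OF that, of q m k] sum_INV[OF assms(1), where q = q] by simp
  show ?thesis
    unfolding gen MAJ_eq_MAJdr MAJd_eq_MAJdr rMAJ_eq_MAJdr
    by (simp only: MAJdr[OF order_refl order_refl] MAJdr[OF assms(2) order_refl] MAJdr[OF order_refl assms(3)]
        sum_INV[OF assms(1)] sum_Zstat[OF assms(1)] sum_DEN[OF assms(1)] sum_MAK[OF assms(1)] sum_MAD[OF assms(1)] simp_thms)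
qed

end
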